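(* Let $K\subseteq\mathbb{R}^n$ be a compact convex subset with non-empty interior. For $r\in\mathbb{N}\cup\{\infty\}$, regard $\operatorname{Diff}^{C^r}_{\partial K}(K)$ as a smooth manifold modelled on $C^r_{\partial K}(K,\mathbb{R}^n)$ with global chart $\phi\mapsto\phi-\operatorname{id}_K$. (1) For each $r\in\mathbb{N}$, $\operatorname{Diff}^{C^r}_{\partial K}(K)$ is a smooth Banach manifold with a global chart, it is a topological group, and for every $\phi\in\operatorname{Diff}^{C^r}_{\partial K}(K)$ the right translation $$\rho_\phi\colon\operatorname{Diff}^{C^r}_{\partial K}(K)\to\operatorname{Diff}^{C^r}_{\partial K}(K),\quad\psi\mapsto\psi\circ\phi$$ is smooth. (2) For all $r\in\mathbb{N}\cup\{\infty\}$ and $s\in\mathbb{N}_0\cup\{\infty\}$, the composition map $$\operatorname{Diff}^{C^{r+s}}_{\partial K}(K)\times\operatorname{Diff}^{C^r}_{\partial K}(K)\to\operatorname{Diff}^{C^r}_{\partial K}(K),\quad(\psi,\phi)\mapsto\psi\circ\phi$$ and the inversion map $$\operatorname{Diff}^{C^{r+s}}_{\partial K}(K)\to\operatorname{Diff}^{C^r}_{\partial K}(K),\quad\phi\mapsto\phi^{-1}$$ are $C^s$.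
   Context: All locally convex spaces are real and Hausdorff; $\mathbb{N}=\{1,2,\dots\}$, $\mathbb{N}_0=\mathbb{N}\cup\{0\}$. $C^r$-maps (Bastiani/Keller $C^r_c$). Let $E,F$ be locally convex spaces, $r\in\mathbb{N}_0\cup\{\infty\}$. For $U\subseteq E$ open, $f\colon U\to F$ is $C^r$ if it is continuous, the iterated directional derivatives $d^{(k)}f(x,y_1,\dots,y_k)=(D_{y_k}\cdots D_{y_1}f)(x)$ exist for all $k\in\mathbb{N}$, $k\le r$, $x\in U$, $y_i\in E$, and all $d^{(k)}f\colon U\times E^k\to F$ are continuous. If $U\subseteq E$ is a subset with dense interior $U^0$ that is locally convex (every $x\in U$ has a convex neighbourhood in $U$), then $f\colon U\to F$ is $C^r$ if $f$ is continuous, $f|_{U^0}$ is $C^r$ and each $d^{(k)}(f|_{U^0})$ ($k\le r$) has a continuous extension $d^{(k)}f\colon U\times E^k\to F$. Smooth means $C^\infty$. The space $C^r(U,F)$ of $C^r$-maps carries the compact-open $C^r$-topology, i.e. the initial topology with respect to the maps $f\mapsto d^{(k)}f\in C(U\times E^k,F)$ ($k\in\mathbb{N}_0$, $k\le r$, $d^{(0)}f=f$), with compact-open topologies on the targets. $\operatorname{Diff}^{C^r}_{\partial K}(K)$ is the group (under composition) of all bijections $\phi\colon K\to K$ such that $\phi$ and $\phi^{-1}$ are $C^r$ and $\phi|_{\partial K}=\operatorname{id}_{\partial K}$. $C^r_{\partial K}(K,\mathbb{R}^n)$ is the closed vector subspace of all $\gamma\in C^r(K,\mathbb{R}^n)$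 with $\gamma|_{\partial K}=0$. The set $\{\phi-\operatorname{id}_K:\phi\in\operatorname{Diff}^{C^r}_{\partial K}(K)\}$ is open in $C^r_{\partial K}(K,\mathbb{R}^n)$, and $\operatorname{Diff}^{C^r}_{\partial K}(K)$ is given the manifold structure for which $\phi\mapsto\phi-\operatorname{id}_K$ is a global chart onto this set. *)

theory Defs
  imports
    "HOL-Analysis.Analysis"
    "HOL-Library.Function_Algebras"
    "HOL-Library.Extended_Nat"
    "HOL-Algebra.Group"
begin

instantiation "fun" :: (type, scaleR) scaleR
begin

definition scaleR_fun_def: "c *\<^sub>R f = (\<lambda>x. c *\<^sub>R f x)"
instance ..

end

lemma scaleR_fun_apply [simp]: "(c *\<^sub>R f) x = c *\<^sub>R f x"
  by (simp add: scaleR_fun_def)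

instance "fun" :: (type, real_vector) real_vector
  by standard (simp_all add: fun_eq_iff algebra_simps)

text \<open>
  A topological vector space is given by a topology \<open>T\<close> on a type of class
  \<open>real_vector\<close> whose \<open>topspace\<close>, the underlying set of the space, is a linear subspace.
  Explicit topologies are needed because the spaces of \<open>C\<^sup>r\<close>-maps for different \<open>r\<close>
  live in the same type but carry different topologies.
\<close>

definition locally_convex_space :: "'a::real_vector topology \<Rightarrow> bool" where
  "locally_convex_space T \<longleftrightarrow>
     subspace (topspace T) \<and> Hausdorff_space T \<and>
     continuous_map (prod_topology T T) T (\<lambda>(x, y). x + y) \<and>
     continuous_map (prod_topology euclideanreal T) T (\<lambda>(c, x). c *\<^sub>R x) \<and>
     (\<forall>W. openin T W \<and> 0 \<in> W \<longrightarrow> (\<exists>V. openin T V \<and> convex V \<and> 0 \<in> V \<and> V \<subseteq> W))"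

definition Banach_space :: "'a::real_vector topology \<Rightarrow> bool" where
  "Banach_space T \<longleftrightarrow>
     subspace (topspace T) \<and>
     (\<exists>N :: 'a \<Rightarrow> real.
        Metric_space (topspace T) (\<lambda>x y. N (x - y)) \<and>
        (\<forall>c. \<forall>x\<in>topspace T. N (c *\<^sub>R x) = \<bar>c\<bar> * N x) \<and>
        Metric_space.mcomplete (topspace T) (\<lambda>x y. N (x - y)) \<and>
        Metric_space.mtopology (topspace T) (\<lambda>x y. N (x - y)) = T)"

definition has_dir_deriv ::
    "'b::real_vector topology \<Rightarrow> ('a::real_vector \<Rightarrow> 'b) \<Rightarrow> 'a \<Rightarrow> 'a \<Rightarrow> 'b \<Rightarrow> bool" where
  "has_dir_deriv TF f y x l \<longleftrightarrow>
     limitin TF (\<lambda>t::real. (1 / t) *\<^sub>R (f (x + t *\<^sub>R y) - f x)) l (at 0)"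

definition dir_deriv ::
    "'b::real_vector topology \<Rightarrow> ('a::real_vector \<Rightarrow> 'b) \<Rightarrow> 'a \<Rightarrow> 'a \<Rightarrow> 'b" where
  "dir_deriv TF f y x = (THE l. has_dir_deriv TF f y x l)"

text \<open>
  \<open>iter_dir_deriv TF f k y x\<close> is \<open>(D_{y\<^sub>k} \<dots> D_{y\<^sub>1} f)(x)\<close>, where the directions
  \<open>y\<^sub>1, \<dots>, y\<^sub>k\<close> are \<open>y 0, \<dots>, y (k - 1)\<close>.
\<close>

primrec iter_dir_deriv ::
    "'b::real_vector topology \<Rightarrow> ('a::real_vector \<Rightarrow> 'b) \<Rightarrow> nat \<Rightarrow> (nat \<Rightarrow> 'a) \<Rightarrow> 'a \<Rightarrow> 'b" where
  "iter_dir_deriv TF f 0 y = f"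
| "iter_dir_deriv TF f (Suc k) y = dir_deriv TF (iter_dir_deriv TF f k y) (y k)"

text \<open>\<open>U \<times> E\<^sup>k\<close>; the elements of \<open>E\<^sup>k\<close> are extensional functions on \<open>{..<k}\<close>.\<close>

definition power_topology :: "'a topology \<Rightarrow> nat \<Rightarrow> (nat \<Rightarrow> 'a) topology" where
  "power_topology TE k = product_topology (\<lambda>_. TE) {..<k}"

definition deriv_dom :: "'a topology \<Rightarrow> 'a set \<Rightarrow> nat \<Rightarrow> ('a \<times> (nat \<Rightarrow> 'a)) topology" where
  "deriv_dom TE U k = prod_topology (subtopology TE U) (power_topology TE k)"

definition Cr_on_open ::
    "'a::real_vector topology \<Rightarrow> 'b::real_vector topology \<Rightarrow> enat \<Rightarrow> 'a set \<Rightarrow> ('a \<Rightarrow> 'b) \<Rightarrow> bool" where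
  "Cr_on_open TE TF r U f \<longleftrightarrow>
     openin TE U \<and> continuous_map (subtopology TE U) TF f \<and>
     (\<forall>k. enat (Suc k) \<le> r \<longrightarrow>
        (\<forall>x\<in>U. \<forall>y\<in>topspace (power_topology TE (Suc k)).
           \<exists>l. has_dir_deriv TF (iter_dir_deriv TF f k y) (y k) x l)) \<and>
     (\<forall>k. enat k \<le> r \<longrightarrow>
        continuous_map (deriv_dom TE U k) TF (\<lambda>(x, y). iter_dir_deriv TF f k y x))"

definition Cr_on ::
    "'a::real_vector topology \<Rightarrow> 'b::real_vector topology \<Rightarrow> enat \<Rightarrow> 'a set \<Rightarrow> ('a \<Rightarrow> 'b) \<Rightarrow> bool" where
  "Cr_on TE TF r U f \<longleftrightarrow>
     U \<subseteq> topspace TE \<and> U \<subseteq> TE closure_of (TE interior_of U) \<and>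
     (\<forall>x\<in>U. \<exists>V W. openin (subtopology TE U) W \<and> x \<in> W \<and> W \<subseteq> V \<and> V \<subseteq> U \<and> convex V) \<and>
     continuous_map (subtopology TE U) TF f \<and>
     Cr_on_open TE TF r (TE interior_of U) f \<and>
     (\<forall>k. enat k \<le> r \<longrightarrow>
        (\<exists>g. continuous_map (deriv_dom TE U k) TF g \<and>
             (\<forall>x\<in>TE interior_of U. \<forall>y\<in>topspace (power_topology TE k).
                g (x, y) = iter_dir_deriv TF f k y x)))"

text \<open>The continuous extension \<open>d\<^sup>(\<^sup>k\<^sup>)f : U \<times> E\<^sup>k \<rightarrow> F\<close>, as an extensional function.\<close>

definition deriv_ext ::
    "'a::real_vector topology \<Rightarrow> 'b::real_vector topology \<Rightarrow> 'a set \<Rightarrow> ('a \<Rightarrow> 'b) \<Rightarrow> nat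
      \<Rightarrow> 'a \<times> (nat \<Rightarrow> 'a) \<Rightarrow> 'b" where
  "deriv_ext TE TF U f k =
     (THE g. g \<in> extensional (topspace (deriv_dom TE U k)) \<and>
             continuous_map (deriv_dom TE U k) TF g \<and>
             (\<forall>x\<in>TE interior_of U. \<forall>y\<in>topspace (power_topology TE k).
                g (x, y) = iter_dir_deriv TF f k y x))"

definition compact_open_topology :: "'a topology \<Rightarrow> 'b topology \<Rightarrow> ('a \<Rightarrow> 'b) topology" where
  "compact_open_topology X Y =
     topology_generated_by
       {{g \<in> extensional (topspace X). continuous_map X Y g \<and> g ` S \<subseteq> V} | S V.
          compactin X S \<and> openin Y V}"

text \<open>
  A map \<open>U \<rightarrow> F\<close> is represented by its extension by zero, so that the pointwise vector
  space operations of the function type restrict to the space of \<open>C\<^sup>r\<close>-maps.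
\<close>

definition Cr_space ::
    "'a::real_vector topology \<Rightarrow> 'b::real_vector topology \<Rightarrow> enat \<Rightarrow> 'a set \<Rightarrow> ('a \<Rightarrow> 'b) set" where
  "Cr_space TE TF r U = {f. Cr_on TE TF r U f \<and> (\<forall>x. x \<notin> U \<longrightarrow> f x = 0)}"

text \<open>
  The initial topology for the maps \<open>f \<mapsto> d\<^sup>(\<^sup>k\<^sup>)f\<close>, \<open>k \<le> r\<close>, is the pullback of the product
  topology under the map with these components.
\<close>

definition Cr_topology ::
    "'a::real_vector topology \<Rightarrow> 'b::real_vector topology \<Rightarrow> enat \<Rightarrow> 'a set \<Rightarrow> ('a \<Rightarrow> 'b) topology" where
  "Cr_topology TE TF r U =
     pullback_topology (Cr_space TE TF r U)
       (\<lambda>f. \<lambda>k\<in>{k. enat k \<le> r}. deriv_ext TE TF U f k)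
       (product_topology (\<lambda>k. compact_open_topology (deriv_dom TE U k) TF) {k. enat k \<le> r})"

definition Cr_bdry_topology :: "enat \<Rightarrow> (real^'n) set \<Rightarrow> (real^'n \<Rightarrow> real^'n) topology" where
  "Cr_bdry_topology r K =
     subtopology (Cr_topology euclidean euclidean r K) {\<gamma>. \<forall>x\<in>frontier K. \<gamma> x = 0}"

text \<open>A chart is a pair \<open>(V, \<kappa>)\<close> of its domain and the chart map.\<close>

record ('m, 'e) manifold =
  model :: "'e topology"
  mtop :: "'m topology"
  atlas :: "('m set \<times> ('m \<Rightarrow> 'e)) set"

definition smooth_manifold :: "('m, 'e::real_vector) manifold \<Rightarrow> bool" where
  "smooth_manifold M \<longleftrightarrow>
     locally_convex_space (model M) \<and> Hausdorff_space (mtop M) \<and>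
     (\<Union>(V, \<kappa>)\<in>atlas M. V) = topspace (mtop M) \<and>
     (\<forall>(V, \<kappa>)\<in>atlas M.
        openin (mtop M) V \<and> openin (model M) (\<kappa> ` V) \<and>
        homeomorphic_map (subtopology (mtop M) V) (subtopology (model M) (\<kappa> ` V)) \<kappa>) \<and>
     (\<forall>(V, \<kappa>)\<in>atlas M. \<forall>(W, \<eta>)\<in>atlas M.
        Cr_on_open (model M) (model M) \<infinity> (\<kappa> ` (V \<inter> W)) (\<eta> \<circ> inv_into V \<kappa>))"

definition smooth_Banach_manifold :: "('m, 'e::real_vector) manifold \<Rightarrow> bool" where
  "smooth_Banach_manifold M \<longleftrightarrow> smooth_manifold M \<and> Banach_space (model M)"

definition global_chart :: "('m, 'e) manifold \<Rightarrow> ('m \<Rightarrow> 'e) \<Rightarrow> bool" where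
  "global_chart M \<kappa> \<longleftrightarrow> (topspace (mtop M), \<kappa>) \<in> atlas M"

definition prod_manifold ::
    "('m, 'e) manifold \<Rightarrow> ('l, 'f) manifold \<Rightarrow> ('m \<times> 'l, 'e \<times> 'f) manifold" where
  "prod_manifold M N =
     \<lparr>model = prod_topology (model M) (model N),
      mtop = prod_topology (mtop M) (mtop N),
      atlas = {(V \<times> W, map_prod \<kappa> \<eta>) | V \<kappa> W \<eta>. (V, \<kappa>) \<in> atlas M \<and> (W, \<eta>) \<in> atlas N}\<rparr>"

definition Cr_manifold_map ::
    "enat \<Rightarrow> ('m, 'e::real_vector) manifold \<Rightarrow> ('l, 'f::real_vector) manifold \<Rightarrow> ('m \<Rightarrow> 'l) \<Rightarrow> bool" where
  "Cr_manifold_map r M N F \<longleftrightarrow>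
     continuous_map (mtop M) (mtop N) F \<and>
     (\<forall>(V, \<kappa>)\<in>atlas M. \<forall>(W, \<eta>)\<in>atlas N.
        Cr_on_open (model M) (model N) r (\<kappa> ` {x \<in> V. F x \<in> W}) (\<eta> \<circ> F \<circ> inv_into V \<kappa>))"

definition topological_group :: "('a, 'b) monoid_scheme \<Rightarrow> 'a topology \<Rightarrow> bool" where
  "topological_group G X \<longleftrightarrow>
     group G \<and> topspace X = carrier G \<and>
     continuous_map (prod_topology X X) X (\<lambda>(x, y). x \<otimes>\<^bsub>G\<^esub> y) \<and>
     continuous_map X X (m_inv G)"

text \<open>
  A bijection of \<open>K\<close> is represented by its extension by the identity outside \<open>K\<close>. Then
  composition and inversion of bijections of \<open>K\<close> are those of functions on the whole
  space, and \<open>\<phi> - id\<close> is the extension by zero of \<open>\<phi> - id\<^sub>K\<close>.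
\<close>

definition Diff_bdry :: "enat \<Rightarrow> (real^'n) set \<Rightarrow> (real^'n \<Rightarrow> real^'n) set" where
  "Diff_bdry r K =
     {\<phi>. bij_betw \<phi> K K \<and> (\<forall>x. x \<notin> K \<longrightarrow> \<phi> x = x) \<and>
         Cr_on euclidean euclidean r K \<phi> \<and> Cr_on euclidean euclidean r K (inv_into K \<phi>) \<and>
         (\<forall>x\<in>frontier K. \<phi> x = x)}"

definition Diff_group :: "enat \<Rightarrow> (real^'n) set \<Rightarrow> (real^'n \<Rightarrow> real^'n) monoid" where
  "Diff_group r K = \<lparr>carrier = Diff_bdry r K, monoid.mult = (\<circ>), one = id\<rparr>"

definition Diff_chart :: "(real^'n \<Rightarrow> real^'n) \<Rightarrow> real^'n \<Rightarrow> real^'n" where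
  "Diff_chart \<phi> = \<phi> - id"

definition Diff_manifold ::
    "enat \<Rightarrow> (real^'n) set \<Rightarrow> (real^'n \<Rightarrow> real^'n, real^'n \<Rightarrow> real^'n) manifold" where
  "Diff_manifold r K =
     \<lparr>model = Cr_bdry_topology r K,
      mtop = pullback_topology (Diff_bdry r K) Diff_chart (Cr_bdry_topology r K),
      atlas = {(Diff_bdry r K, Diff_chart)}\<rparr>"

end

theory Submission
  imports Defs
begin

text \<open>
  In the charts, composition is \<open>(\<eta>, \<gamma>) \<mapsto> \<gamma> + \<eta> \<circ> (id + \<gamma>)\<close> and inversion is \<open>\<gamma> \<mapsto> (id + \<gamma>)\<^sup>-\<^sup>1 - id\<close>. By a
  form of the exponential law, a map \<open>u \<mapsto> g(u, \<cdot>)\<close> into \<open>C\<^sup>r(K, \<real>\<^sup>n)\<close> is \<open>C\<^sup>s\<close> as soon as \<open>g\<close> has jointly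
  continuous mixed derivatives of order at most \<open>s\<close> in \<open>u\<close> and at most \<open>r\<close> in the point of \<open>K\<close>, so only
  calculus in finitely many variables is needed: evaluation \<open>(u, x) \<mapsto> u(x)\<close> has such derivatives, and
  the class of functions which have them is closed under arithmetic, composition and inversion. Openness
  of the chart image is a perturbation argument: maps which are the identity outside the interior of
  \<open>K\<close> extend to all of \<open>\<real>\<^sup>n\<close> with the same Lipschitz constant, and a Lipschitz-small perturbation of a
  bi-Lipschitz homeomorphism of \<open>\<real>\<^sup>n\<close> is again one.
\<close>

section \<open>Jets of maps on a convex body\<close>

text \<open>The boundary of \<open>K\<close> carries no smoothness, and there derivatives exist only
  as continuous extensions from the interior. Total derivatives are therefore used at interior
  points only, and identities spread to \<open>K\<close> by density of the interior. The chain rule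
  is available because the maps in question fix every point outside the interior: they send interior
  to interior, and at a fixed boundary point the parameter derivatives of the image point vanish.
  The loss of derivatives is visible in \<eta> o (id + \<gamma>): varying \<gamma> brings in the
  space derivative of \<eta>, so s derivatives in \<gamma> need \<eta> of order r + s. For fixed
  \<gamma> nothing is lost, which is why right translations are smooth for finite r. A bijection of
  class C^r with a C^r inverse has an invertible Jacobian up to the boundary. Openness of this
  condition comes from a lower Lipschitz bound for the perturbed map, which passes to its Jacobian
  inside and, by continuity, on the boundary. The calculus counts finite orders; infinite ones are
  reached through all finite ones.\<close>

lemma has_derivative_of_continuous_partials:
  fixes f :: "real^'n \<Rightarrow> 'b::real_normed_vector"
  assumes S: "open S" "x \<in> S"
    and d: "\<And>z i. z \<in> S \<Longrightarrow> ((\<lambda>t. f (z + t *\<^sub>R axis i 1)) has_vector_derivative g i z) (at 0)"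
    and c: "\<And>i. continuous_on S (g i)"
  shows "(f has_derivative (\<lambda>h. \<Sum>i\<in>UNIV. (h$i) *\<^sub>R g i x)) (at x)"
  unfolding has_derivative_at_alt
proof (intro conjI allI impI)
  show "bounded_linear (\<lambda>h. \<Sum>i\<in>UNIV. (h$i) *\<^sub>R g i x)"
    by (intro bounded_linear_sum bounded_linear_scaleR_const bounded_linear_vec_nth)
next
  fix e :: real assume "e > 0"
  \<comment> \<open>An equal share for each coordinate: the \<open>CARD('n)\<close> legs of the path
    used below add up to at most \<open>e * norm h\<close>.\<close>
  define e' where "e' = e / real CARD('n)"
  have e': "e' > 0" using \<open>e > 0\<close> by (simp add: e'_def)
  have "\<forall>\<^sub>F z in nhds x. z \<in> S \<and> (\<forall>i. norm (g i z - g i x) \<le> e')"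
  proof (intro eventually_conj)
    show "\<forall>\<^sub>F z in nhds x. z \<in> S" using S by (simp add: eventually_nhds_in_open)
    have "\<forall>\<^sub>F z in nhds x. norm (g i z - g i x) \<le> e'" for i
    proof -
      have "isCont (g i) x" using c[of i] S by (simp add: continuous_on_eq_continuous_at)
      then have "(g i \<longlongrightarrow> g i x) (nhds x)" by (simp add: continuous_at tendsto_at_iff_tendsto_nhds)
      from tendstoD[OF this e'] show ?thesis
        by (rule eventually_mono) (simp add: dist_norm)
    qed
    then show "\<forall>\<^sub>F z in nhds x. \<forall>i. norm (g i z - g i x) \<le> e'"
      by (intro eventually_all_finite) auto
  qed
  then obtain \<delta> where \<delta>: "\<delta> > 0"
    and inS: "\<And>z. dist z x < \<delta> \<Longrightarrow> z \<in> S"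
    and gx: "\<And>z i. dist z x < \<delta> \<Longrightarrow> norm (g i z - g i x) \<le> e'"
    unfolding eventually_nhds_metric by blast
  have step: "norm (f (z + \<tau> *\<^sub>R axis i 1) - f z - \<tau> *\<^sub>R g i x) \<le> e' * \<bar>\<tau>\<bar>"
    if z: "z \<in> ball x \<delta>" "z + \<tau> *\<^sub>R axis i 1 \<in> ball x \<delta>" for z \<tau> i
  proof -
    let ?\<phi> = "\<lambda>t. f (z + t *\<^sub>R axis i 1) - t *\<^sub>R g i x"
    have inb: "z + t *\<^sub>R axis i 1 \<in> ball x \<delta>" if "t \<in> closed_segment 0 \<tau>" for t
    proof -
      from that obtain u where u: "0 \<le> u" "u \<le> 1" "t = u * \<tau>"
        by (auto simp: closed_segment_def)
      have "z + t *\<^sub>R axis i 1 = (1 - u) *\<^sub>R z + u *\<^sub>R (z + \<tau> *\<^sub>R axis i 1)"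
        by (simp add: algebra_simps u)
      also have "\<dots> \<in> ball x \<delta>"
        by (rule convexD[OF convex_ball]) (use z u in auto)
      finally show ?thesis .
    qed
    have "norm (?\<phi> \<tau> - ?\<phi> 0) \<le> e' * norm (\<tau> - 0)"
    proof (rule differentiable_bound[where S="closed_segment 0 \<tau>"
          and f'="\<lambda>t s. s *\<^sub>R (g i (z + t *\<^sub>R axis i 1) - g i x)"])
      fix t assume t: "t \<in> closed_segment 0 \<tau>"
      have "((\<lambda>s. f ((z + t *\<^sub>R axis i 1) + s *\<^sub>R axis i 1)) has_vector_derivative
          g i (z + t *\<^sub>R axis i 1)) (at 0)"
        by (rule d) (use inb[OF t] inS in \<open>auto simp: dist_commute\<close>)
      moreover have shift: "((\<lambda>s. s - t) has_vector_derivative 1) (at t)"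
        by (auto intro!: derivative_eq_intros)
      ultimately have "((\<lambda>s. f ((z + t *\<^sub>R axis i 1) + (s - t) *\<^sub>R axis i 1)) has_vector_derivative
          g i (z + t *\<^sub>R axis i 1)) (at t)"
        using vector_diff_chain_at[of "\<lambda>s. s - t" 1 t "\<lambda>s. f ((z + t *\<^sub>R axis i 1) + s *\<^sub>R axis i 1)"
            "g i (z + t *\<^sub>R axis i 1)"] shift
        by (simp add: o_def)
      then have "((\<lambda>s. f (z + s *\<^sub>R axis i 1)) has_vector_derivative g i (z + t *\<^sub>R axis i 1)) (at t)"
        by (simp add: algebra_simps)
      then have "((\<lambda>s. f (z + s *\<^sub>R axis i 1)) has_derivative (\<lambda>s. s *\<^sub>R g i (z + t *\<^sub>R axis i 1))) (at t)"
        by (simp add: has_vector_derivative_def)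
      then have "(?\<phi> has_derivative (\<lambda>s. s *\<^sub>R g i (z + t *\<^sub>R axis i 1) - s *\<^sub>R g i x)) (at t)"
        by (rule has_derivative_diff) (auto intro!: derivative_eq_intros)
      then show "(?\<phi> has_derivative (\<lambda>s. s *\<^sub>R (g i (z + t *\<^sub>R axis i 1) - g i x)))
          (at t within closed_segment 0 \<tau>)"
        unfolding scaleR_diff_right by (rule has_derivative_at_withinI)
      show "onorm (\<lambda>s. s *\<^sub>R (g i (z + t *\<^sub>R axis i 1) - g i x)) \<le> e'"
      proof (rule onorm_le)
        fix s :: real
        show "norm (s *\<^sub>R (g i (z + t *\<^sub>R axis i 1) - g i x)) \<le> e' * norm s"
          using mult_left_mono[OF gx[of "z + t *\<^sub>R axis i 1" i], of "\<bar>s\<bar>"] inb[OF t]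
          by (simp add: dist_commute mult.commute)
      qed
    qed auto
    then show ?thesis by (simp add: algebra_simps)
  qed
  have "norm (f y - f x - (\<Sum>i\<in>UNIV. ((y - x)$i) *\<^sub>R g i x)) \<le> e * norm (y - x)"
    if y: "norm (y - x) < \<delta>" for y
  proof -
    define h where "h = y - x"
    \<comment> \<open>The path from \<open>x\<close> to \<open>y\<close> changes one coordinate at a
      time and visits points \<open>x + P A\<close>. Since \<open>P A\<close> keeps some coordinates
      of \<open>h\<close> and kills the others, it is no longer than \<open>h\<close>, so the path
      stays in the ball.\<close>
    define P where "P A = (\<Sum>i\<in>A. (h$i) *\<^sub>R axis i (1::real))" for A :: "'n set"
    have Pn: "P A $ j = (if j \<in> A then h$j else 0)" for A j
      by (simp add: P_def axis_def if_distrib cong: if_cong)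
    have Pb: "x + P A \<in> ball x \<delta>" for A
    proof -
      have "norm (P A) \<le> norm h"
        by (rule norm_le_componentwise_cart) (simp add: Pn)
      then show ?thesis using y by (simp add: h_def dist_norm)
    qed
    have main: "norm (f (x + P A) - f x - (\<Sum>i\<in>A. (h$i) *\<^sub>R g i x)) \<le> e' * (\<Sum>i\<in>A. \<bar>h$i\<bar>)"
      for A :: "'n set"
    proof (induction A rule: finite_induct[OF finite])
      case 1
      then show ?case by (simp add: P_def)
    next
      case (2 i A)
      have eq: "x + P (insert i A) = (x + P A) + (h$i) *\<^sub>R axis i 1"
        using 2 by (simp add: P_def algebra_simps)
      have "norm (f (x + P A + (h$i) *\<^sub>R axis i 1) - f (x + P A) - (h$i) *\<^sub>R g i x) \<le> e' * \<bar>h$i\<bar>"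
        by (rule step) (use Pb[of A] Pb[of "insert i A"] eq in auto)
      moreover have "f (x + P (insert i A)) - f x - (\<Sum>i\<in>insert i A. (h$i) *\<^sub>R g i x)
         = (f (x + P A + (h$i) *\<^sub>R axis i 1) - f (x + P A) - (h$i) *\<^sub>R g i x)
          + (f (x + P A) - f x - (\<Sum>i\<in>A. (h$i) *\<^sub>R g i x))"
        using 2 by (simp add: eq)
      ultimately show ?case
        using 2(3) norm_triangle_ineq[of "f (x + P A + (h$i) *\<^sub>R axis i 1) - f (x + P A) - (h$i) *\<^sub>R g i x"
            "f (x + P A) - f x - (\<Sum>i\<in>A. (h$i) *\<^sub>R g i x)"] 2(1,2)
        by (simp add: algebra_simps)
    qed
    have "P UNIV = h" by (simp add: vec_eq_iff Pn)
    then have "norm (f y - f x - (\<Sum>i\<in>UNIV. (h$i) *\<^sub>R g i x)) \<le> e' * (\<Sum>i\<in>UNIV. \<bar>h$i\<bar>)"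
      using main[of UNIV] by (simp add: h_def)
    also have "\<dots> \<le> e' * (\<Sum>i\<in>(UNIV::'n set). norm h)"
      using e' by (intro mult_left_mono sum_mono component_le_norm_cart) auto
    also have "\<dots> = e * norm h" by (simp add: e'_def)
    finally show ?thesis by (simp add: h_def)
  qed
  then show "\<exists>d>0. \<forall>y. norm (y - x) < d \<longrightarrow>
      norm (f y - f x - (\<Sum>i\<in>UNIV. ((y - x)$i) *\<^sub>R g i x)) \<le> e * norm (y - x)"
    using \<delta> by blast
qed

text \<open>
  The letters of the word \<open>\<alpha>\<close> are the coordinates in which one differentiates, the first letter first;
  \<open>D \<alpha>\<close> is the corresponding partial derivative, extended continuously to the boundary.
\<close>

definition jet :: "(real^'n) set \<Rightarrow> enat \<Rightarrow> ('n list \<Rightarrow> real^'n \<Rightarrow> 'b::real_normed_vector) \<Rightarrow> bool" where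
  "jet K r D \<longleftrightarrow>
     (\<forall>\<alpha>. enat (length \<alpha>) \<le> r \<longrightarrow> continuous_on K (D \<alpha>)) \<and>
     (\<forall>\<alpha>. enat (Suc (length \<alpha>)) \<le> r \<longrightarrow>
        (\<forall>x\<in>interior K. (D \<alpha> has_derivative (\<lambda>h. \<Sum>i\<in>UNIV. (h$i) *\<^sub>R D (\<alpha> @ [i]) x)) (at x)))"

lemma jet_cont: "jet K r D \<Longrightarrow> enat (length \<alpha>) \<le> r \<Longrightarrow> continuous_on K (D \<alpha>)"
  by (simp add: jet_def)

lemma jet_deriv: "jet K r D \<Longrightarrow> enat (Suc (length \<alpha>)) \<le> r \<Longrightarrow> x \<in> interior K \<Longrightarrow>
   (D \<alpha> has_derivative (\<lambda>h. \<Sum>i\<in>UNIV. (h$i) *\<^sub>R D (\<alpha> @ [i]) x)) (at x)"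
  by (simp add: jet_def)

lemma jet_mono: "jet K r D \<Longrightarrow> r' \<le> r \<Longrightarrow> jet K r' D"
  unfolding jet_def by (meson order_trans)

lemma jet_cong:
  fixes D D' :: "'n::finite list \<Rightarrow> real^'n \<Rightarrow> 'b::real_normed_vector"
  assumes "jet K r D" and eq: "\<And>\<alpha> x. enat (length \<alpha>) \<le> r \<Longrightarrow> x \<in> K \<Longrightarrow> D \<alpha> x = D' \<alpha> x"
  shows "jet K r D'"
  unfolding jet_def
proof (intro conjI allI impI ballI)
  fix \<alpha> :: "'n list" assume "enat (length \<alpha>) \<le> r"
  with assms show "continuous_on K (D' \<alpha>)"
    by (intro continuous_on_eq[OF jet_cont[OF assms(1)]]) auto
next
  fix \<alpha> :: "'n list" and x assume r: "enat (Suc (length \<alpha>)) \<le> r" and x: "x \<in> interior K"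
  have r': "enat (length \<alpha>) \<le> r" using r by (metis Suc_ile_eq order_less_imp_le)
  have "(D \<alpha> has_derivative (\<lambda>h. \<Sum>i\<in>UNIV. (h$i) *\<^sub>R D (\<alpha> @ [i]) x)) (at x)"
    using assms(1) r x by (rule jet_deriv)
  moreover have "D (\<alpha> @ [i]) x = D' (\<alpha> @ [i]) x" for i
    by (rule eq) (use r x interior_subset in auto)
  ultimately have "(D \<alpha> has_derivative (\<lambda>h. \<Sum>i\<in>UNIV. (h$i) *\<^sub>R D' (\<alpha> @ [i]) x)) (at x)"
    by simp
  then show "(D' \<alpha> has_derivative (\<lambda>h. \<Sum>i\<in>UNIV. (h$i) *\<^sub>R D' (\<alpha> @ [i]) x)) (at x)"
    by (rule has_derivative_transform_within_open[of _ _ _ _ "interior K"])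
      (use x eq[OF r'] interior_subset in auto)
qed

lemma jet_add:
  fixes D E :: "'n::finite list \<Rightarrow> real^'n \<Rightarrow> 'b::real_normed_vector"
  assumes "jet K r D" "jet K r E"
  shows "jet K r (\<lambda>\<alpha> x. D \<alpha> x + E \<alpha> x)"
  unfolding jet_def
proof (intro conjI allI impI ballI)
  fix \<alpha> :: "'n list" and x assume "enat (Suc (length \<alpha>)) \<le> r" "x \<in> interior K"
  from has_derivative_add[OF jet_deriv[OF assms(1) this] jet_deriv[OF assms(2) this]]
  show "((\<lambda>x. D \<alpha> x + E \<alpha> x) has_derivative
     (\<lambda>h. \<Sum>i\<in>UNIV. (h$i) *\<^sub>R (D (\<alpha> @ [i]) x + E (\<alpha> @ [i]) x))) (at x)"
    by (simp add: scaleR_add_right sum.distrib)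
qed (auto intro!: continuous_on_add jet_cont[OF assms(1)] jet_cont[OF assms(2)])

lemma jet_scale:
  fixes D :: "'n::finite list \<Rightarrow> real^'n \<Rightarrow> 'b::real_normed_vector"
  assumes "jet K r D"
  shows "jet K r (\<lambda>\<alpha> x. c *\<^sub>R D \<alpha> x)"
  unfolding jet_def
proof (intro conjI allI impI ballI)
  fix \<alpha> :: "'n list" and x assume "enat (Suc (length \<alpha>)) \<le> r" "x \<in> interior K"
  from bounded_linear.has_derivative[OF bounded_linear_scaleR_right jet_deriv[OF assms this], of c]
  show "((\<lambda>x. c *\<^sub>R D \<alpha> x) has_derivative
     (\<lambda>h. \<Sum>i\<in>UNIV. (h$i) *\<^sub>R (c *\<^sub>R D (\<alpha> @ [i]) x))) (at x)"
    by (simp only: scaleR_sum_right scaleR_left_commute)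
qed (auto intro!: continuous_intros jet_cont[OF assms(1)])

lemma jet_zero: "jet K r (\<lambda>_ _. 0)"
  by (simp add: jet_def)

text \<open>Convexity enters through \<open>has_derivative_sequence\<close>: uniform convergence of
  the derivatives on a convex set lets differentiation pass to the limit. Besides completeness, this
  is what later permits interchanging parameter and space derivatives.\<close>

lemma jet_uniform_limit:
  fixes D :: "'a::finite list \<Rightarrow> real^'a \<Rightarrow> 'b::banach"
  assumes K: "convex K" and jets: "\<And>n::nat. jet K r (D' n)"
    and lim: "\<And>\<alpha>. enat (length \<alpha>) \<le> r \<Longrightarrow> uniform_limit K (\<lambda>n. D' n \<alpha>) (D \<alpha>) sequentially"
  shows "jet K r D"
  unfolding jet_def
proof (intro conjI allI impI ballI)
  fix \<alpha> :: "'a list" assume "enat (length \<alpha>) \<le> r"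
  then show "continuous_on K (D \<alpha>)"
    by (intro uniform_limit_theorem[OF _ lim]) (auto intro!: always_eventually jet_cont[OF jets])
next
  fix \<alpha> :: "'a list" and x assume r: "enat (Suc (length \<alpha>)) \<le> r" and x: "x \<in> interior K"
  have r': "enat (length \<alpha>) \<le> r" using r by (metis Suc_ile_eq order_less_imp_le)
  have lim': "(\<lambda>n. D' n \<alpha> z) \<longlonglongrightarrow> D \<alpha> z" if "z \<in> interior K" for z
    by (rule tendsto_uniform_limitI[OF lim[OF r']]) (use that interior_subset in auto)
  have "\<exists>g. \<forall>z\<in>interior K. (\<lambda>n. D' n \<alpha> z) \<longlonglongrightarrow> g z \<and>
      (g has_derivative (\<lambda>h. \<Sum>i\<in>UNIV. (h$i) *\<^sub>R D (\<alpha> @ [i]) z)) (at z within interior K)"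
  proof (rule has_derivative_sequence)
    show "convex (interior K)" using K by (rule convex_interior)
    show "(D' n \<alpha> has_derivative (\<lambda>h. \<Sum>i\<in>UNIV. (h$i) *\<^sub>R D' n (\<alpha> @ [i]) z)) (at z within interior K)"
      if "z \<in> interior K" for n z
      using jet_deriv[OF jets r that] by (rule has_derivative_at_withinI)
    show "x \<in> interior K" by fact
    show "(\<lambda>n. D' n \<alpha> x) \<longlonglongrightarrow> D \<alpha> x" using x by (rule lim')
    fix e :: real assume "e > 0"
    define e' where "e' = e / real CARD('a)"
    have e': "e' > 0" using \<open>e > 0\<close> by (simp add: e'_def)
    have "\<forall>\<^sub>F n in sequentially. \<forall>z\<in>K. dist (D' n (\<alpha> @ [i]) z) (D (\<alpha> @ [i]) z) < e'" for i
      using uniform_limitD[OF lim[of "\<alpha> @ [i]"] e'] r by simp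
    then have "\<forall>\<^sub>F n in sequentially. \<forall>i. \<forall>z\<in>K. dist (D' n (\<alpha> @ [i]) z) (D (\<alpha> @ [i]) z) < e'"
      by (intro eventually_all_finite) auto
    then show "\<forall>\<^sub>F n in sequentially. \<forall>z\<in>interior K. \<forall>h.
        norm ((\<Sum>i\<in>UNIV. (h$i) *\<^sub>R D' n (\<alpha> @ [i]) z) - (\<Sum>i\<in>UNIV. (h$i) *\<^sub>R D (\<alpha> @ [i]) z)) \<le> e * norm h"
    proof (rule eventually_mono, intro ballI allI)
      fix n z and h :: "real^'a"
      assume *: "\<forall>i. \<forall>z\<in>K. dist (D' n (\<alpha> @ [i]) z) (D (\<alpha> @ [i]) z) < e'" and z: "z \<in> interior K"
      have "norm ((\<Sum>i\<in>UNIV. (h$i) *\<^sub>R D' n (\<alpha> @ [i]) z) - (\<Sum>i\<in>UNIV. (h$i) *\<^sub>R D (\<alpha> @ [i]) z))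
         = norm (\<Sum>i\<in>UNIV. (h$i) *\<^sub>R (D' n (\<alpha> @ [i]) z - D (\<alpha> @ [i]) z))"
        by (simp add: sum_subtractf scaleR_diff_right)
      also have "\<dots> \<le> (\<Sum>i\<in>(UNIV::'a set). norm h * e')"
      proof (rule sum_norm_le)
        fix i
        have "norm (D' n (\<alpha> @ [i]) z - D (\<alpha> @ [i]) z) \<le> e'"
          using * subsetD[OF interior_subset z] by (auto simp: dist_norm less_imp_le)
        then show "norm ((h$i) *\<^sub>R (D' n (\<alpha> @ [i]) z - D (\<alpha> @ [i]) z)) \<le> norm h * e'"
          by (simp add: component_le_norm_cart mult_mono)
      qed
      also have "\<dots> = e * norm h" by (simp add: e'_def)
      finally show "norm ((\<Sum>i\<in>UNIV. (h$i) *\<^sub>R D' n (\<alpha> @ [i]) z) - (\<Sum>i\<in>UNIV. (h$i) *\<^sub>R D (\<alpha> @ [i]) z))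
         \<le> e * norm h" .
    qed
  qed
  then obtain g where g: "\<And>z. z \<in> interior K \<Longrightarrow> (\<lambda>n. D' n \<alpha> z) \<longlonglongrightarrow> g z"
    "\<And>z. z \<in> interior K \<Longrightarrow>
      (g has_derivative (\<lambda>h. \<Sum>i\<in>UNIV. (h$i) *\<^sub>R D (\<alpha> @ [i]) z)) (at z within interior K)"
    by blast
  have geq: "g z = D \<alpha> z" if "z \<in> interior K" for z
    using LIMSEQ_unique[OF g(1)[OF that] lim'[OF that]] .
  have "(g has_derivative (\<lambda>h. \<Sum>i\<in>UNIV. (h$i) *\<^sub>R D (\<alpha> @ [i]) x)) (at x)"
    using g(2)[OF x] unfolding at_within_open[OF x open_interior] .
  then show "(D \<alpha> has_derivative (\<lambda>h. \<Sum>i\<in>UNIV. (h$i) *\<^sub>R D (\<alpha> @ [i]) x)) (at x)"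
    by (rule has_derivative_transform_within_open[of _ _ _ _ "interior K"]) (simp_all add: x geq)
qed

section \<open>Iterated directional derivatives as multilinear forms\<close>

definition words :: "nat \<Rightarrow> 'n list set" where "words k = {\<alpha>. length \<alpha> = k}"

definition monomial :: "(nat \<Rightarrow> real^'n) \<Rightarrow> 'n list \<Rightarrow> real" where
  "monomial z \<alpha> = (\<Prod>i<length \<alpha>. z i $ (\<alpha> ! i))"

text \<open>The k-th derivative at \<open>x\<close> as a k-linear form in the directions z 0, ..., z
  (k - 1), expanded in partial derivatives. Indexing by words keeps the order of
  differentiation.\<close>

definition jet_form :: "('n list \<Rightarrow> real^'n \<Rightarrow> 'b::real_vector) \<Rightarrow> nat \<Rightarrow> real^'n \<Rightarrow> (nat \<Rightarrow> real^'n) \<Rightarrow> 'b" where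
  "jet_form D k x z = (\<Sum>\<alpha>\<in>words k. monomial z \<alpha> *\<^sub>R D \<alpha> x)"

lemma finite_words [simp]: "finite (words k :: 'n::finite list set)"
  using finite_lists_length_eq[of "UNIV :: 'n set" k] by (simp add: words_def)

lemma words_0 [simp]: "words 0 = {[]}" by (auto simp: words_def)

lemma sum_words_Suc:
  "(\<Sum>\<alpha>\<in>words (Suc k). h \<alpha>) = (\<Sum>\<alpha>\<in>words k. \<Sum>i\<in>(UNIV::'n::finite set). h (\<alpha> @ [i]))"
proof -
  have "bij_betw (\<lambda>(\<alpha>, i). \<alpha> @ [i]) (words k \<times> (UNIV::'n set)) (words (Suc k))"
    unfolding bij_betw_def
  proof
    show "inj_on (\<lambda>(\<alpha>, i). \<alpha> @ [i]) (words k \<times> (UNIV::'n set))"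
      by (auto simp: inj_on_def)
    have "\<alpha> \<in> (\<lambda>(\<alpha>, i). \<alpha> @ [i]) ` (words k \<times> (UNIV::'n set))" if "\<alpha> \<in> words (Suc k)" for \<alpha>
      by (rule image_eqI[of _ _ "(butlast \<alpha>, last \<alpha>)"]) (use that in \<open>auto simp: words_def simp flip: length_greater_0_conv\<close>)
    then show "(\<lambda>(\<alpha>, i). \<alpha> @ [i]) ` (words k \<times> (UNIV::'n set)) = words (Suc k)"
      by (auto simp: words_def)
  qed
  from sum.reindex_bij_betw[OF this, of h] show ?thesis
    by (simp add: sum.cartesian_product case_prod_unfold)
qed

lemma monomial_snoc: "monomial z (\<alpha> @ [i]) = monomial z \<alpha> * z (length \<alpha>) $ i"
  by (simp add: monomial_def nth_append)

lemma jet_form_Suc: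
  "jet_form D (Suc k) x z = (\<Sum>\<alpha>\<in>words k. monomial z \<alpha> *\<^sub>R (\<Sum>i\<in>UNIV. (z k $ i) *\<^sub>R D (\<alpha> @ [i]) x))"
  unfolding jet_form_def sum_words_Suc
  by (intro sum.cong refl) (auto simp: monomial_snoc scaleR_sum_right words_def)

lemma continuous_map_euclidean_iff_tendsto:
  "continuous_map X euclidean f \<longleftrightarrow> (\<forall>x\<in>topspace X. (f \<longlongrightarrow> f x) (atin X x))"
  by (simp add: continuous_map_atin)

lemma has_dir_deriv_euclidean:
  "has_dir_deriv euclidean f y x l \<longleftrightarrow> ((\<lambda>t. f (x + t *\<^sub>R y)) has_vector_derivative l) (at 0)"
proof -
  have "norm ((1/t) *\<^sub>R (f (x + t *\<^sub>R y) - f x) - l) = norm (f (x + t *\<^sub>R y) - f x - t *\<^sub>R l) / norm t"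
    if "t \<noteq> 0" for t
  proof -
    have "(1/t) *\<^sub>R (f (x + t *\<^sub>R y) - f x) - l = (1/t) *\<^sub>R (f (x + t *\<^sub>R y) - f x - t *\<^sub>R l)"
      using that by (simp add: scaleR_diff_right)
    then show ?thesis by (simp only: norm_scaleR) simp
  qed
  then have "((\<lambda>t. norm ((1/t) *\<^sub>R (f (x + t *\<^sub>R y) - f x) - l)) \<longlongrightarrow> 0) (at 0) \<longleftrightarrow>
     ((\<lambda>t. norm (f (x + t *\<^sub>R y) - f x - t *\<^sub>R l) / norm t) \<longlongrightarrow> 0) (at 0)"
    by (intro tendsto_cong) (auto simp: eventually_at_filter)
  moreover have "((\<lambda>t. (1/t) *\<^sub>R (f (x + t *\<^sub>R y) - f x)) \<longlongrightarrow> l) (at 0) \<longleftrightarrow>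
      ((\<lambda>t. norm ((1/t) *\<^sub>R (f (x + t *\<^sub>R y) - f x) - l)) \<longlongrightarrow> 0) (at 0)"
    by (rule trans[OF Lim_null tendsto_norm_zero_iff[symmetric]])
  ultimately show ?thesis
    by (simp add: has_dir_deriv_def has_vector_derivative_def has_derivative_iff_norm bounded_linear_scaleR_left)
qed

lemma has_dir_deriv_euclidean_unique:
  fixes f :: "'a::real_vector \<Rightarrow> 'b::real_normed_vector"
  shows "has_dir_deriv euclidean f y x l \<Longrightarrow> has_dir_deriv euclidean f y x l' \<Longrightarrow> l = l'"
  unfolding has_dir_deriv_euclidean by (rule vector_derivative_unique_at)

lemma dir_deriv_euclideanI:
  fixes f :: "'a::real_vector \<Rightarrow> 'b::real_normed_vector"
  shows "has_dir_deriv euclidean f y x l \<Longrightarrow> dir_deriv euclidean f y x = l"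
  unfolding dir_deriv_def
  by (rule the_equality) (auto intro: has_dir_deriv_euclidean_unique)

lemma has_dir_deriv_of_derivative:
  assumes "(f has_derivative f') (at x)"
  shows "has_dir_deriv euclidean f v x (f' v)"
proof -
  have "((\<lambda>t. x + t *\<^sub>R v) has_derivative (\<lambda>t. t *\<^sub>R v)) (at 0)"
    by (auto intro!: derivative_eq_intros)
  moreover have "(f has_derivative f') (at (x + 0 *\<^sub>R v))" using assms by simp
  ultimately have "((\<lambda>t. f (x + t *\<^sub>R v)) has_derivative (\<lambda>t. f' (t *\<^sub>R v))) (at 0)"
    by (rule has_derivative_compose)
  moreover have "f' (t *\<^sub>R v) = t *\<^sub>R f' v" for t
    by (rule linear_scale) (use assms has_derivative_linear in blast)
  ultimately show ?thesis
    by (simp add: has_dir_deriv_euclidean has_vector_derivative_def)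
qed

text \<open>\<open>f\<close> is tied to the form on the interior only, because it will be an
  iterated directional derivative, of which nothing is known elsewhere. Differentiating the form
  along \<open>z k\<close> appends one letter to every word.\<close>

lemma has_dir_deriv_jet_form:
  fixes D :: "'n::finite list \<Rightarrow> real^'n \<Rightarrow> 'b::real_normed_vector"
  assumes D: "jet K r D" and eq: "\<And>x. x \<in> interior K \<Longrightarrow> f x = jet_form D k x z"
    and k: "enat (Suc k) \<le> r" and x: "x \<in> interior K"
  shows "has_dir_deriv euclidean f (z k) x (jet_form D (Suc k) x z)"
proof -
  have "((\<lambda>x. jet_form D k x z) has_derivative
      (\<lambda>h. \<Sum>\<alpha>\<in>words k. monomial z \<alpha> *\<^sub>R (\<Sum>i\<in>UNIV. (h$i) *\<^sub>R D (\<alpha> @ [i]) x))) (at x)"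
    unfolding jet_form_def
    by (intro has_derivative_sum bounded_linear.has_derivative[OF bounded_linear_scaleR_right] jet_deriv[OF D _ x])
      (use k in \<open>auto simp: words_def\<close>)
  then have "(f has_derivative
      (\<lambda>h. \<Sum>\<alpha>\<in>words k. monomial z \<alpha> *\<^sub>R (\<Sum>i\<in>UNIV. (h$i) *\<^sub>R D (\<alpha> @ [i]) x))) (at x)"
    by (rule has_derivative_transform_within_open[of _ _ _ _ "interior K"]) (use x eq in auto)
  from has_dir_deriv_of_derivative[OF this, of "z k"] show ?thesis
    by (simp add: jet_form_Suc)
qed

lemma iter_dir_deriv_jet:
  fixes D :: "'n::finite list \<Rightarrow> real^'n \<Rightarrow> 'b::real_normed_vector"
  assumes D: "jet K r D" and f: "\<And>x. x \<in> interior K \<Longrightarrow> f x = D [] x"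
  shows "enat k \<le> r \<Longrightarrow> x \<in> interior K \<Longrightarrow> iter_dir_deriv euclidean f k z x = jet_form D k x z"
proof (induction k arbitrary: x)
  case 0
  then show ?case by (simp add: jet_form_def monomial_def f)
next
  case (Suc k)
  have k: "enat k \<le> r" using Suc.prems by (metis Suc_ile_eq order_less_imp_le)
  have "has_dir_deriv euclidean (iter_dir_deriv euclidean f k z) (z k) x (jet_form D (Suc k) x z)"
    using Suc k by (intro has_dir_deriv_jet_form[OF D]) auto
  then show ?case by (simp add: dir_deriv_euclideanI)
qed

lemma continuous_map_jet_form:
  fixes D :: "'n::finite list \<Rightarrow> real^'n \<Rightarrow> 'b::real_normed_vector"
  assumes "\<And>\<alpha>. length \<alpha> = k \<Longrightarrow> continuous_on K (D \<alpha>)"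
  shows "continuous_map (deriv_dom euclidean K k) euclidean (\<lambda>(x, z). jet_form D k x z)"
proof -
  have zi: "continuous_map (deriv_dom euclidean K k) euclidean (\<lambda>p. snd p i)" if "i < k" for i
    using that unfolding deriv_dom_def power_topology_def
    by (intro continuous_map_compose[OF continuous_map_snd, unfolded o_def])
      (use continuous_map_product_projection[of i "{..<k}" "\<lambda>_. euclidean"] in auto)
  have Dx: "continuous_map (deriv_dom euclidean K k) euclidean (\<lambda>p. D \<alpha> (fst p))" if "length \<alpha> = k" for \<alpha>
    using that unfolding deriv_dom_def
    by (intro continuous_map_compose[OF continuous_map_fst, unfolded o_def]) (simp add: assms)
  show ?thesis
    unfolding continuous_map_euclidean_iff_tendsto case_prod_unfold jet_form_def monomial_def
    using zi Dx unfolding continuous_map_euclidean_iff_tendsto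
    by (intro ballI tendsto_sum tendsto_scaleR tendsto_prod tendsto_vec_nth) (auto simp: words_def)
qed

text \<open>Evaluating the extension \<open>deriv_ext\<close> at the unit vectors named by the word
  gives partial derivatives at boundary points as well. The directions form an extensional function
  because the domain of \<open>deriv_ext\<close> consists of such functions.\<close>

definition PD :: "(real^'n) set \<Rightarrow> (real^'n \<Rightarrow> real^'n) \<Rightarrow> 'n list \<Rightarrow> real^'n \<Rightarrow> real^'n" where
  "PD K f \<alpha> x = deriv_ext euclidean euclidean K f (length \<alpha>) (x, \<lambda>i\<in>{..<length \<alpha>}. axis (\<alpha> ! i) 1)"

lemma monomial_axis:
  "length \<alpha> = k \<Longrightarrow> length \<beta> = k \<Longrightarrow> monomial (\<lambda>i\<in>{..<k}. axis (\<alpha> ! i) 1) \<beta> = (if \<alpha> = \<beta> then 1 else 0)"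
  unfolding monomial_def by (auto simp: axis_def intro!: prod.neutral) (metis lessThan_iff nth_equalityI)

text \<open>At unit vectors the monomials are a Kronecker delta on words
  (\<open>monomial_axis\<close>), so the form singles out one partial derivative.\<close>

lemma jet_form_axis: "length \<alpha> = k \<Longrightarrow> jet_form D k x (\<lambda>i\<in>{..<k}. axis (\<alpha> ! i) 1) = D \<alpha> x"
proof -
  assume a: "length \<alpha> = k"
  have "jet_form D k x (\<lambda>i\<in>{..<k}. axis (\<alpha> ! i) 1) = (\<Sum>\<beta>\<in>words k. if \<beta> = \<alpha> then D \<alpha> x else 0)"
    unfolding jet_form_def by (intro sum.cong refl) (auto simp: monomial_axis a words_def)
  also have "\<dots> = (if \<alpha> \<in> words k then D \<alpha> x else 0)" by simp
  also have "\<dots> = D \<alpha> x" using a by (simp add: words_def)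
  finally show ?thesis .
qed

section \<open>Maps of class C^r on a convex body and their jets\<close>

locale convex_body =
  fixes K :: "(real^'n) set"
  assumes compact_K: "compact K" and convex_K: "convex K" and interior_K: "interior K \<noteq> {}"
begin

lemma closure_interior_K: "closure (interior K) = K"
  using convex_closure_interior[OF convex_K interior_K] compact_K
  by (simp add: compact_imp_closed)

lemma topspace_deriv_dom: "topspace (deriv_dom euclidean K k) = K \<times> topspace (power_topology euclidean k)"
  by (simp add: deriv_dom_def)

text \<open>For fixed directions both sides are continuous in \<open>x\<close>, and the interior is
  dense in \<open>K\<close>. This is what makes the \<open>THE\<close> in \<open>deriv_ext\<close>
  computable.\<close>

lemma continuous_extension_unique:
  fixes g g' :: "(real^'n) \<times> (nat \<Rightarrow> real^'n) \<Rightarrow> 'b::metric_space"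
  assumes g: "continuous_map (deriv_dom euclidean K k) euclidean g"
    and g': "continuous_map (deriv_dom euclidean K k) euclidean g'"
    and eq: "\<And>x. x \<in> interior K \<Longrightarrow> g (x, z) = g' (x, z)"
    and x: "x \<in> K" and z: "z \<in> topspace (power_topology euclidean k)"
  shows "g (x, z) = g' (x, z)"
proof -
  have c: "continuous_map (top_of_set K) (deriv_dom euclidean K k) (\<lambda>x. (x, z))"
    unfolding deriv_dom_def using z by (intro continuous_map_pairedI) auto
  have "x \<in> top_of_set K closure_of interior K"
    using x closure_interior_K interior_subset[of K]
    by (simp add: closure_of_subtopology Int_absorb1)
  then show ?thesis
  proof (rule forall_in_closure_of_eq)
    show "Hausdorff_space (euclidean :: 'b topology)" by simp
    show "continuous_map (top_of_set K) euclidean (\<lambda>x. g (x, z))"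
      "continuous_map (top_of_set K) euclidean (\<lambda>x. g' (x, z))"
      using continuous_map_compose[OF c g] continuous_map_compose[OF c g'] by (simp_all add: o_def)
  qed (use eq in auto)
qed

lemma deriv_ext_eqI:
  fixes g :: "(real^'n) \<times> (nat \<Rightarrow> real^'n) \<Rightarrow> 'b::real_normed_vector"
  assumes g: "continuous_map (deriv_dom euclidean K k) euclidean g"
    and eq: "\<And>x z. x \<in> interior K \<Longrightarrow> z \<in> topspace (power_topology euclidean k) \<Longrightarrow>
      g (x, z) = iter_dir_deriv euclidean f k z x"
  shows "deriv_ext euclidean euclidean K f k = restrict g (topspace (deriv_dom euclidean K k))"
  unfolding deriv_ext_def
proof (rule the_equality, intro conjI)
  show r: "continuous_map (deriv_dom euclidean K k) euclidean (restrict g (topspace (deriv_dom euclidean K k)))"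
    using g by (rule continuous_map_eq) auto
  show "\<forall>x\<in>euclidean interior_of K. \<forall>z\<in>topspace (power_topology euclidean k).
     restrict g (topspace (deriv_dom euclidean K k)) (x, z) = iter_dir_deriv euclidean f k z x"
    using eq interior_subset by (auto simp: topspace_deriv_dom)
next
  fix g' assume g': "g' \<in> extensional (topspace (deriv_dom euclidean K k)) \<and>
    continuous_map (deriv_dom euclidean K k) euclidean g' \<and>
    (\<forall>x\<in>euclidean interior_of K. \<forall>z\<in>topspace (power_topology euclidean k).
       g' (x, z) = iter_dir_deriv euclidean f k z x)"
  show "g' = restrict g (topspace (deriv_dom euclidean K k))"
  proof (rule extensionalityI)
    fix p assume "p \<in> topspace (deriv_dom euclidean K k)"
    then show "g' p = restrict g (topspace (deriv_dom euclidean K k)) p"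
      using continuous_extension_unique[of k g' g "snd p" "fst p"] g g' eq
      by (auto simp: topspace_deriv_dom)
  qed (use g' in auto)
qed auto

lemma deriv_ext_jet:
  fixes D :: "'n list \<Rightarrow> real^'n \<Rightarrow> 'b::real_normed_vector"
  assumes D: "jet K r D" and f: "\<And>x. x \<in> interior K \<Longrightarrow> f x = D [] x" and k: "enat k \<le> r"
  shows "deriv_ext euclidean euclidean K f k =
    restrict (\<lambda>(x, z). jet_form D k x z) (topspace (deriv_dom euclidean K k))"
proof (rule deriv_ext_eqI)
  show "continuous_map (deriv_dom euclidean K k) euclidean (\<lambda>(x, z). jet_form D k x z)"
    by (rule continuous_map_jet_form) (use k in \<open>auto intro: jet_cont[OF D]\<close>)
qed (simp add: iter_dir_deriv_jet[OF D f k])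

lemma PD_jet:
  assumes D: "jet K r D" and f: "\<And>x. x \<in> interior K \<Longrightarrow> f x = D [] x"
    and "enat (length \<alpha>) \<le> r" "x \<in> K"
  shows "PD K f \<alpha> x = D \<alpha> x"
  unfolding PD_def
  by (subst deriv_ext_jet[OF D f])
    (use assms in \<open>auto simp: jet_form_axis topspace_deriv_dom power_topology_def\<close>)

text \<open>With its converse \<open>jet_PD\<close> this lets jets replace the definition of
  C^r-maps in what follows: the jet forms serve as the continuous extensions of the iterated
  derivatives.\<close>

lemma Cr_on_jet:
  fixes D :: "'n list \<Rightarrow> real^'n \<Rightarrow> real^'n"
  assumes D: "jet K r D" and f: "\<And>x. x \<in> K \<Longrightarrow> f x = D [] x"
  shows "Cr_on euclidean euclidean r K f"
proof -
  have f': "\<And>x. x \<in> interior K \<Longrightarrow> f x = D [] x"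
    using f interior_subset by blast
  have contK: "continuous_on K f"
    by (rule continuous_on_eq[OF jet_cont[OF D, of "[]"]]) (auto simp: f zero_enat_def[symmetric])
  have ext: "continuous_map (deriv_dom euclidean K k) euclidean (\<lambda>(x, z). jet_form D k x z)"
    if "enat k \<le> r" for k
    by (rule continuous_map_jet_form) (use that in \<open>auto intro: jet_cont[OF D]\<close>)
  have "continuous_map (deriv_dom euclidean (interior K) k) euclidean (\<lambda>(x, y). iter_dir_deriv euclidean f k y x)"
    if k: "enat k \<le> r" for k
  proof (rule continuous_map_eq)
    show "continuous_map (deriv_dom euclidean (interior K) k) euclidean (\<lambda>(x, z). jet_form D k x z)"
      by (rule continuous_map_jet_form)
        (use k in \<open>auto intro: continuous_on_subset[OF jet_cont[OF D] interior_subset]\<close>)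
  qed (auto simp: deriv_dom_def iter_dir_deriv_jet[OF D f' k])
  moreover have "\<exists>l. has_dir_deriv euclidean (iter_dir_deriv euclidean f k y) (y k) x l"
    if "enat (Suc k) \<le> r" "x \<in> interior K" for k x y
  proof -
    have k: "enat k \<le> r" using that(1) by (metis Suc_ile_eq order_less_imp_le)
    show ?thesis
      using has_dir_deriv_jet_form[OF D iter_dir_deriv_jet[OF D f' k] that] by blast
  qed
  ultimately have "Cr_on_open euclidean euclidean r (interior K) f"
    unfolding Cr_on_open_def using continuous_on_subset[OF contK interior_subset] by auto
  moreover have "\<exists>V W. openin (top_of_set K) W \<and> x \<in> W \<and> W \<subseteq> V \<and> V \<subseteq> K \<and> convex V"
    if "x \<in> K" for x
    using that convex_K by (intro exI[of _ K]) auto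
  moreover have "\<exists>g. continuous_map (deriv_dom euclidean K k) euclidean g \<and>
         (\<forall>x\<in>interior K. \<forall>y\<in>topspace (power_topology euclidean k).
            g (x, y) = iter_dir_deriv euclidean f k y x)" if k: "enat k \<le> r" for k
    by (rule exI[of _ "\<lambda>(x, z). jet_form D k x z"]) (use ext[OF k] iter_dir_deriv_jet[OF D f' k] in auto)
  ultimately show ?thesis
    unfolding Cr_on_def using contK closure_interior_K by auto
qed

lemma jet_PD:
  assumes f: "Cr_on euclidean euclidean r K f"
  shows "jet K r (PD K f)" and "x \<in> K \<Longrightarrow> PD K f [] x = f x"
proof -
  let ?ax = "\<lambda>\<alpha>::'n list. \<lambda>i\<in>{..<length \<alpha>}. axis (\<alpha> ! i) (1::real)"
  have ax: "?ax \<alpha> \<in> topspace (power_topology euclidean (length \<alpha>))" for \<alpha>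
    by (auto simp: power_topology_def)
  have ext: "continuous_map (deriv_dom euclidean K k) euclidean (deriv_ext euclidean euclidean K f k) \<and>
     (\<forall>x\<in>interior K. \<forall>y\<in>topspace (power_topology euclidean k).
            deriv_ext euclidean euclidean K f k (x, y) = iter_dir_deriv euclidean f k y x)"
    if k: "enat k \<le> r" for k
  proof -
    obtain g where g: "continuous_map (deriv_dom euclidean K k) euclidean g"
         "\<And>x y. x\<in>interior K \<Longrightarrow> y\<in>topspace (power_topology euclidean k) \<Longrightarrow>
            g (x, y) = iter_dir_deriv euclidean f k y x"
      using f k unfolding Cr_on_def by (metis euclidean_interior_of)
    have "deriv_ext euclidean euclidean K f k = restrict g (topspace (deriv_dom euclidean K k))"
      by (rule deriv_ext_eqI) (use g in auto)
    then show ?thesis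
      using continuous_map_eq[OF g(1)] g(2) subsetD[OF interior_subset[of K]] by (auto simp: topspace_deriv_dom)
  qed
  have cont: "continuous_on K (PD K f \<alpha>)" if "enat (length \<alpha>) \<le> r" for \<alpha>
  proof -
    have "continuous_map (top_of_set K) (deriv_dom euclidean K (length \<alpha>)) (\<lambda>x. (x, ?ax \<alpha>))"
      unfolding deriv_dom_def using ax by (intro continuous_map_pairedI) auto
    from continuous_map_compose[OF this conjunct1[OF ext[OF that]]]
    show ?thesis by (simp add: PD_def o_def cong: continuous_on_cong)
  qed
  have PDint: "PD K f \<alpha> x = iter_dir_deriv euclidean f (length \<alpha>) (?ax \<alpha>) x"
    if "x \<in> interior K" "enat (length \<alpha>) \<le> r" for x \<alpha>
    using ext[OF that(2)] that(1) ax unfolding PD_def by auto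
  \<comment> \<open>At order \<open>length \<alpha>\<close> only that many directions matter, so the
    unit vectors of \<open>\<alpha> @ [i]\<close> may be replaced by those of
    \<open>\<alpha>\<close>.\<close>
  have cong: "iter_dir_deriv euclidean f k y = iter_dir_deriv euclidean f k y'"
    if "\<And>i. i < k \<Longrightarrow> y i = y' i" for k y y'
    using that by (induction k) auto
  show "jet K r (PD K f)"
    unfolding jet_def
  proof (intro conjI allI impI ballI)
    fix \<alpha> :: "'n list" and x assume r: "enat (Suc (length \<alpha>)) \<le> r" and x: "x \<in> interior K"
    have r': "enat (length \<alpha>) \<le> r" using r by (metis Suc_ile_eq order_less_imp_le)
    show "(PD K f \<alpha> has_derivative (\<lambda>h. \<Sum>i\<in>UNIV. (h$i) *\<^sub>R PD K f (\<alpha> @ [i]) x)) (at x)"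
    \<comment> \<open>The definition of C^r yields directional derivatives only; continuity of the
      next partial derivatives upgrades them to a total one.\<close>
    proof (rule has_derivative_of_continuous_partials[OF open_interior x])
      fix i show "continuous_on (interior K) (PD K f (\<alpha> @ [i]))"
        by (rule continuous_on_subset[OF cont interior_subset]) (use r in auto)
      fix z assume z: "z \<in> interior K"
      let ?y = "?ax (\<alpha> @ [i])"
      have "\<exists>l. has_dir_deriv euclidean (iter_dir_deriv euclidean f (length \<alpha>) ?y) (?y (length \<alpha>)) z l"
        using f r z ax[of "\<alpha> @ [i]"] unfolding Cr_on_def Cr_on_open_def euclidean_interior_of
        by (metis length_append_singleton)
      then have "has_dir_deriv euclidean (iter_dir_deriv euclidean f (length \<alpha>) ?y) (?y (length \<alpha>)) z
          (iter_dir_deriv euclidean f (Suc (length \<alpha>)) ?y z)"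
        using dir_deriv_euclideanI by fastforce
      moreover have "iter_dir_deriv euclidean f (length \<alpha>) ?y = iter_dir_deriv euclidean f (length \<alpha>) (?ax \<alpha>)"
        by (rule cong) (auto simp: nth_append)
      ultimately have "has_dir_deriv euclidean (iter_dir_deriv euclidean f (length \<alpha>) (?ax \<alpha>)) (axis i 1) z
          (PD K f (\<alpha> @ [i]) z)"
        using PDint[OF z, of "\<alpha> @ [i]"] r by simp
      then have hv: "((\<lambda>t. iter_dir_deriv euclidean f (length \<alpha>) (?ax \<alpha>) (z + t *\<^sub>R axis i 1))
          has_vector_derivative PD K f (\<alpha> @ [i]) z) (at 0)"
        by (simp add: has_dir_deriv_euclidean)
      have ev: "\<forall>\<^sub>F t in nhds 0. iter_dir_deriv euclidean f (length \<alpha>) (?ax \<alpha>) (z + t *\<^sub>R axis i 1)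
          = PD K f \<alpha> (z + t *\<^sub>R axis i 1)"
      proof -
        have "((\<lambda>t. z + t *\<^sub>R axis i 1) \<longlongrightarrow> z + 0 *\<^sub>R axis i 1) (nhds 0)"
          by (intro tendsto_intros filterlim_ident)
        then have "\<forall>\<^sub>F t in nhds 0. z + t *\<^sub>R axis i 1 \<in> interior K"
          using z by (auto dest: topological_tendstoD[OF _ open_interior])
        then show ?thesis by (rule eventually_mono) (simp add: PDint[OF _ r'])
      qed
      show "((\<lambda>t. PD K f \<alpha> (z + t *\<^sub>R axis i 1)) has_vector_derivative PD K f (\<alpha> @ [i]) z) (at 0)"
        using hv unfolding has_vector_derivative_def
      proof (rule has_derivative_transform_eventually)
        show "\<forall>\<^sub>F t in at 0. iter_dir_deriv euclidean f (length \<alpha>) (?ax \<alpha>) (z + t *\<^sub>R axis i 1)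
          = PD K f \<alpha> (z + t *\<^sub>R axis i 1)"
          unfolding eventually_at_filter using ev by (rule eventually_mono) simp
      qed (use z in \<open>auto simp: PDint[OF _ r']\<close>)
    qed
  qed (rule cont)
  have "continuous_on K f" using f by (simp add: Cr_on_def)
  then have "continuous_map (deriv_dom euclidean K 0) euclidean (\<lambda>p. f (fst p))"
    unfolding deriv_dom_def
    by (intro continuous_map_compose[OF continuous_map_fst, unfolded o_def]) simp
  then have "deriv_ext euclidean euclidean K f 0 = restrict (\<lambda>p. f (fst p)) (topspace (deriv_dom euclidean K 0))"
    by (rule deriv_ext_eqI) auto
  then show "x \<in> K \<Longrightarrow> PD K f [] x = f x"
    using ax[of "[]"] by (simp add: PD_def topspace_deriv_dom)
qed

end

section \<open>The topology of the space of maps as a seminorm topology\<close>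

lemma fun_minus_apply [simp]: "(f - g) x = f x - (g x :: 'b::ab_group_add)"
  by (simp add: fun_diff_def)

context convex_body begin

abbreviation X :: "enat \<Rightarrow> (real^'n \<Rightarrow> real^'n) set" where
  "X r \<equiv> topspace (Cr_bdry_topology r K)"

text \<open>Each d^(k) f, a function of infinitely many directions, is thereby governed by finitely
  many partial derivatives. This is why countably many norms will describe the topology.\<close>

lemma deriv_ext_PD:
  assumes "Cr_on euclidean euclidean r K f" "enat k \<le> r"
  shows "deriv_ext euclidean euclidean K f k =
    restrict (\<lambda>(x, z). jet_form (PD K f) k x z) (topspace (deriv_dom euclidean K k))"
  by (rule deriv_ext_jet[OF jet_PD(1)[OF assms(1)] _ assms(2)])
    (use jet_PD(2)[OF assms(1)] subsetD[OF interior_subset[of K]] in auto)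

lemma topspace_compact_open:
  "topspace (compact_open_topology Y Z) = {g \<in> extensional (topspace Y). continuous_map Y Z g}"
proof -
  have "g \<in> topspace (compact_open_topology Y Z)" if "g \<in> extensional (topspace Y)" "continuous_map Y Z g" for g
    unfolding compact_open_topology_def topology_generated_by_topspace
    \<comment> \<open>The subbasic set for the empty compact set and the empty open set imposes no
      constraint, so it is already the whole space.\<close>
    by (rule UnionI[of "{h \<in> extensional (topspace Y). continuous_map Y Z h \<and> h ` {} \<subseteq> {}}"],
        rule CollectI, rule exI[of _ "{}"], rule exI[of _ "{}"]) (use that in auto)
  then show ?thesis unfolding compact_open_topology_def by auto
qed

lemma deriv_ext_in_compact_open:
  fixes f :: "real^'n \<Rightarrow> real^'n"
  assumes "Cr_on euclidean euclidean r K f" "enat k \<le> r"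
  shows "deriv_ext euclidean euclidean K f k \<in>
    topspace (compact_open_topology (deriv_dom euclidean K k) euclidean)"
proof -
  have "continuous_map (deriv_dom euclidean K k) euclidean (\<lambda>(x, z). jet_form (PD K f) k x z)"
    by (rule continuous_map_jet_form) (use assms(2) in \<open>auto intro: jet_cont[OF jet_PD(1)[OF assms(1)]]\<close>)
  then show ?thesis
    unfolding deriv_ext_PD[OF assms] topspace_compact_open by (auto intro: continuous_map_eq)
qed

lemma topspace_Cr_topology:
  "topspace (Cr_topology euclidean (euclidean :: (real^'n) topology) r K) = Cr_space euclidean euclidean r K"
  unfolding Cr_topology_def topspace_pullback_topology topspace_product_topology
  by (auto simp: Cr_space_def intro: deriv_ext_in_compact_open)

lemma X_iff: "f \<in> X r \<longleftrightarrow> Cr_on euclidean euclidean r K f \<and> (\<forall>x. x \<notin> K \<longrightarrow> f x = 0) \<and> (\<forall>x\<in>frontier K. f x = 0)"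
  unfolding Cr_bdry_topology_def topspace_subtopology topspace_Cr_topology
  by (auto simp: Cr_space_def)

lemma X_Cr_on: "f \<in> X r \<Longrightarrow> Cr_on euclidean euclidean r K f" by (simp add: X_iff)

lemma X_jet: "f \<in> X r \<Longrightarrow> jet K r (PD K f)" using jet_PD(1) X_Cr_on by blast

lemma PD_Nil: "f \<in> X r \<Longrightarrow> x \<in> K \<Longrightarrow> PD K f [] x = f x" using jet_PD(2) X_Cr_on by blast

lemma X_outside: "f \<in> X r \<Longrightarrow> x \<notin> interior K \<Longrightarrow> f x = 0"
  using compact_K by (auto simp: X_iff frontier_def compact_imp_closed)

text \<open>A single condition off the interior covers both the frontier and the complement of
  \<open>K\<close>.\<close>

lemma X_I:
  assumes D: "jet K r D" and f: "\<And>x. x \<in> K \<Longrightarrow> f x = D [] x" and out: "\<And>x. x \<notin> interior K \<Longrightarrow> f x = 0"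
  shows "f \<in> X r"
  using Cr_on_jet[OF D f] out subsetD[OF interior_subset[of K]] by (auto simp: X_iff frontier_def)

lemma PD_eq:
  assumes "jet K r D" "\<And>x. x \<in> K \<Longrightarrow> f x = D [] x" "enat (length \<alpha>) \<le> r" "x \<in> K"
  shows "PD K f \<alpha> x = D \<alpha> x"
  by (rule PD_jet[OF assms(1) _ assms(3,4)]) (use assms(2) interior_subset in blast)

lemma X_add: assumes "f \<in> X r" "g \<in> X r" shows "f + g \<in> X r"
  by (rule X_I[OF jet_add[OF X_jet[OF assms(1)] X_jet[OF assms(2)]]])
    (use assms in \<open>auto simp: PD_Nil X_outside\<close>)

lemma X_scale: assumes "f \<in> X r" shows "c *\<^sub>R f \<in> X r"
  by (rule X_I[OF jet_scale[OF X_jet[OF assms]]]) (use assms in \<open>auto simp: PD_Nil X_outside\<close>)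

lemma X_zero: "0 \<in> X r"
  by (rule X_I[OF jet_zero]) auto

lemma subspace_X: "subspace (X r)"
  unfolding subspace_def using X_add X_scale X_zero by blast

lemma X_diff: "f \<in> X r \<Longrightarrow> g \<in> X r \<Longrightarrow> f - g \<in> X r"
  using subspace_X subspace_diff by blast

lemma PD_add:
  assumes "f \<in> X r" "g \<in> X r" "enat (length \<alpha>) \<le> r" "x \<in> K"
  shows "PD K (f + g) \<alpha> x = PD K f \<alpha> x + PD K g \<alpha> x"
  by (rule PD_eq[OF jet_add[OF X_jet[OF assms(1)] X_jet[OF assms(2)]] _ assms(3,4)])
    (use assms in \<open>auto simp: PD_Nil\<close>)

lemma PD_scale:
  assumes "f \<in> X r" "enat (length \<alpha>) \<le> r" "x \<in> K"
  shows "PD K (c *\<^sub>R f) \<alpha> x = c *\<^sub>R PD K f \<alpha> x"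
  by (rule PD_eq[OF jet_scale[OF X_jet[OF assms(1)]] _ assms(2,3)])
    (use assms in \<open>auto simp: PD_Nil\<close>)

lemma PD_zero: "x \<in> K \<Longrightarrow> PD K 0 \<alpha> x = 0"
  by (rule PD_eq[OF jet_zero, of _ _ "\<infinity>"]) auto

lemma PD_diff:
  assumes "f \<in> X r" "g \<in> X r" "enat (length \<alpha>) \<le> r" "x \<in> K"
  shows "PD K (f - g) \<alpha> x = PD K f \<alpha> x - PD K g \<alpha> x"
proof -
  have "f - g = f + (-1) *\<^sub>R g" by simp
  then have "PD K (f - g) \<alpha> x = PD K f \<alpha> x + PD K ((-1) *\<^sub>R g) \<alpha> x"
    by (simp only: PD_add[OF assms(1) X_scale[OF assms(2)] assms(3,4)])
  also have "PD K ((-1) *\<^sub>R g) \<alpha> x = (-1) *\<^sub>R PD K g \<alpha> x"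
    by (rule PD_scale[OF assms(2-4)])
  finally show ?thesis by (simp only: scaleR_minus1_left add_uminus_conv_diff)
qed

text \<open>The C^k-norm. Taking all orders up to \<open>k\<close> makes it increasing in
  \<open>k\<close>, so that one order and one radius suffice to describe a basic
  neighbourhood.\<close>

definition snorm :: "nat \<Rightarrow> (real^'n \<Rightarrow> real^'n) \<Rightarrow> real" where
  "snorm k f = (SUP p\<in>{\<alpha>. length \<alpha> \<le> k} \<times> K. norm (PD K f (fst p) (snd p)))"

lemma K_ne: "K \<noteq> {}" using interior_K interior_subset by blast

lemma snorm_bdd:
  assumes f: "f \<in> X r" and k: "enat k \<le> r"
  shows "bdd_above ((\<lambda>p. norm (PD K f (fst p) (snd p))) ` ({\<alpha>. length \<alpha> \<le> k} \<times> K))"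
proof -
  have fin: "finite {\<alpha>::'n list. length \<alpha> \<le> k}"
    using finite_lists_length_le[of "UNIV :: 'n set" k] by simp
  have "bounded (PD K f \<alpha> ` K)" if "length \<alpha> \<le> k" for \<alpha>
  proof -
    have "enat (length \<alpha>) \<le> r" using that k by (meson enat_ord_simps(1) order_trans)
    then show ?thesis
      using compact_continuous_image[OF jet_cont[OF X_jet[OF f]] compact_K] compact_imp_bounded by blast
  qed
  then have "bounded (\<Union>\<alpha>\<in>{\<alpha>. length \<alpha> \<le> k}. PD K f \<alpha> ` K)"
    using fin by auto
  then obtain B where B: "\<And>v. v \<in> (\<Union>\<alpha>\<in>{\<alpha>. length \<alpha> \<le> k}. PD K f \<alpha> ` K) \<Longrightarrow> norm v \<le> B"
    unfolding bounded_iff by blast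
  have "norm (PD K f \<alpha> x) \<le> B" if "length \<alpha> \<le> k" "x \<in> K" for \<alpha> x
    by (rule B, rule UN_I[of \<alpha>]) (use that in auto)
  then show ?thesis by (intro bdd_aboveI[of _ B]) auto
qed

lemma snorm_le_iff:
  assumes f: "f \<in> X r" and k: "enat k \<le> r"
  shows "snorm k f \<le> e \<longleftrightarrow> (\<forall>\<alpha> x. length \<alpha> \<le> k \<longrightarrow> x \<in> K \<longrightarrow> norm (PD K f \<alpha> x) \<le> e)"
proof -
  have "([], SOME x. x \<in> K) \<in> {\<alpha>::'n list. length \<alpha> \<le> k} \<times> K"
    using K_ne some_in_eq[of K] by simp
  then have ne: "{\<alpha>::'n list. length \<alpha> \<le> k} \<times> K \<noteq> {}" by blast
  show ?thesis
    unfolding snorm_def by (subst cSUP_le_iff[OF ne snorm_bdd[OF assms]]) auto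
qed

lemma norm_PD_le:
  assumes "f \<in> X r" "enat k \<le> r" "length \<alpha> \<le> k" "x \<in> K"
  shows "norm (PD K f \<alpha> x) \<le> snorm k f"
  using snorm_le_iff[OF assms(1,2), of "snorm k f"] assms(3,4) by simp

lemma snorm_nonneg: "f \<in> X r \<Longrightarrow> enat k \<le> r \<Longrightarrow> 0 \<le> snorm k f"
  using norm_PD_le[of f r k "[]" "SOME x. x \<in> K"] some_in_eq[of K] K_ne
  by (auto intro: order_trans[OF norm_ge_zero])

lemma enat_le_trans: "n \<le> k \<Longrightarrow> enat k \<le> r \<Longrightarrow> enat n \<le> r"
  by (meson enat_ord_simps(1) order_trans)

lemma snorm_triangle:
  assumes "f \<in> X r" "g \<in> X r" "enat k \<le> r"
  shows "snorm k (f + g) \<le> snorm k f + snorm k g"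
  unfolding snorm_le_iff[OF X_add[OF assms(1,2)] assms(3)]
proof (intro allI impI)
  fix \<alpha> :: "'n list" and x assume a: "length \<alpha> \<le> k" "x \<in> K"
  show "norm (PD K (f + g) \<alpha> x) \<le> snorm k f + snorm k g"
    using PD_add[OF assms(1,2) enat_le_trans[OF a(1) assms(3)] a(2)]
      norm_PD_le[OF assms(1,3) a] norm_PD_le[OF assms(2,3) a]
      norm_triangle_ineq[of "PD K f \<alpha> x" "PD K g \<alpha> x"] by simp
qed

lemma snorm_scale_le:
  assumes "f \<in> X r" "enat k \<le> r"
  shows "snorm k (c *\<^sub>R f) \<le> \<bar>c\<bar> * snorm k f"
  unfolding snorm_le_iff[OF X_scale[OF assms(1)] assms(2)]
proof (intro allI impI)
  fix \<alpha> :: "'n list" and x assume a: "length \<alpha> \<le> k" "x \<in> K"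
  show "norm (PD K (c *\<^sub>R f) \<alpha> x) \<le> \<bar>c\<bar> * snorm k f"
    using PD_scale[OF assms(1) enat_le_trans[OF a(1) assms(2)] a(2)]
      norm_PD_le[OF assms a] by (simp add: mult_left_mono)
qed

lemma snorm_scale:
  assumes "f \<in> X r" "enat k \<le> r"
  shows "snorm k (c *\<^sub>R f) = \<bar>c\<bar> * snorm k f"
proof (cases "c = 0")
  case True
  then show ?thesis using snorm_scale_le[OF assms, of c] snorm_nonneg[OF X_scale[OF assms(1)] assms(2), of c] by simp
next
  case False
  have "snorm k (inverse c *\<^sub>R (c *\<^sub>R f)) \<le> \<bar>inverse c\<bar> * snorm k (c *\<^sub>R f)"
    by (rule snorm_scale_le[OF X_scale[OF assms(1)] assms(2)])
  moreover have "inverse c *\<^sub>R (c *\<^sub>R f) = f" using False by (simp only: scaleR_scaleR) simp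
  ultimately have "\<bar>c\<bar> * snorm k f \<le> snorm k (c *\<^sub>R f)"
    using False by (simp add: field_simps)
  with snorm_scale_le[OF assms, of c] show ?thesis by simp
qed

lemma snorm_diff_commute:
  assumes "f \<in> X r" "g \<in> X r" "enat k \<le> r"
  shows "snorm k (f - g) = snorm k (g - f)"
  using snorm_scale[OF X_diff[OF assms(1,2)] assms(3), of "-1"] by simp

lemma snorm_zero: "snorm k 0 = 0"
  using snorm_scale[OF X_zero, of k "\<infinity>" 0] by simp

lemma snorm_triangle_diff:
  assumes "f \<in> X r" "g \<in> X r" "h \<in> X r" "enat k \<le> r"
  shows "snorm k (f - h) \<le> snorm k (f - g) + snorm k (g - h)"
  using snorm_triangle[OF X_diff[OF assms(1,2)] X_diff[OF assms(2,3)] assms(4)] by simp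

lemma snorm_mono:
  assumes "f \<in> X r" "enat k \<le> r" "j \<le> k"
  shows "snorm j f \<le> snorm k f"
  using snorm_le_iff[OF assms(1) enat_le_trans[OF assms(3,2)]] norm_PD_le[OF assms(1,2)] assms(3) by auto

text \<open>Order 0 is among those in the supremum, so each \<open>snorm k\<close> is a norm and not
  merely a seminorm.\<close>

lemma nrm_0_eq:
  assumes f: "f \<in> X r" and "snorm k f = 0" "enat k \<le> r"
  shows "f = 0"
proof
  fix x show "f x = 0 x"
  proof (cases "x \<in> K")
    case True
    then show ?thesis using norm_PD_le[OF f assms(3), of "[]" x] PD_Nil[OF f] assms(2) by simp
  next
    case False
    then show ?thesis using f by (simp add: X_iff)
  qed
qed

text \<open>This will turn out to be \<open>Cr_bdry_topology r K\<close>.\<close>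

definition seminorm_topology :: "enat \<Rightarrow> (real^'n \<Rightarrow> real^'n) topology" where
  "seminorm_topology r = topology (\<lambda>V. V \<subseteq> X r \<and>
     (\<forall>f\<in>V. \<exists>k e. enat k \<le> r \<and> 0 < e \<and> {g \<in> X r. snorm k (g - f) < e} \<subseteq> V))"

lemma openin_seminorm_topology: "openin (seminorm_topology r) V \<longleftrightarrow> V \<subseteq> X r \<and>
     (\<forall>f\<in>V. \<exists>k e. enat k \<le> r \<and> 0 < e \<and> {g \<in> X r. snorm k (g - f) < e} \<subseteq> V)"
proof -
  have "istopology (\<lambda>V. V \<subseteq> X r \<and>
     (\<forall>f\<in>V. \<exists>k e. enat k \<le> r \<and> 0 < e \<and> {g \<in> X r. snorm k (g - f) < e} \<subseteq> V))"
    unfolding istopology_def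
  proof (intro conjI allI impI ballI)
    fix S T f
    assume S: "S \<subseteq> X r \<and> (\<forall>f\<in>S. \<exists>k e. enat k \<le> r \<and> 0 < e \<and> {g \<in> X r. snorm k (g - f) < e} \<subseteq> S)"
      and T: "T \<subseteq> X r \<and> (\<forall>f\<in>T. \<exists>k e. enat k \<le> r \<and> 0 < e \<and> {g \<in> X r. snorm k (g - f) < e} \<subseteq> T)"
      and f: "f \<in> S \<inter> T"
    obtain k e where 1: "enat k \<le> r" "0 < e" "{g \<in> X r. snorm k (g - f) < e} \<subseteq> S" using S f by blast
    obtain k' e' where 2: "enat k' \<le> r" "0 < e'" "{g \<in> X r. snorm k' (g - f) < e'} \<subseteq> T" using T f by blast
    have m: "enat (max k k') \<le> r" using 1 2 by (simp add: max_def)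
    have fX: "f \<in> X r" using f S by blast
    show "\<exists>k e. enat k \<le> r \<and> 0 < e \<and> {g \<in> X r. snorm k (g - f) < e} \<subseteq> S \<inter> T"
    proof (intro exI conjI)
      show "{g \<in> X r. snorm (max k k') (g - f) < min e e'} \<subseteq> S \<inter> T"
      proof
        fix g assume g: "g \<in> {g \<in> X r. snorm (max k k') (g - f) < min e e'}"
        then have d: "g - f \<in> X r" using fX X_diff by blast
        have "snorm k (g - f) < e" "snorm k' (g - f) < e'"
          using snorm_mono[OF d m, of k] snorm_mono[OF d m, of k'] g by auto
        then show "g \<in> S \<inter> T" using g 1 2 by blast
      qed
    qed (use m 1 2 in auto)
  next
    fix \<C> assume C: "\<forall>S\<in>\<C>. S \<subseteq> X r \<and> (\<forall>f\<in>S. \<exists>k e. enat k \<le> r \<and> 0 < e \<and> {g \<in> X r. snorm k (g - f) < e} \<subseteq> S)"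
    then show "\<Union>\<C> \<subseteq> X r" by blast
    fix f assume "f \<in> \<Union>\<C>"
    then obtain S where S: "S \<in> \<C>" "f \<in> S" by blast
    with C obtain k e where "enat k \<le> r" "0 < e" "{g \<in> X r. snorm k (g - f) < e} \<subseteq> S" by meson
    then show "\<exists>k e. enat k \<le> r \<and> 0 < e \<and> {g \<in> X r. snorm k (g - f) < e} \<subseteq> \<Union>\<C>" using S by blast
  qed blast
  then show ?thesis by (simp add: seminorm_topology_def topology_inverse')
qed

lemma topspace_seminorm_topology: "topspace (seminorm_topology r) = X r"
proof -
  have "openin (seminorm_topology r) (X r)"
    unfolding openin_seminorm_topology by (auto intro!: exI[of _ 0] exI[of _ "1::real"] simp: zero_enat_def[symmetric])
  then show ?thesis by (metis openin_seminorm_topology openin_subset openin_topspace subset_antisym)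
qed

text \<open>On a compact set of pairs (x, z) the monomials in the directions are bounded. There the
  difference of two k-th derivatives is at most a constant times the C^k-norm of the difference of
  the maps.\<close>

lemma continuous_deriv_ext_seminorm_topology:
  assumes k: "enat k \<le> r"
  shows "continuous_map (seminorm_topology r) (compact_open_topology (deriv_dom euclidean K k) euclidean)
     (\<lambda>f. deriv_ext euclidean euclidean K f k)"
  unfolding compact_open_topology_def
proof (rule continuous_on_generated_topo)
  let ?d = "\<lambda>f. deriv_ext euclidean euclidean K f k"
  show "?d ` topspace (seminorm_topology r) \<subseteq> \<Union>{{g \<in> extensional (topspace (deriv_dom euclidean K k)).
       continuous_map (deriv_dom euclidean K k) euclidean g \<and> g ` S \<subseteq> V} |S V.
      compactin (deriv_dom euclidean K k) S \<and> openin euclidean V}"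
    using deriv_ext_in_compact_open[OF X_Cr_on k]
    unfolding compact_open_topology_def topology_generated_by_topspace topspace_seminorm_topology by blast
  fix U assume "U \<in> {{g \<in> extensional (topspace (deriv_dom euclidean K k)).
       continuous_map (deriv_dom euclidean K k) (euclidean :: (real^'n) topology) g \<and> g ` S \<subseteq> V} |S V.
      compactin (deriv_dom euclidean K k) S \<and> openin euclidean V}"
  then obtain S and V :: "(real^'n) set" where U: "U = {g \<in> extensional (topspace (deriv_dom euclidean K k)).
       continuous_map (deriv_dom euclidean K k) euclidean g \<and> g ` S \<subseteq> V}"
    and S: "compactin (deriv_dom euclidean K k) S" and V: "open V" by auto
  have Ssub: "S \<subseteq> topspace (deriv_dom euclidean K k)" using S by (rule compactin_subset_topspace)
  let ?w = "\<lambda>p. \<Sum>\<alpha>\<in>words k. \<bar>monomial (snd p) (\<alpha>::'n list)\<bar>"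
  have "continuous_map (deriv_dom euclidean K k) euclideanreal ?w"
  proof -
    have "continuous_map (deriv_dom euclidean K k) euclidean (\<lambda>p. snd p i)" if "i < k" for i
      using that unfolding deriv_dom_def power_topology_def
      by (intro continuous_map_compose[OF continuous_map_snd, unfolded o_def])
        (use continuous_map_product_projection[of i "{..<k}" "\<lambda>_. euclidean"] in auto)
    then show ?thesis
      unfolding continuous_map_euclidean_iff_tendsto monomial_def
      by (intro ballI tendsto_sum tendsto_rabs tendsto_prod tendsto_vec_nth) (auto simp: words_def)
  qed
  from image_compactin[OF S this] have "bounded (?w ` S)"
    by (simp add: compact_imp_bounded)
  then obtain B0 where B0: "\<And>p. p \<in> S \<Longrightarrow> \<bar>?w p\<bar> \<le> B0"
    unfolding bounded_iff by auto
  \<comment> \<open>The bound is going to be a divisor, so it is made positive; \<open>S\<close> may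
    be empty and then \<open>B0\<close> is arbitrary.\<close>
  define B where "B = \<bar>B0\<bar> + 1"
  have B: "B > 0" "\<And>p. p \<in> S \<Longrightarrow> ?w p \<le> B"
    using B0 unfolding B_def by (auto, smt (verit))
  show "openin (seminorm_topology r) (?d -` U \<inter> topspace (seminorm_topology r))"
    unfolding openin_seminorm_topology topspace_seminorm_topology
  proof (intro conjI ballI)
    fix f assume f: "f \<in> ?d -` U \<inter> X r"
    then have fX: "f \<in> X r" by blast
    have "compactin euclidean (?d f ` S)"
      by (rule image_compactin[OF S]) (use f U in auto)
    then have "compact (?d f ` S)" by simp
    moreover have "?d f ` S \<subseteq> V" using f U by auto
    ultimately obtain e where e: "e > 0" "(\<Union>x\<in>?d f ` S. ball x e) \<subseteq> V"
      using compact_subset_open_imp_ball_epsilon_subset V by metis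
    have "{g \<in> X r. snorm k (g - f) < e / B} \<subseteq> ?d -` U \<inter> X r"
    proof
      fix g assume "g \<in> {g \<in> X r. snorm k (g - f) < e / B}"
      then have g: "g \<in> X r" "snorm k (g - f) < e / B" by auto
      have gf: "g - f \<in> X r" using g fX X_diff by blast
      have "?d g p \<in> V" if p: "p \<in> S" for p
      proof -
        have pt: "p \<in> topspace (deriv_dom euclidean K k)" using p Ssub by blast
        then have xK: "fst p \<in> K" by (auto simp: topspace_deriv_dom)
        have "?d g p - ?d f p = (\<Sum>\<alpha>\<in>words k. monomial (snd p) \<alpha> *\<^sub>R (PD K g \<alpha> (fst p) - PD K f \<alpha> (fst p)))"
          using pt by (simp add: deriv_ext_PD[OF X_Cr_on[OF g(1)] k] deriv_ext_PD[OF X_Cr_on[OF fX] k]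
              jet_form_def case_prod_unfold scaleR_diff_right sum_subtractf)
        also have "norm \<dots> \<le> (\<Sum>\<alpha>\<in>words k. \<bar>monomial (snd p) (\<alpha>::'n list)\<bar> * snorm k (g - f))"
        proof (rule sum_norm_le)
          fix \<alpha> :: "'n list" assume "\<alpha> \<in> words k"
          then have l: "length \<alpha> = k" by (simp add: words_def)
          have "norm (PD K g \<alpha> (fst p) - PD K f \<alpha> (fst p)) \<le> snorm k (g - f)"
            using norm_PD_le[OF gf k, of \<alpha>] PD_diff[OF g(1) fX, of \<alpha>] xK l k by simp
          then show "norm (monomial (snd p) \<alpha> *\<^sub>R (PD K g \<alpha> (fst p) - PD K f \<alpha> (fst p)))
              \<le> \<bar>monomial (snd p) \<alpha>\<bar> * snorm k (g - f)"
            by (simp add: mult_left_mono)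
        qed
        also have "\<dots> \<le> B * snorm k (g - f)"
          using B(2)[OF p] snorm_nonneg[OF gf k] by (simp add: sum_distrib_right[symmetric] mult_right_mono)
        also have "\<dots> < e" using g(2) B(1) by (simp add: field_simps)
        finally have "?d g p \<in> ball (?d f p) e" by (simp add: dist_norm norm_minus_commute)
        then show ?thesis using e(2) p by blast
      qed
      then show "g \<in> ?d -` U \<inter> X r"
        using U g(1) deriv_ext_in_compact_open[OF X_Cr_on[OF g(1)] k] by (auto simp: topspace_compact_open)
    qed
    then show "\<exists>k e. enat k \<le> r \<and> 0 < e \<and> {g \<in> X r. snorm k (g - f) < e} \<subseteq> ?d -` U \<inter> X r"
      by (intro exI conjI) (rule k, rule divide_pos_pos[OF e(1) B(1)])
  qed blast
qed

lemma continuous_deriv_ext: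
  assumes k: "enat k \<le> r"
  shows "continuous_map (Cr_bdry_topology r K) (compact_open_topology (deriv_dom euclidean K k) euclidean)
     (\<lambda>f. deriv_ext euclidean euclidean K f k)"
proof -
  have "continuous_map (product_topology (\<lambda>k. compact_open_topology (deriv_dom euclidean K k) euclidean) {k. enat k \<le> r})
      (compact_open_topology (deriv_dom euclidean K k) (euclidean :: (real^'n) topology)) (\<lambda>h. h k)"
    by (rule continuous_map_product_projection) (use k in simp)
  from continuous_map_pullback[OF this, of "Cr_space euclidean euclidean r K"
      "\<lambda>f. \<lambda>k\<in>{k. enat k \<le> r}. deriv_ext euclidean euclidean K f k"]
  show ?thesis
    unfolding Cr_bdry_topology_def Cr_topology_def using k
    by (intro continuous_map_from_subtopology) (simp add: o_def)
qed

text \<open>The compact-open topology only controls images of compact sets. So the compact image of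
  \<open>PD K f \<alpha>\<close> is covered by finitely many balls of radius e/3, and the derivative
  of \<open>g\<close> is required to map each compact preimage \<open>S c\<close> into a slightly
  larger ball. Together these finitely many conditions give uniform closeness on
  \<open>K\<close>.\<close>

lemma PD_close_nbhd:
  assumes f: "f \<in> X r" and k: "enat (length \<alpha>) \<le> r" and e: "e > 0"
  shows "\<exists>V. openin (Cr_bdry_topology r K) V \<and> f \<in> V \<and> (\<forall>g\<in>V. \<forall>x\<in>K. norm (PD K g \<alpha> x - PD K f \<alpha> x) < e)"
proof -
  let ?h = "PD K f \<alpha>" let ?k = "length \<alpha>"
  let ?ax = "\<lambda>i\<in>{..<?k}. axis (\<alpha> ! i) (1::real)"
  have ax: "?ax \<in> topspace (power_topology euclidean ?k)" by (auto simp: power_topology_def)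
  have hc: "continuous_on K ?h" using jet_cont[OF X_jet[OF f] k] .
  have "compact (?h ` K)" using compact_continuous_image[OF hc compact_K] .
  then obtain C where C: "finite C" "?h ` K \<subseteq> (\<Union>c\<in>C. ball c (e/3))"
    unfolding compact_eq_totally_bounded using e by (meson zero_less_divide_iff zero_less_numeral)
  define S where "S c = {x\<in>K. ?h x \<in> cball c (e/3)}" for c
  have S: "compact (S c)" for c
  proof -
    have "closedin (top_of_set K) (S c)"
      unfolding S_def using continuous_closedin_preimage[OF hc closed_cball, of c "e/3"]
      by (simp add: vimage_def Int_def)
    then show ?thesis using closedin_compact compact_K by blast
  qed
  have Sc: "compactin (deriv_dom euclidean K ?k) (S c \<times> {?ax})" for c
    unfolding deriv_dom_def compactin_Times using ax S[of c]
    by (auto simp: compactin_subtopology S_def)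
  \<comment> \<open>The radius e/2 exceeds e/3, so that \<open>f\<close> itself qualifies, and stays
    below 2e/3, so that the two distances to \<open>c\<close> add up to less than
    \<open>e\<close>.\<close>
  define O1 where "O1 c = {g \<in> X r. (\<lambda>p. deriv_ext euclidean euclidean K g ?k p) ` (S c \<times> {?ax}) \<subseteq> ball c (e/2)}" for c
  have O1: "openin (Cr_bdry_topology r K) (O1 c)" for c
  proof -
    have "openin (compact_open_topology (deriv_dom euclidean K ?k) (euclidean :: (real^'n) topology))
      {g \<in> extensional (topspace (deriv_dom euclidean K ?k)).
       continuous_map (deriv_dom euclidean K ?k) euclidean g \<and> g ` (S c \<times> {?ax}) \<subseteq> ball c (e/2)}"
      unfolding compact_open_topology_def
      by (rule topology_generated_by_Basis, rule CollectI, rule exI[of _ "S c \<times> {?ax}"],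
          rule exI[of _ "ball c (e/2)"], intro conjI refl Sc) simp
    from openin_continuous_map_preimage[OF continuous_deriv_ext[OF k] this]
    show ?thesis
    proof (rule back_subst[where P="openin (Cr_bdry_topology r K)"])
      show "{x \<in> X r. deriv_ext euclidean euclidean K x ?k
         \<in> {g \<in> extensional (topspace (deriv_dom euclidean K ?k)).
             continuous_map (deriv_dom euclidean K ?k) euclidean g \<and> g ` (S c \<times> {?ax}) \<subseteq> ball c (e/2)}} = O1 c"
        using deriv_ext_in_compact_open[OF X_Cr_on k] by (auto simp: O1_def topspace_compact_open)
    qed
  qed
  have dPD: "deriv_ext euclidean euclidean K g ?k (x, ?ax) = PD K g \<alpha> x" for g x by (simp add: PD_def)
  show ?thesis
  proof (intro exI conjI ballI)
    show "openin (Cr_bdry_topology r K) (X r \<inter> \<Inter>(O1 ` C))"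
      using C(1) O1 by (cases "C = {}") (auto intro!: openin_Int openin_Inter)
    have "f \<in> O1 c" for c
    proof -
      have "PD K f \<alpha> x \<in> ball c (e/2)" if "x \<in> S c" for x
        using that e by (auto simp: S_def)
      then show ?thesis using f unfolding O1_def by (auto simp: dPD)
    qed
    then show "f \<in> X r \<inter> \<Inter>(O1 ` C)" using f by blast
    fix g x assume g: "g \<in> X r \<inter> \<Inter>(O1 ` C)" and x: "x \<in> K"
    obtain c where c: "c \<in> C" "?h x \<in> ball c (e/3)" using C(2) x by blast
    then have xS: "x \<in> S c" using x by (simp add: S_def)
    have "deriv_ext euclidean euclidean K g ?k (x, ?ax) \<in> ball c (e/2)"
      using g c(1) xS unfolding O1_def by blast
    then have "dist c (PD K g \<alpha> x) < e/2" by (simp add: dPD)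
    moreover have "dist c (PD K f \<alpha> x) < e/3" using c by simp
    ultimately have "dist (PD K g \<alpha> x) (PD K f \<alpha> x) < e"
      using dist_triangle3[of "PD K g \<alpha> x" "PD K f \<alpha> x" c] e by simp
    then show "norm (PD K g \<alpha> x - PD K f \<alpha> x) < e" by (simp add: dist_norm)
  qed
qed

text \<open>One direction is the universal property of the initial topology. For the other, a norm
  ball contains a finite intersection of neighbourhoods from \<open>PD_close_nbhd\<close>, one for
  each word of length at most \<open>k\<close>. From here on the topology is used only through the
  norms.\<close>

lemma openin_Cr_bdry:
  "openin (Cr_bdry_topology r K) V \<longleftrightarrow> V \<subseteq> X r \<and>
     (\<forall>f\<in>V. \<exists>k e. enat k \<le> r \<and> 0 < e \<and> {g \<in> X r. snorm k (g - f) < e} \<subseteq> V)"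
  unfolding openin_seminorm_topology[symmetric]
proof
  assume V: "openin (Cr_bdry_topology r K) V"
  have "continuous_map (seminorm_topology r) (Cr_topology euclidean euclidean r K) (\<lambda>f. f)"
    unfolding Cr_topology_def
  proof (rule continuous_map_pullback')
    show "continuous_map (seminorm_topology r)
       (product_topology (\<lambda>k. compact_open_topology (deriv_dom euclidean K k) euclidean) {k. enat k \<le> r})
       ((\<lambda>f. \<lambda>k\<in>{k. enat k \<le> r}. deriv_ext euclidean euclidean K f k) \<circ> (\<lambda>f. f))"
      unfolding continuous_map_componentwise by (auto simp: continuous_deriv_ext_seminorm_topology)
    show "topspace (seminorm_topology r) \<subseteq> (\<lambda>f. f) -` Cr_space euclidean euclidean r K"
      by (auto simp: topspace_seminorm_topology X_iff Cr_space_def)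
  qed
  then have "continuous_map (seminorm_topology r) (Cr_bdry_topology r K) (\<lambda>f. f)"
    unfolding Cr_bdry_topology_def by (auto simp: continuous_map_in_subtopology topspace_seminorm_topology X_iff)
  from openin_continuous_map_preimage[OF this V]
  show "openin (seminorm_topology r) V"
    using openin_subset[OF V] by (simp add: topspace_seminorm_topology Int_absorb1 Collect_conj_eq)
next
  assume V: "openin (seminorm_topology r) V"
  show "openin (Cr_bdry_topology r K) V"
  proof (subst openin_subopen, intro ballI)
    fix f assume f: "f \<in> V"
    then obtain k e where k: "enat k \<le> r" and e: "0 < e" and sub: "{g \<in> X r. snorm k (g - f) < e} \<subseteq> V"
      using V unfolding openin_seminorm_topology by blast
    have fX: "f \<in> X r" using f V unfolding openin_seminorm_topology by blast
    have "\<forall>\<alpha>\<in>{\<alpha>. length \<alpha> \<le> k}. \<exists>W. openin (Cr_bdry_topology r K) W \<and> f \<in> W \<and>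
        (\<forall>g\<in>W. \<forall>x\<in>K. norm (PD K g \<alpha> x - PD K f \<alpha> x) < e/2)"
      by (intro ballI PD_close_nbhd[OF fX]) (use e enat_le_trans[OF _ k] in auto)
    from bchoice[OF this] obtain W where
      W: "\<And>\<alpha>. length \<alpha> \<le> k \<Longrightarrow> openin (Cr_bdry_topology r K) (W \<alpha>)" "\<And>\<alpha>. length \<alpha> \<le> k \<Longrightarrow> f \<in> W \<alpha>"
      "\<And>\<alpha> g x. length \<alpha> \<le> k \<Longrightarrow> g \<in> W \<alpha> \<Longrightarrow> x \<in> K \<Longrightarrow> norm (PD K g \<alpha> x - PD K f \<alpha> x) < e/2"
      by auto
    let ?T = "X r \<inter> \<Inter>(W ` {\<alpha>. length \<alpha> \<le> k})"
    have fin: "finite {\<alpha>::'n list. length \<alpha> \<le> k}"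
      using finite_lists_length_le[of "UNIV :: 'n set" k] by simp
    have ne: "{\<alpha>::'n list. length \<alpha> \<le> k} \<noteq> {}" by (auto intro: exI[of _ "[]"])
    have "openin (Cr_bdry_topology r K) ?T"
      using fin ne W(1) by (intro openin_Int openin_Inter) auto
    moreover have "f \<in> ?T" using fX W(2) by blast
    moreover have "?T \<subseteq> V"
    proof
      fix g assume g: "g \<in> ?T"
      then have gX: "g \<in> X r" by blast
      have "snorm k (g - f) \<le> e/2"
        unfolding snorm_le_iff[OF X_diff[OF gX fX] k]
      proof (intro allI impI)
        fix \<alpha> :: "'n list" and x assume a: "length \<alpha> \<le> k" "x \<in> K"
        show "norm (PD K (g - f) \<alpha> x) \<le> e/2"
          using W(3)[OF a(1) _ a(2), of g] g a PD_diff[OF gX fX enat_le_trans[OF a(1) k] a(2)] by auto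
      qed
      then show "g \<in> V" using sub gX e by auto
    qed
    ultimately show "\<exists>T. openin (Cr_bdry_topology r K) T \<and> f \<in> T \<and> T \<subseteq> V" by blast
  qed
qed

section \<open>Norm criteria for openness, continuity and limits\<close>

lemma openin_snorm_ball:
  assumes "f \<in> X r" "enat k \<le> r"
  shows "openin (Cr_bdry_topology r K) {g \<in> X r. snorm k (g - f) < e}"
  unfolding openin_Cr_bdry
proof (intro conjI ballI)
  fix g assume g: "g \<in> {g \<in> X r. snorm k (g - f) < e}"
  show "\<exists>k' e'. enat k' \<le> r \<and> 0 < e' \<and> {h \<in> X r. snorm k' (h - g) < e'} \<subseteq> {g \<in> X r. snorm k (g - f) < e}"
  proof (intro exI conjI)
    show "{h \<in> X r. snorm k (h - g) < e - snorm k (g - f)} \<subseteq> {g \<in> X r. snorm k (g - f) < e}"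
      using snorm_triangle_diff[OF _ _ assms(1,2), of _ g] g by force
  qed (use g assms in auto)
qed blast

lemma continuous_map_Cr_bdryI:
  assumes X: "\<And>p. p \<in> topspace P \<Longrightarrow> F p \<in> X r"
    and c: "\<And>p k e. p \<in> topspace P \<Longrightarrow> enat k \<le> r \<Longrightarrow> 0 < e \<Longrightarrow>
      \<exists>N. openin P N \<and> p \<in> N \<and> (\<forall>q\<in>N. snorm k (F q - F p) < e)"
  shows "continuous_map P (Cr_bdry_topology r K) F"
  unfolding continuous_map_def
proof (intro conjI allI impI)
  fix V assume V: "openin (Cr_bdry_topology r K) V"
  show "openin P {p \<in> topspace P. F p \<in> V}"
  proof (subst openin_subopen, intro ballI)
    fix p assume p: "p \<in> {p \<in> topspace P. F p \<in> V}"
    then obtain k e where k: "enat k \<le> r" "0 < e" "{g \<in> X r. snorm k (g - F p) < e} \<subseteq> V"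
      using V unfolding openin_Cr_bdry by blast
    from c[OF _ k(1,2), of p] p obtain N where N: "openin P N" "p \<in> N" "\<forall>q\<in>N. snorm k (F q - F p) < e" by auto
    have "N \<subseteq> {p \<in> topspace P. F p \<in> V}"
      using N k(3) X openin_subset[OF N(1)] by blast
    then show "\<exists>T. openin P T \<and> p \<in> T \<and> T \<subseteq> {p \<in> topspace P. F p \<in> V}" using N by blast
  qed
qed (use X in auto)

lemma limitin_Cr_bdryI:
  assumes l: "l \<in> X r" and X: "\<forall>\<^sub>F t in net. F t \<in> X r"
    and c: "\<And>k e. enat k \<le> r \<Longrightarrow> 0 < e \<Longrightarrow> \<forall>\<^sub>F t in net. snorm k (F t - l) < e"
  shows "limitin (Cr_bdry_topology r K) F l net"
  unfolding limitin_def
proof (intro conjI allI impI)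
  fix V assume "openin (Cr_bdry_topology r K) V \<and> l \<in> V"
  then obtain k e where k: "enat k \<le> r" "0 < e" "{g \<in> X r. snorm k (g - l) < e} \<subseteq> V"
    unfolding openin_Cr_bdry by blast
  from eventually_conj[OF X c[OF k(1,2)]] show "\<forall>\<^sub>F t in net. F t \<in> V"
    by (rule eventually_mono) (use k(3) in blast)
qed (rule l)

end

section \<open>Families of maps with mixed derivatives\<close>

lemma continuous_map_euclideanI:
  fixes f :: "'a \<Rightarrow> 'b::metric_space"
  assumes "\<And>x e. x \<in> topspace X \<Longrightarrow> 0 < e \<Longrightarrow> \<exists>U. openin X U \<and> x \<in> U \<and> (\<forall>y\<in>U. dist (f y) (f x) < e)"
  shows "continuous_map X euclidean f"
  unfolding continuous_map_euclidean_iff_tendsto tendsto_iff eventually_atin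
  using assms by (metis DiffD1)

lemma continuous_map_euclideanD:
  fixes f :: "'a \<Rightarrow> 'b::metric_space"
  assumes f: "continuous_map X euclidean f" and x: "x \<in> topspace X" and e: "0 < e"
  obtains U where "openin X U" "x \<in> U" "\<And>y. y \<in> U \<Longrightarrow> dist (f y) (f x) < e"
proof
  show "openin X {y \<in> topspace X. f y \<in> ball (f x) e}"
    by (rule openin_continuous_map_preimage[OF f]) simp
qed (use x e in \<open>auto simp: dist_commute\<close>)

lemma has_derivative_vec:
  fixes f :: "'i::finite \<Rightarrow> 'a::real_normed_vector \<Rightarrow> real"
  assumes "\<And>i. (f i has_derivative f' i) (at a)"
  shows "((\<lambda>x. \<chi> i. f i x) has_derivative (\<lambda>h. \<chi> i. f' i h)) (at a)"
  by (rule iffD2[OF has_derivative_componentwise_within])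
    (use assms in \<open>auto simp: Basis_vec_def inner_axis\<close>)

lemma matrix_inv_inverse:
  assumes "invertible A"
  shows "A ** matrix_inv A = mat 1" "matrix_inv A ** A = mat 1"
  using someI_ex[of "\<lambda>A'. A ** A' = mat 1 \<and> A' ** A = mat 1"] assms
  unfolding invertible_def matrix_inv_def by blast+

text \<open>Cramer's rule makes the solution of a linear system a rational function of its entries,
  so that it inherits differentiability from sums, products and reciprocals.\<close>

lemma matrix_inv_mult_vector_nth:
  fixes A :: "real^'n^'n"
  assumes "det A \<noteq> 0"
  shows "(matrix_inv A *v v) $ k = det (\<chi> i j. if j = k then v$i else A$i$j) / det A"
proof -
  have "A *v (matrix_inv A *v v) = v"
    using assms by (simp add: matrix_vector_mul_assoc invertible_det_nz matrix_inv_inverse)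
  then have "matrix_inv A *v v = (\<chi> k. det (\<chi> i j. if j = k then v$i else A$i$j) / det A)"
    using cramer[OF assms] by blast
  then show ?thesis by (metis (no_types, lifting) vec_lambda_beta)
qed

context convex_body begin

lemma eq_on_K:
  fixes f g :: "real^'n \<Rightarrow> real"
  assumes "continuous_on K f" "continuous_on K g" "\<And>x. x \<in> interior K \<Longrightarrow> f x = g x" "x \<in> K"
  shows "f x = g x"
proof (rule forall_in_closure_of_eq[where X="top_of_set K" and Y=euclideanreal and S="interior K"])
  show "x \<in> top_of_set K closure_of interior K"
    using assms(4) closure_interior_K interior_subset[of K]
    by (simp add: closure_of_subtopology Int_absorb1)
qed (use assms in auto)

end

text \<open>
  \<open>P\<close> is a space of parameters \<open>p = (u, y)\<close>, where \<open>y\<close> is a sequence of directions, and \<open>fl j p t\<close> moves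
  \<open>u\<close> by \<open>t\<close> times the direction \<open>y j\<close>. Carrying all directions along as parameters keeps every
  iterated derivative a function of the same type. With a constant flow on a one-point space,
  the same calculus describes single \<open>C\<^sup>r\<close>-maps.
\<close>

locale param_calculus = convex_body K for K :: "(real^'n) set" +
  fixes P :: "'p topology" and fl :: "nat \<Rightarrow> 'p \<Rightarrow> real \<Rightarrow> 'p"
  assumes fl_0: "p \<in> topspace P \<Longrightarrow> fl j p 0 = p"
    and fl_add: "p \<in> topspace P \<Longrightarrow> fl j (fl j p t) s = fl j p (t + s)"
    and fl_cont: "p \<in> topspace P \<Longrightarrow> \<exists>\<delta>>0. continuous_map (top_of_set {-\<delta><..<\<delta>}) P (fl j p)"
begin

definition jointly_cont :: "('p \<Rightarrow> real^'n \<Rightarrow> real) \<Rightarrow> bool" where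
  "jointly_cont g \<longleftrightarrow> continuous_map (prod_topology P (top_of_set K)) euclideanreal (\<lambda>q. g (fst q) (snd q))"

definition param_deriv :: "nat \<Rightarrow> ('p \<Rightarrow> real^'n \<Rightarrow> real) \<Rightarrow> ('p \<Rightarrow> real^'n \<Rightarrow> real) \<Rightarrow> bool" where
  "param_deriv j g g' \<longleftrightarrow> (\<forall>p\<in>topspace P. \<forall>x\<in>K. ((\<lambda>t. g (fl j p t) x) has_real_derivative g' p x) (at 0))"

text \<open>Unlike \<open>param_deriv\<close> this speaks of interior points only. The boundary is
  reached through the joint continuity that \<open>Csr\<close> demands of the derivatives.\<close>

definition space_deriv :: "('p \<Rightarrow> real^'n \<Rightarrow> real) \<Rightarrow> ('n \<Rightarrow> 'p \<Rightarrow> real^'n \<Rightarrow> real) \<Rightarrow> bool" where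
  "space_deriv g g' \<longleftrightarrow> (\<forall>p\<in>topspace P. \<forall>x\<in>interior K.
     (g p has_derivative (\<lambda>h. \<Sum>i\<in>UNIV. h$i * g' i p x)) (at x))"

text \<open>
  The derivatives, at most \<open>s\<close> in the parameter and \<open>r\<close> in the space variable, are required in every
  order. This makes closure under composition and inversion a plain induction on \<open>s + r\<close> and
  avoids interchanging derivatives until \<open>to_map_dir_deriv\<close>.
\<close>

inductive Csr :: "nat \<Rightarrow> nat \<Rightarrow> ('p \<Rightarrow> real^'n \<Rightarrow> real) \<Rightarrow> bool" where
  CsrI: "jointly_cont g \<Longrightarrow>
    \<forall>s'. s = Suc s' \<longrightarrow> (\<forall>j. \<exists>g'. param_deriv j g g' \<and> Csr s' r g') \<Longrightarrow>
    \<forall>r'. r = Suc r' \<longrightarrow> (\<exists>g'. space_deriv g g' \<and> (\<forall>i. Csr s r' (g' i))) \<Longrightarrow> Csr s r g"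

lemma interior_in_K: "x \<in> interior K \<Longrightarrow> x \<in> K"
  using interior_subset by blast

lemma Csr_jointly_cont: "Csr s r g \<Longrightarrow> jointly_cont g"
  by (auto elim: Csr.cases)

lemma Csr_param_deriv: "Csr (Suc s) r g \<Longrightarrow> \<exists>g'. param_deriv j g g' \<and> Csr s r g'"
  by (auto elim: Csr.cases)

lemma Csr_space_deriv: "Csr s (Suc r) g \<Longrightarrow> \<exists>g'. space_deriv g g' \<and> (\<forall>i. Csr s r (g' i))"
  by (auto elim: Csr.cases)

lemma Csr_mono: "Csr s r g \<Longrightarrow> s1 \<le> s \<Longrightarrow> r1 \<le> r \<Longrightarrow> Csr s1 r1 g"
proof (induction arbitrary: s1 r1 rule: Csr.induct)
  case (CsrI g s r)
  show ?case
  proof (rule Csr.CsrI)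
    show "jointly_cont g" by fact
    show "\<forall>s'. s1 = Suc s' \<longrightarrow> (\<forall>j. \<exists>g'. param_deriv j g g' \<and> Csr s' r1 g')"
    proof (intro allI impI)
      fix s' j assume "s1 = Suc s'"
      with CsrI.prems obtain s'' where s: "s = Suc s''" "s' \<le> s''" by (cases s) auto
      with CsrI(2) have "\<exists>g'. param_deriv j g g' \<and> (\<forall>x\<le>s''. \<forall>xa\<le>r. Csr x xa g')" by blast
      then show "\<exists>g'. param_deriv j g g' \<and> Csr s' r1 g'" using s(2) CsrI.prems by blast
    qed
    show "\<forall>r'. r1 = Suc r' \<longrightarrow> (\<exists>g'. space_deriv g g' \<and> (\<forall>i. Csr s1 r' (g' i)))"
    proof (intro allI impI)
      fix r' assume "r1 = Suc r'"
      with CsrI.prems obtain r'' where r: "r = Suc r''" "r' \<le> r''" by (cases r) auto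
      with CsrI(3) have "\<exists>g'. space_deriv g g' \<and> (\<forall>i. \<forall>x\<le>s. \<forall>xa\<le>r''. Csr x xa (g' i))" by blast
      then show "\<exists>g'. space_deriv g g' \<and> (\<forall>i. Csr s1 r' (g' i))" using r(2) CsrI.prems by blast
    qed
  qed
qed

lemma fl_in:
  assumes p: "p \<in> topspace P"
  shows "\<forall>\<^sub>F t in nhds 0. fl j p t \<in> topspace P"
proof -
  obtain \<delta> where d: "\<delta> > 0" "continuous_map (top_of_set {-\<delta><..<\<delta>}) P (fl j p)" using fl_cont[OF p] by blast
  have "\<forall>\<^sub>F t in nhds (0::real). t \<in> {-\<delta><..<\<delta>}" using d(1) by (intro eventually_nhds_in_open) auto
  then show ?thesis by (rule eventually_mono) (use d(2) in \<open>auto simp: continuous_map_def\<close>)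
qed

lemma jointly_cont_cong: "(\<And>p x. p \<in> topspace P \<Longrightarrow> x \<in> K \<Longrightarrow> g p x = h p x) \<Longrightarrow> jointly_cont g \<Longrightarrow> jointly_cont h"
  unfolding jointly_cont_def by (erule continuous_map_eq) auto

text \<open>For small times the flow stays in the parameter space (\<open>fl_in\<close>), so
  agreement there is agreement near time 0.\<close>

lemma param_deriv_cong:
  assumes eq: "\<And>p x. p \<in> topspace P \<Longrightarrow> x \<in> K \<Longrightarrow> g p x = h p x" and u: "param_deriv j g g'"
  shows "param_deriv j h g'"
  unfolding param_deriv_def
proof (intro ballI)
  fix p x assume p: "p \<in> topspace P" and x: "x \<in> K"
  have ev: "\<forall>\<^sub>F t in nhds 0. g (fl j p t) x = h (fl j p t) x"
    using fl_in[OF p] by (rule eventually_mono) (use eq x in auto)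
  have "((\<lambda>t. g (fl j p t) x) has_real_derivative g' p x) (at 0)"
    using u p x by (simp add: param_deriv_def)
  then show "((\<lambda>t. h (fl j p t) x) has_real_derivative g' p x) (at 0)"
    using DERIV_cong_ev[OF refl ev refl] by simp
qed

lemma space_deriv_cong:
  assumes eq: "\<And>p x. p \<in> topspace P \<Longrightarrow> x \<in> K \<Longrightarrow> g p x = h p x" and u: "space_deriv g g'"
  shows "space_deriv h g'"
  unfolding space_deriv_def
proof (intro ballI)
  fix p x assume p: "p \<in> topspace P" and x: "x \<in> interior K"
  have "(g p has_derivative (\<lambda>h. \<Sum>i\<in>UNIV. h$i * g' i p x)) (at x)"
    using u p x by (simp add: space_deriv_def)
  then show "(h p has_derivative (\<lambda>h. \<Sum>i\<in>UNIV. h$i * g' i p x)) (at x)"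
    by (rule has_derivative_transform_within_open[of _ _ _ _ "interior K"])
      (use p x eq interior_in_K in auto)
qed

lemma Csr_cong:
  assumes eq: "\<And>p x. p \<in> topspace P \<Longrightarrow> x \<in> K \<Longrightarrow> g p x = h p x" and g: "Csr s r g"
  shows "Csr s r h"
proof (rule CsrI)
  show "jointly_cont h" using jointly_cont_cong[of g h, OF eq Csr_jointly_cont[OF g]] by blast
  show "\<forall>s'. s = Suc s' \<longrightarrow> (\<forall>j. \<exists>g'. param_deriv j h g' \<and> Csr s' r g')"
    using Csr_param_deriv param_deriv_cong[of g h, OF eq] g by blast
  show "\<forall>r'. r = Suc r' \<longrightarrow> (\<exists>g'. space_deriv h g' \<and> (\<forall>i. Csr s r' (g' i)))"
    using Csr_space_deriv space_deriv_cong[of g h, OF eq] g by blast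
qed

lemma param_deriv_unique: "param_deriv j g a \<Longrightarrow> param_deriv j g b \<Longrightarrow> p \<in> topspace P \<Longrightarrow> x \<in> K \<Longrightarrow> a p x = b p x"
  unfolding param_deriv_def using DERIV_unique by blast

lemma jointly_cont_x: "jointly_cont g \<Longrightarrow> p \<in> topspace P \<Longrightarrow> continuous_on K (g p)"
proof -
  assume g: "jointly_cont g" and p: "p \<in> topspace P"
  have "continuous_map (top_of_set K) (prod_topology P (top_of_set K)) (\<lambda>x. (p, x))"
    using p by (intro continuous_map_pairedI) auto
  from continuous_map_compose[OF this g[unfolded jointly_cont_def]]
  show "continuous_on K (g p)" by (simp add: o_def)
qed

text \<open>Derivatives are unique at interior points; joint continuity of both candidates carries
  the equality to the boundary.\<close>

lemma space_deriv_unique: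
  assumes g: "space_deriv g a" "space_deriv g b" and c: "\<And>i. jointly_cont (a i)" "\<And>i. jointly_cont (b i)"
    and p: "p \<in> topspace P" and x: "x \<in> K"
  shows "a i p x = b i p x"
proof (rule eq_on_K[OF jointly_cont_x[OF c(1) p] jointly_cont_x[OF c(2) p] _ x])
  fix z assume z: "z \<in> interior K"
  have "(\<lambda>h. \<Sum>i\<in>UNIV. h$i * a i p z) = (\<lambda>h. \<Sum>i\<in>UNIV. h$i * b i p z)"
    using has_derivative_unique g p z unfolding space_deriv_def by blast
  from fun_cong[OF this, of "axis i 1"] show "a i p z = b i p z"
    by (simp add: axis_def if_distrib[where f="\<lambda>c. c * _"] cong: if_cong)
qed

section \<open>Closure under arithmetic, reciprocals and linear systems\<close>

lemma jointly_cont_const: "jointly_cont (\<lambda>p x. c)" by (simp add: jointly_cont_def)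

lemma Csr_const: "Csr s r (\<lambda>p x. c)"
proof (induction "s + r" arbitrary: s r c rule: less_induct)
  case less
  show ?case
  proof (rule CsrI[OF jointly_cont_const]; intro allI impI)
    fix s' j assume "s = Suc s'"
    then show "\<exists>g'. param_deriv j (\<lambda>p x. c) g' \<and> Csr s' r g'"
      by (intro exI[of _ "\<lambda>p x. 0"]) (auto simp: param_deriv_def less)
  next
    fix r' assume "r = Suc r'"
    then show "\<exists>g'. space_deriv (\<lambda>p x. c) g' \<and> (\<forall>i. Csr s r' (g' i))"
      by (intro exI[of _ "\<lambda>i p x. 0"]) (auto simp: space_deriv_def less)
  qed
qed

lemma Csr_coord: "Csr s r (\<lambda>p x. x $ k)"
proof (induction s)
  case 0
  have c: "jointly_cont (\<lambda>p x. x $ k)"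
    unfolding jointly_cont_def
    by (rule continuous_map_compose[OF continuous_map_snd, unfolded o_def]) (auto intro: continuous_intros)
  have x: "space_deriv (\<lambda>p x. x $ k) (\<lambda>i p x. if i = k then 1 else 0)"
    unfolding space_deriv_def
    by (auto simp: if_distrib[where f="\<lambda>c. _ * c"] cong: if_cong
        intro: bounded_linear_imp_has_derivative bounded_linear_vec_nth)
  show ?case
    by (rule CsrI[OF c]) (use x in \<open>auto intro!: exI[of _ "\<lambda>i p x. if i = k then 1 else 0"] Csr_const\<close>)
  have u: "param_deriv j (\<lambda>p x. x $ k) (\<lambda>p x. 0)" for j by (simp add: param_deriv_def)
  case (Suc s)
  show ?case
    by (rule CsrI[OF c]) (use x u in \<open>auto intro!: exI[of _ "\<lambda>i p x. if i = k then 1 else 0"] Csr_const\<close>)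
qed

lemma Csr_add: "Csr s r g \<Longrightarrow> Csr s r h \<Longrightarrow> Csr s r (\<lambda>p x. g p x + h p x)"
proof (induction "s + r" arbitrary: s r g h rule: less_induct)
  case less
  note g = less.prems(1) and h = less.prems(2)
  show ?case
  proof (rule CsrI; (intro allI impI)?)
    show "jointly_cont (\<lambda>p x. g p x + h p x)"
      using Csr_jointly_cont[OF g] Csr_jointly_cont[OF h] unfolding jointly_cont_def by (rule continuous_map_add)
  next
    fix s' j assume s: "s = Suc s'"
    obtain g' h' where "param_deriv j g g'" "Csr s' r g'" "param_deriv j h h'" "Csr s' r h'" using Csr_param_deriv g h s by meson
    then show "\<exists>k. param_deriv j (\<lambda>p x. g p x + h p x) k \<and> Csr s' r k"
      using less.hyps[of s' r g' h'] s
      by (intro exI[of _ "\<lambda>p x. g' p x + h' p x"]) (auto simp: param_deriv_def intro: DERIV_add)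
  next
    fix r' assume r: "r = Suc r'"
    obtain g' h' where "space_deriv g g'" "\<And>i. Csr s r' (g' i)" "space_deriv h h'" "\<And>i. Csr s r' (h' i)" using Csr_space_deriv g h r by meson
    moreover from this have "space_deriv (\<lambda>p x. g p x + h p x) (\<lambda>i p x. g' i p x + h' i p x)"
      unfolding space_deriv_def by (auto simp: distrib_left sum.distrib intro: has_derivative_add)
    ultimately show "\<exists>k. space_deriv (\<lambda>p x. g p x + h p x) k \<and> (\<forall>i. Csr s r' (k i))"
      using less.hyps[of s r'] r by (intro exI[of _ "\<lambda>i p x. g' i p x + h' i p x"]) auto
  qed
qed

lemma Csr_mult: "Csr s r g \<Longrightarrow> Csr s r h \<Longrightarrow> Csr s r (\<lambda>p x. g p x * h p x)"
proof (induction "s + r" arbitrary: s r g h rule: less_induct)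
  case less
  note g = less.prems(1) and h = less.prems(2)
  show ?case
  proof (rule CsrI; (intro allI impI)?)
    show "jointly_cont (\<lambda>p x. g p x * h p x)"
      using Csr_jointly_cont[OF g] Csr_jointly_cont[OF h] unfolding jointly_cont_def by (rule continuous_map_real_mult)
  next
    fix s' j assume s: "s = Suc s'"
    obtain g' h' where d: "param_deriv j g g'" "Csr s' r g'" "param_deriv j h h'" "Csr s' r h'" using Csr_param_deriv g h s by meson
    have "Csr s' r (\<lambda>p x. g' p x * h p x + h' p x * g p x)"
      using less.hyps[of s' r g' h] less.hyps[of s' r h' g] d s Csr_mono[OF g, of s' r] Csr_mono[OF h, of s' r]
      by (intro Csr_add) auto
    moreover have "param_deriv j (\<lambda>p x. g p x * h p x) (\<lambda>p x. g' p x * h p x + h' p x * g p x)"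
      unfolding param_deriv_def
    proof (intro ballI)
      fix p x assume p: "p \<in> topspace P" and x: "x \<in> K"
      have "((\<lambda>t. g (fl j p t) x) has_real_derivative g' p x) (at 0)"
        "((\<lambda>t. h (fl j p t) x) has_real_derivative h' p x) (at 0)"
        using d p x by (auto simp: param_deriv_def)
      from DERIV_mult[OF this] show "((\<lambda>t. g (fl j p t) x * h (fl j p t) x) has_real_derivative
          g' p x * h p x + h' p x * g p x) (at 0)" by (simp add: fl_0 p)
    qed
    ultimately show "\<exists>k. param_deriv j (\<lambda>p x. g p x * h p x) k \<and> Csr s' r k" by blast
  next
    fix r' assume r: "r = Suc r'"
    obtain g' h' where d: "space_deriv g g'" "\<And>i. Csr s r' (g' i)" "space_deriv h h'" "\<And>i. Csr s r' (h' i)" using Csr_space_deriv g h r by meson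
    have "Csr s r' (\<lambda>p x. g' i p x * h p x + h' i p x * g p x)" for i
      using less.hyps[of s r' "g' i" h] less.hyps[of s r' "h' i" g] d r Csr_mono[OF g, of s r'] Csr_mono[OF h, of s r']
      by (intro Csr_add) auto
    moreover have "space_deriv (\<lambda>p x. g p x * h p x) (\<lambda>i p x. g' i p x * h p x + h' i p x * g p x)"
      unfolding space_deriv_def
    proof (intro ballI)
      fix p x assume p: "p \<in> topspace P" and x: "x \<in> interior K"
      have "(g p has_derivative (\<lambda>v. \<Sum>i\<in>UNIV. v$i * g' i p x)) (at x)"
        "(h p has_derivative (\<lambda>v. \<Sum>i\<in>UNIV. v$i * h' i p x)) (at x)"
        using d p x by (auto simp: space_deriv_def)
      from has_derivative_mult[OF this]
      show "((\<lambda>x. g p x * h p x) has_derivative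
          (\<lambda>v. \<Sum>i\<in>UNIV. v$i * (g' i p x * h p x + h' i p x * g p x))) (at x)"
        by (rule has_derivative_eq_rhs)
          (simp add: fun_eq_iff distrib_left sum.distrib sum_distrib_left sum_distrib_right mult_ac)
    qed
    ultimately show "\<exists>k. space_deriv (\<lambda>p x. g p x * h p x) k \<and> (\<forall>i. Csr s r' (k i))"
      by (intro exI[of _ "\<lambda>i p x. g' i p x * h p x + h' i p x * g p x"]) auto
  qed
qed

lemma Csr_minus: "Csr s r g \<Longrightarrow> Csr s r (\<lambda>p x. - g p x)"
  using Csr_mult[OF Csr_const[of s r "-1"]] by simp

lemma Csr_diff: "Csr s r g \<Longrightarrow> Csr s r h \<Longrightarrow> Csr s r (\<lambda>p x. g p x - h p x)"
  using Csr_add[OF _ Csr_minus, of s r g h] by simp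

lemma Csr_sum: "(\<And>i. i \<in> I \<Longrightarrow> Csr s r (g i)) \<Longrightarrow> Csr s r (\<lambda>p x. \<Sum>i\<in>I. g i p x)"
  by (induction I rule: infinite_finite_induct) (auto intro: Csr_const Csr_add)

lemma Csr_prod: "(\<And>i. i \<in> I \<Longrightarrow> Csr s r (g i)) \<Longrightarrow> Csr s r (\<lambda>p x. \<Prod>i\<in>I. g i p x)"
  by (induction I rule: infinite_finite_induct) (auto intro: Csr_const Csr_mult)

lemma Csr_inverse:
  "Csr s r g \<Longrightarrow> (\<And>p x. p \<in> topspace P \<Longrightarrow> x \<in> K \<Longrightarrow> g p x \<noteq> 0) \<Longrightarrow> Csr s r (\<lambda>p x. inverse (g p x))"
proof (induction "s + r" arbitrary: s r rule: less_induct)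
  case less
  note g = less.prems(1) and nz = less.prems(2)
  show ?case
  proof (rule CsrI; (intro allI impI)?)
    show "jointly_cont (\<lambda>p x. inverse (g p x))"
      using Csr_jointly_cont[OF g] unfolding jointly_cont_def
      by (rule continuous_map_real_inverse) (use nz in auto)
  next
    fix s' j assume s: "s = Suc s'"
    obtain g' where d: "param_deriv j g g'" "Csr s' r g'" using Csr_param_deriv g s by meson
    have i: "Csr s' r (\<lambda>p x. inverse (g p x))"
      using less.hyps[of s' r] s Csr_mono[OF g, of s' r] nz by auto
    have "Csr s' r (\<lambda>p x. - (inverse (g p x) * g' p x * inverse (g p x)))"
      by (intro Csr_minus Csr_mult i d)
    moreover have "param_deriv j (\<lambda>p x. inverse (g p x)) (\<lambda>p x. - (inverse (g p x) * g' p x * inverse (g p x)))"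
      unfolding param_deriv_def
    proof (intro ballI)
      fix p x assume p: "p \<in> topspace P" and x: "x \<in> K"
      have "((\<lambda>t. g (fl j p t) x) has_real_derivative g' p x) (at 0)"
        using d p x by (auto simp: param_deriv_def)
      from DERIV_inverse'[OF this] show "((\<lambda>t. inverse (g (fl j p t) x)) has_real_derivative
          - (inverse (g p x) * g' p x * inverse (g p x))) (at 0)" using nz p x by (simp add: fl_0)
    qed
    ultimately show "\<exists>k. param_deriv j (\<lambda>p x. inverse (g p x)) k \<and> Csr s' r k" by blast
  next
    fix r' assume r: "r = Suc r'"
    obtain g' where d: "space_deriv g g'" "\<And>i. Csr s r' (g' i)" using Csr_space_deriv g r by meson
    have i: "Csr s r' (\<lambda>p x. inverse (g p x))"
      using less.hyps[of s r'] r Csr_mono[OF g, of s r'] nz by auto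
    have "Csr s r' (\<lambda>p x. - (inverse (g p x) * g' i p x * inverse (g p x)))" for i
      by (intro Csr_minus Csr_mult i d)
    moreover have "space_deriv (\<lambda>p x. inverse (g p x)) (\<lambda>i p x. - (inverse (g p x) * g' i p x * inverse (g p x)))"
      unfolding space_deriv_def
    proof (intro ballI)
      fix p x assume p: "p \<in> topspace P" and x: "x \<in> interior K"
      have "(g p has_derivative (\<lambda>v. \<Sum>i\<in>UNIV. v$i * g' i p x)) (at x)"
        using d p x by (auto simp: space_deriv_def)
      from Deriv.has_derivative_inverse[OF nz[OF p interior_in_K[OF x]] this]
      show "((\<lambda>x. inverse (g p x)) has_derivative
          (\<lambda>v. \<Sum>i\<in>UNIV. v$i * - (inverse (g p x) * g' i p x * inverse (g p x)))) (at x)"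
        by (rule has_derivative_eq_rhs)
          (simp add: fun_eq_iff sum_distrib_left sum_distrib_right sum_negf mult_ac)
    qed
    ultimately show "\<exists>k. space_deriv (\<lambda>p x. inverse (g p x)) k \<and> (\<forall>i. Csr s r' (k i))"
      by (intro exI[of _ "\<lambda>i p x. - (inverse (g p x) * g' i p x * inverse (g p x))"]) auto
  qed
qed

lemma Csr_det:
  assumes "\<And>i j. Csr s r (A i j)"
  shows "Csr s r (\<lambda>p x. det (\<chi> i j. A i j p x) :: real)"
  unfolding det_def by (simp, intro Csr_sum Csr_mult Csr_prod Csr_const assms)

lemma Csr_solve:
  assumes A: "\<And>i j. Csr s r (A i j)" and v: "\<And>i. Csr s r (v i)"
    and nz: "\<And>p x. p \<in> topspace P \<Longrightarrow> x \<in> K \<Longrightarrow> det (\<chi> i j. A i j p x) \<noteq> 0"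
  shows "Csr s r (\<lambda>p x. (matrix_inv (\<chi> i j. A i j p x) *v (\<chi> i. v i p x)) $ k)"
proof (rule Csr_cong)
  show "Csr s r (\<lambda>p x. det (\<chi> i j. (if j = k then v i else A i j) p x) * inverse (det (\<chi> i j. A i j p x)))"
    by (intro Csr_mult Csr_inverse Csr_det nz) (auto simp: A v)
  fix p x assume "p \<in> topspace P" "x \<in> K"
  from matrix_inv_mult_vector_nth[OF nz[OF this], of "\<chi> i. v i p x" k]
  show "det (\<chi> i j. (if j = k then v i else A i j) p x) * inverse (det (\<chi> i j. A i j p x))
     = (matrix_inv (\<chi> i j. A i j p x) *v (\<chi> i. v i p x)) $ k"
    by (simp add: divide_inverse if_distrib[where f="\<lambda>f. f p x"] cong: if_cong)
qed

section \<open>The chain rule for families of maps\<close>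

lemma jointly_cont_flow:
  assumes p: "p \<in> topspace P"
  obtains \<delta> where "\<delta> > 0" "\<And>t. t \<in> {-\<delta><..<\<delta>} \<Longrightarrow> fl j p t \<in> topspace P"
    "\<And>g. jointly_cont g \<Longrightarrow> continuous_on ({-\<delta><..<\<delta>} \<times> K) (\<lambda>q. g (fl j p (fst q)) (snd q))"
proof -
  \<comment> \<open>The interval depends on \<open>p\<close> and \<open>j\<close> alone, so the same
    one serves every jointly continuous \<open>g\<close>.\<close>
  obtain \<delta> where d: "\<delta> > 0" "continuous_map (top_of_set {-\<delta><..<\<delta>}) P (fl j p)" using fl_cont[OF p] by blast
  have "continuous_on ({-\<delta><..<\<delta>} \<times> K) (\<lambda>q. g (fl j p (fst q)) (snd q))" if "jointly_cont g" for g
  proof -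
    have "continuous_map (prod_topology (top_of_set {-\<delta><..<\<delta>}) (top_of_set K)) (prod_topology P (top_of_set K))
        (\<lambda>q. (fl j p (fst q), snd q))"
      by (intro continuous_map_pairedI continuous_map_snd
          continuous_map_compose[OF continuous_map_fst d(2), unfolded o_def])
    from continuous_map_compose[OF this that[unfolded jointly_cont_def]]
    show ?thesis by (simp add: o_def subtopology_Times[symmetric] euclidean_product_topology)
  qed
  moreover have "fl j p t \<in> topspace P" if "t \<in> {-\<delta><..<\<delta>}" for t
    using d(2) that by (auto simp: continuous_map_def)
  ultimately show ?thesis using that d(1) by blast
qed

text \<open>Total differentiability in (t, z) follows from a parameter derivative at the single
  point together with space derivatives that exist nearby and are continuous;
  \<open>has_derivative_partialsI\<close> is asymmetric in just this way.\<close>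

lemma joint_derivative:
  assumes u: "param_deriv j g a" and x: "space_deriv g b" and b: "\<And>i. jointly_cont (b i)"
    and p: "p \<in> topspace P" and z: "z \<in> interior K"
  shows "((\<lambda>(t, z). g (fl j p t) z) has_derivative
     (\<lambda>(\<tau>, h). \<tau> * a p z + (\<Sum>i\<in>UNIV. h$i * b i p z))) (at (0, z))"
proof -
  obtain \<delta> where d: "\<delta> > 0" "\<And>t. t \<in> {-\<delta><..<\<delta>} \<Longrightarrow> fl j p t \<in> topspace P"
    "\<And>g. jointly_cont g \<Longrightarrow> continuous_on ({-\<delta><..<\<delta>} \<times> K) (\<lambda>q. g (fl j p (fst q)) (snd q))"
    using jointly_cont_flow[OF p] by metis
  let ?T = "{-\<delta><..<\<delta>}"
  \<comment> \<open>Coordinate functionals as bounded linear functions: the criterion wants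
    continuity of the space derivative as an operator.\<close>
  define e :: "'n \<Rightarrow> (real^'n) \<Rightarrow>\<^sub>L real" where "e i = Blinfun (\<lambda>h. h$i)" for i
  have e: "blinfun_apply (e i) h = h$i" for i h
    unfolding e_def by (simp add: bounded_linear_Blinfun_apply bounded_linear_vec_nth)
  define fy where "fy t y = (\<Sum>i\<in>UNIV. b i (fl j p t) y *\<^sub>R e i)" for t y
  have fy: "blinfun_apply (fy t y) = (\<lambda>h. \<Sum>i\<in>UNIV. h$i * b i (fl j p t) y)" for t y
    by (simp add: fun_eq_iff fy_def blinfun.sum_left blinfun.scaleR_left e mult.commute)
  have "((\<lambda>(t, z). g (fl j p t) z) has_derivative (\<lambda>(\<tau>, h). \<tau> * a p z + blinfun_apply (fy 0 z) h))
      (at (0, z) within ?T \<times> interior K)"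
  proof (rule has_derivative_partialsI)
    show "((\<lambda>t. g (fl j p t) z) has_derivative (\<lambda>\<tau>. \<tau> * a p z)) (at 0 within ?T)"
      using u p z interior_in_K unfolding param_deriv_def has_field_derivative_def
      by (metis (no_types, lifting) has_derivative_at_withinI has_derivative_eq_rhs mult.commute ext)
    show "(g (fl j p t) has_derivative blinfun_apply (fy t y)) (at y within interior K)"
      if "t \<in> ?T" "y \<in> interior K" for t y
      unfolding fy using x d(2)[OF that(1)] that(2) by (auto simp: space_deriv_def intro: has_derivative_at_withinI)
    have "continuous_on (?T \<times> interior K) (\<lambda>q. fy (fst q) (snd q))"
      unfolding fy_def
      by (intro continuous_on_sum continuous_on_scaleR continuous_on_const
          continuous_on_subset[OF d(3)[OF b]]) (auto simp: interior_in_K)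
    then show "continuous (at (0, z) within ?T \<times> interior K) (\<lambda>(t, y). fy t y)"
      using d(1) z by (auto simp: continuous_on_eq_continuous_within case_prod_unfold)
  qed (use z convex_K in \<open>auto intro: convex_interior\<close>)
  moreover have "at (0, z) within ?T \<times> interior K = at (0, z)"
    using d(1) z by (intro at_within_open open_Times) auto
  ultimately show ?thesis using p by (simp add: fy fl_0)
qed

lemma jointly_cont_comp:
  assumes G: "jointly_cont G" and \<Phi>: "\<And>l. jointly_cont (\<Phi> l)"
    and K: "\<And>p x. p \<in> topspace P \<Longrightarrow> x \<in> K \<Longrightarrow> (\<chi> l. \<Phi> l p x) \<in> K"
  shows "jointly_cont (\<lambda>p x. G p (\<chi> l. \<Phi> l p x))"
proof -
  have "continuous_map (prod_topology P (top_of_set K)) euclidean (\<lambda>q. \<chi> l. \<Phi> l (fst q) (snd q))"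
    using \<Phi> unfolding jointly_cont_def continuous_map_euclidean_iff_tendsto by (auto intro: tendsto_vec_lambda)
  then have "continuous_map (prod_topology P (top_of_set K)) (top_of_set K) (\<lambda>q. \<chi> l. \<Phi> l (fst q) (snd q))"
    using K by (auto simp: continuous_map_in_subtopology)
  then have "continuous_map (prod_topology P (top_of_set K)) (prod_topology P (top_of_set K))
      (\<lambda>q. (fst q, \<chi> l. \<Phi> l (fst q) (snd q)))"
    by (intro continuous_map_pairedI continuous_map_fst)
  from continuous_map_compose[OF this G[unfolded jointly_cont_def]] show ?thesis
    by (simp add: jointly_cont_def o_def)
qed

text \<open>Interior points have to be sent to interior points, because differentiability of
  \<open>G p\<close> is known only there.\<close>

lemma space_deriv_comp:
  assumes G: "space_deriv G b" and \<Phi>: "\<And>l. space_deriv (\<Phi> l) (\<Phi>' l)"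
    and int: "\<And>p x. p \<in> topspace P \<Longrightarrow> x \<in> interior K \<Longrightarrow> (\<chi> l. \<Phi> l p x) \<in> interior K"
  shows "space_deriv (\<lambda>p x. G p (\<chi> l. \<Phi> l p x)) (\<lambda>i p x. \<Sum>l\<in>UNIV. b l p (\<chi> l. \<Phi> l p x) * \<Phi>' l i p x)"
  unfolding space_deriv_def
proof (intro ballI)
  fix p x assume p: "p \<in> topspace P" and x: "x \<in> interior K"
  have d\<Phi>: "((\<lambda>x. \<chi> l. \<Phi> l p x) has_derivative (\<lambda>h. \<chi> l. \<Sum>i\<in>UNIV. h$i * \<Phi>' l i p x)) (at x)"
    using \<Phi> p x by (intro has_derivative_vec) (auto simp: space_deriv_def)
  have dG: "(G p has_derivative (\<lambda>h. \<Sum>i\<in>UNIV. h$i * b i p (\<chi> l. \<Phi> l p x))) (at (\<chi> l. \<Phi> l p x))"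
    using G p int[OF p x] by (auto simp: space_deriv_def)
  have "((\<lambda>x. G p (\<chi> l. \<Phi> l p x)) has_derivative
      (\<lambda>h. \<Sum>l\<in>UNIV. (\<Sum>i\<in>UNIV. h$i * \<Phi>' l i p x) * b l p (\<chi> l. \<Phi> l p x))) (at x)"
    using has_derivative_compose[OF d\<Phi> dG] by simp
  then show "((\<lambda>x. G p (\<chi> l. \<Phi> l p x)) has_derivative
     (\<lambda>h. \<Sum>i\<in>UNIV. h $ i * (\<Sum>l\<in>UNIV. b l p (\<chi> l. \<Phi> l p x) * \<Phi>' l i p x))) (at x)"
  proof (rule has_derivative_eq_rhs, intro ext)
    fix h :: "real^'n"
    have "(\<Sum>l\<in>UNIV. (\<Sum>i\<in>UNIV. h$i * \<Phi>' l i p x) * b l p (\<chi> l. \<Phi> l p x))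
        = (\<Sum>l\<in>UNIV. \<Sum>i\<in>UNIV. h$i * (b l p (\<chi> l. \<Phi> l p x) * \<Phi>' l i p x))"
      by (simp only: sum_distrib_right) (simp add: mult_ac)
    also have "\<dots> = (\<Sum>i\<in>UNIV. \<Sum>l\<in>UNIV. h$i * (b l p (\<chi> l. \<Phi> l p x) * \<Phi>' l i p x))"
      by (rule sum.swap)
    finally show "(\<Sum>l\<in>UNIV. (\<Sum>i\<in>UNIV. h$i * \<Phi>' l i p x) * b l p (\<chi> l. \<Phi> l p x))
        = (\<Sum>i\<in>UNIV. h$i * (\<Sum>l\<in>UNIV. b l p (\<chi> l. \<Phi> l p x) * \<Phi>' l i p x))"
      by (simp add: sum_distrib_left)
  qed
qed

lemma maps_K:
  assumes int: "\<And>p x. p \<in> topspace P \<Longrightarrow> x \<in> interior K \<Longrightarrow> \<Phi> p x \<in> interior K"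
    and fr: "\<And>p x. p \<in> topspace P \<Longrightarrow> x \<in> K \<Longrightarrow> x \<notin> interior K \<Longrightarrow> \<Phi> p x = x"
    and "p \<in> topspace P" "x \<in> K"
  shows "\<Phi> p x \<in> K"
  using assms interior_in_K by (cases "x \<in> interior K") auto

text \<open>
  A parameter derivative of \<open>G \<circ> \<Phi>\<close> costs one space derivative of \<open>G\<close>, hence the order \<open>r + s\<close>. At
  boundary points \<open>\<Phi>\<close> does not move, so the chain rule is only needed in the interior.
\<close>

lemma Csr_comp:
  assumes "Csr s (r + s) G" and "\<And>l. Csr s r (\<Phi> l)"
    and int: "\<And>p x. p \<in> topspace P \<Longrightarrow> x \<in> interior K \<Longrightarrow> (\<chi> l. \<Phi> l p x) \<in> interior K"
    and fr: "\<And>p x. p \<in> topspace P \<Longrightarrow> x \<in> K \<Longrightarrow> x \<notin> interior K \<Longrightarrow> (\<chi> l. \<Phi> l p x) = x"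
  shows "Csr s r (\<lambda>p x. G p (\<chi> l. \<Phi> l p x))"
  using assms(1,2)
proof (induction "s + r" arbitrary: s r G rule: less_induct)
  case less
  note G = less.prems(1) and \<Phi> = less.prems(2)
  have inK: "(\<chi> l. \<Phi> l p x) \<in> K" if "p \<in> topspace P" "x \<in> K" for p x
    using maps_K[of "\<lambda>p x. \<chi> l. \<Phi> l p x", OF int fr] that by blast
  show ?case
  proof (rule CsrI; (intro allI impI)?)
    show "jointly_cont (\<lambda>p x. G p (\<chi> l. \<Phi> l p x))"
      by (intro jointly_cont_comp Csr_jointly_cont[OF G] Csr_jointly_cont[OF \<Phi>] inK)
  next
    fix s' j assume s: "s = Suc s'"
    obtain a where a: "param_deriv j G a" "Csr s' (r + Suc s') a" using Csr_param_deriv G s by meson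
    have "\<forall>l. \<exists>u. param_deriv j (\<Phi> l) u \<and> Csr s' r u" using Csr_param_deriv \<Phi> s by meson
    then obtain u where u: "\<And>l. param_deriv j (\<Phi> l) (u l)" "\<And>l. Csr s' r (u l)" by metis
    \<comment> \<open>One of the surplus space orders of \<open>G\<close> is spent here;
      \<open>r + s'\<close> remain, which is what the induction hypothesis for \<open>s'\<close>
      asks for.\<close>
    have "Csr s (Suc (r + s')) G" using G s by simp
    then obtain b where b: "space_deriv G b" "\<And>i. Csr s (r + s') (b i)" using Csr_space_deriv by meson
    have bC: "Csr s' r (\<lambda>p x. b i p (\<chi> l. \<Phi> l p x))" for i
      by (rule less.hyps) (use s Csr_mono[OF b(2)] Csr_mono[OF \<Phi>] in auto)
    have aC: "Csr s' r (\<lambda>p x. a p (\<chi> l. \<Phi> l p x))"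
      by (rule less.hyps) (use s Csr_mono[OF a(2)] Csr_mono[OF \<Phi>] in auto)
    have "Csr s' r (\<lambda>p x. a p (\<chi> l. \<Phi> l p x) + (\<Sum>l\<in>UNIV. u l p x * b l p (\<chi> l. \<Phi> l p x)))"
      by (intro Csr_add Csr_sum Csr_mult aC bC u)
    moreover have "param_deriv j (\<lambda>p x. G p (\<chi> l. \<Phi> l p x))
        (\<lambda>p x. a p (\<chi> l. \<Phi> l p x) + (\<Sum>l\<in>UNIV. u l p x * b l p (\<chi> l. \<Phi> l p x)))"
      unfolding param_deriv_def
    proof (intro ballI)
      fix p x assume p: "p \<in> topspace P" and x: "x \<in> K"
      have ul: "((\<lambda>t. \<Phi> l (fl j p t) x) has_real_derivative u l p x) (at 0)" for l
        using u(1)[of l] p x by (auto simp: param_deriv_def)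
      show "((\<lambda>t. G (fl j p t) (\<chi> l. \<Phi> l (fl j p t) x)) has_real_derivative
        a p (\<chi> l. \<Phi> l p x) + (\<Sum>l\<in>UNIV. u l p x * b l p (\<chi> l. \<Phi> l p x))) (at 0)"
      proof (cases "x \<in> interior K")
        case True
        have d\<Phi>: "((\<lambda>t. (t, \<chi> l. \<Phi> l (fl j p t) x)) has_derivative (\<lambda>\<tau>. (\<tau>, \<chi> l. u l p x * \<tau>))) (at 0)"
          by (intro has_derivative_Pair has_derivative_ident has_derivative_vec)
            (use ul in \<open>simp add: has_field_derivative_def\<close>)
        have dG: "((\<lambda>(t, z). G (fl j p t) z) has_derivative
            (\<lambda>(\<tau>, h). \<tau> * a p (\<chi> l. \<Phi> l p x) + (\<Sum>i\<in>UNIV. h$i * b i p (\<chi> l. \<Phi> l p x))))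
            (at (0, \<chi> l. \<Phi> l (fl j p 0) x))"
          using joint_derivative[OF a(1) b(1) Csr_jointly_cont[OF b(2)] p int[OF p True]] p by (simp add: fl_0)
        have "((\<lambda>t. G (fl j p t) (\<chi> l. \<Phi> l (fl j p t) x)) has_derivative
            (\<lambda>\<tau>. \<tau> * a p (\<chi> l. \<Phi> l p x) + (\<Sum>l\<in>UNIV. u l p x * \<tau> * b l p (\<chi> l. \<Phi> l p x)))) (at 0)"
          using has_derivative_compose[OF d\<Phi> dG] by (simp add: case_prod_unfold)
        then show ?thesis
          unfolding has_field_derivative_def
          by (rule has_derivative_eq_rhs) (simp add: fun_eq_iff algebra_simps sum_distrib_left)
      next
        case False
        have ev: "\<forall>\<^sub>F t in nhds 0. (\<chi> l. \<Phi> l (fl j p t) x) = x"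
          using fl_in[OF p] by (rule eventually_mono) (use fr x False in auto)
        have "u l p x = 0" for l
        proof -
          have "((\<lambda>t. x $ l) has_real_derivative u l p x) (at 0)"
          proof (rule iffD1[OF DERIV_cong_ev[OF refl _ refl] ul])
            show "\<forall>\<^sub>F t in nhds 0. \<Phi> l (fl j p t) x = x $ l"
              using ev by (rule eventually_mono) (metis vec_lambda_beta)
          qed
          then show ?thesis using DERIV_unique DERIV_const by blast
        qed
        moreover have "((\<lambda>t. G (fl j p t) x) has_real_derivative a p x) (at 0)"
          using a(1) p x by (simp add: param_deriv_def)
        moreover have "\<forall>\<^sub>F t in nhds 0. G (fl j p t) x = G (fl j p t) (\<chi> l. \<Phi> l (fl j p t) x)"
          using ev by (rule eventually_mono) simp
        ultimately show ?thesis
          using DERIV_cong_ev[OF refl _ refl] fr[OF p x False] by fastforce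
      qed
    qed
    ultimately show "\<exists>k. param_deriv j (\<lambda>p x. G p (\<chi> l. \<Phi> l p x)) k \<and> Csr s' r k" by blast
  next
    fix r' assume r: "r = Suc r'"
    have "Csr s (Suc (r' + s)) G" using G r by simp
    then obtain b where b: "space_deriv G b" "\<And>i. Csr s (r' + s) (b i)" using Csr_space_deriv by meson
    have "\<forall>l. \<exists>u. space_deriv (\<Phi> l) u \<and> (\<forall>i. Csr s r' (u i))" using Csr_space_deriv \<Phi> r by meson
    then obtain u where u: "\<And>l. space_deriv (\<Phi> l) (u l)" "\<And>l i. Csr s r' (u l i)" by metis
    have bC: "Csr s r' (\<lambda>p x. b i p (\<chi> l. \<Phi> l p x))" for i
      by (rule less.hyps) (use r b(2) Csr_mono[OF \<Phi>] in auto)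
    show "\<exists>k. space_deriv (\<lambda>p x. G p (\<chi> l. \<Phi> l p x)) k \<and> (\<forall>i. Csr s r' (k i))"
      by (rule exI, rule conjI[OF space_deriv_comp[OF b(1) u(1) int]], assumption, assumption)
        (intro allI Csr_sum Csr_mult bC u)
  qed
qed

text \<open>The inner map does not move with the parameter, so a parameter derivative never touches
  the space variable of \<open>G\<close> and no order is lost. This is the reason why right
  translations are smooth.\<close>

lemma Csr_comp_constant:
  assumes "Csr s r G" and "\<And>l. Csr s r (\<Phi> l)"
    and inv: "\<And>l j p t x. \<Phi> l (fl j p t) x = \<Phi> l p x"
    and int: "\<And>p x. p \<in> topspace P \<Longrightarrow> x \<in> interior K \<Longrightarrow> (\<chi> l. \<Phi> l p x) \<in> interior K"
    and fr: "\<And>p x. p \<in> topspace P \<Longrightarrow> x \<in> K \<Longrightarrow> x \<notin> interior K \<Longrightarrow> (\<chi> l. \<Phi> l p x) = x"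
  shows "Csr s r (\<lambda>p x. G p (\<chi> l. \<Phi> l p x))"
  using assms(1,2)
proof (induction "s + r" arbitrary: s r G rule: less_induct)
  case less
  note G = less.prems(1) and \<Phi> = less.prems(2)
  have inK: "(\<chi> l. \<Phi> l p x) \<in> K" if "p \<in> topspace P" "x \<in> K" for p x
    using maps_K[of "\<lambda>p x. \<chi> l. \<Phi> l p x", OF int fr] that by blast
  show ?case
  proof (rule CsrI; (intro allI impI)?)
    show "jointly_cont (\<lambda>p x. G p (\<chi> l. \<Phi> l p x))"
      by (intro jointly_cont_comp Csr_jointly_cont[OF G] Csr_jointly_cont[OF \<Phi>] inK)
  next
    fix s' j assume s: "s = Suc s'"
    obtain a where a: "param_deriv j G a" "Csr s' r a" using Csr_param_deriv G s by meson
    have "Csr s' r (\<lambda>p x. a p (\<chi> l. \<Phi> l p x))"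
      by (rule less.hyps) (use s Csr_mono[OF a(2)] Csr_mono[OF \<Phi>] in auto)
    moreover have "param_deriv j (\<lambda>p x. G p (\<chi> l. \<Phi> l p x)) (\<lambda>p x. a p (\<chi> l. \<Phi> l p x))"
      using a(1) inK unfolding param_deriv_def inv by simp
    ultimately show "\<exists>k. param_deriv j (\<lambda>p x. G p (\<chi> l. \<Phi> l p x)) k \<and> Csr s' r k" by blast
  next
    fix r' assume r: "r = Suc r'"
    obtain b where b: "space_deriv G b" "\<And>i. Csr s r' (b i)" using Csr_space_deriv G r by meson
    have "\<forall>l. \<exists>u. space_deriv (\<Phi> l) u \<and> (\<forall>i. Csr s r' (u i))" using Csr_space_deriv \<Phi> r by meson
    then obtain u where u: "\<And>l. space_deriv (\<Phi> l) (u l)" "\<And>l i. Csr s r' (u l i)" by metis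
    have bC: "Csr s r' (\<lambda>p x. b i p (\<chi> l. \<Phi> l p x))" for i
      by (rule less.hyps) (use r b(2) Csr_mono[OF \<Phi>] in auto)
    show "\<exists>k. space_deriv (\<lambda>p x. G p (\<chi> l. \<Phi> l p x)) k \<and> (\<forall>i. Csr s r' (k i))"
      by (rule exI, rule conjI[OF space_deriv_comp[OF b(1) u(1) int]], assumption, assumption)
        (intro allI Csr_sum Csr_mult bC u)
  qed
qed

text \<open>Compactness gives continuity of the given inverse, and invertibility of the Jacobian its
  differentiability. The derivatives of \<open>\<psi>\<close> solve a linear system evaluated at
  \<open>\<psi>\<close>, so \<open>Csr_comp\<close> with \<open>\<psi>\<close> of lower order closes
  the induction. The surplus space orders that \<open>Csr_comp\<close> asks of that system account
  for \<open>r + s\<close>.\<close>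

lemma Csr_inverse_map:
  fixes \<phi> :: "'n \<Rightarrow> 'p \<Rightarrow> real^'n \<Rightarrow> real" and \<psi> :: "'p \<Rightarrow> real^'n \<Rightarrow> real^'n"
  assumes "\<And>l. Csr s (r + s) (\<phi> l)"
    and J: "\<And>l. space_deriv (\<phi> l) (J l)" and Jc: "\<And>l i. jointly_cont (J l i)"
    and nz: "\<And>p x. p \<in> topspace P \<Longrightarrow> x \<in> K \<Longrightarrow> det (\<chi> l i. J l i p x) \<noteq> 0"
    and \<phi>\<psi>: "\<And>p x. p \<in> topspace P \<Longrightarrow> x \<in> K \<Longrightarrow> (\<chi> l. \<phi> l p (\<psi> p x)) = x"
    and \<psi>\<phi>: "\<And>p x. p \<in> topspace P \<Longrightarrow> x \<in> K \<Longrightarrow> \<psi> p (\<chi> l. \<phi> l p x) = x"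
    and int: "\<And>p x. p \<in> topspace P \<Longrightarrow> x \<in> interior K \<Longrightarrow> \<psi> p x \<in> interior K"
    and fr: "\<And>p x. p \<in> topspace P \<Longrightarrow> x \<in> K \<Longrightarrow> x \<notin> interior K \<Longrightarrow> \<psi> p x = x"
  shows "Csr s r (\<lambda>p x. \<psi> p x $ l)"
proof -
  have inK: "\<psi> p x \<in> K" if "p \<in> topspace P" "x \<in> K" for p x
    using maps_K[of \<psi>, OF int fr] that by blast
  define \<Phi> where "\<Phi> p x = (\<chi> l. \<phi> l p x)" for p x
  define M where "M p x = (\<chi> l i. J l i p x)" for p x
  note \<phi>\<psi> = \<phi>\<psi>[folded \<Phi>_def] and \<psi>\<phi> = \<psi>\<phi>[folded \<Phi>_def] and nz = nz[folded M_def]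
  have Mi: "M p x ** matrix_inv (M p x) = mat 1" "matrix_inv (M p x) ** M p x = mat 1"
    if "p \<in> topspace P" "x \<in> K" for p x
    using nz[OF that] by (auto intro!: matrix_inv_inverse simp: invertible_det_nz)
  have Mv: "(M p x *v h) $ l = (\<Sum>i\<in>UNIV. h$i * J l i p x)" for p x h l
    by (simp add: M_def matrix_vector_mult_def mult.commute)
  have c\<phi>: "jointly_cont (\<phi> l)" for l using assms(1) Csr_jointly_cont by blast
  have c\<Phi>: "continuous_map (prod_topology P (top_of_set K)) euclidean (\<lambda>q. \<Phi> (fst q) (snd q))"
    using c\<phi> unfolding jointly_cont_def continuous_map_euclidean_iff_tendsto \<Phi>_def by (auto intro: tendsto_vec_lambda)
  have c\<psi>v: "continuous_map (prod_topology P (top_of_set K)) euclidean (\<lambda>q. \<psi> (fst q) (snd q))"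
  proof (rule continuous_map_euclideanI)
    fix q and e :: real assume q: "q \<in> topspace (prod_topology P (top_of_set K))" and e: "0 < e"
    obtain p x where [simp]: "q = (p, x)" and p: "p \<in> topspace P" and x: "x \<in> K" using q by auto
    \<comment> \<open>The points of \<open>K\<close> that the values of \<open>\<psi>\<close> have
      to avoid near \<open>q\<close> in order to stay within \<open>e\<close>.\<close>
    define C where "C = {z\<in>K. e \<le> dist z (\<psi> p x)}"
    have C: "compact C" "C \<subseteq> K"
    proof -
      have "C = K \<inter> (- ball (\<psi> p x) e)" by (auto simp: C_def dist_commute)
      then show "compact C" using compact_Int_closed[OF compact_K, of "- ball (\<psi> p x) e"] by (simp add: closed_Compl)
    qed (auto simp: C_def)
    have ne: "\<Phi> p z \<noteq> x" if "z \<in> C" for z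
      using \<psi>\<phi>[OF p, of z] that e by (auto simp: C_def)
    define W where "W = {w \<in> topspace (prod_topology (prod_topology P (top_of_set K)) (top_of_set K)).
       \<Phi> (fst (fst w)) (snd w) - snd (fst w) \<in> - {0}}"
    \<comment> \<open>\<open>\<psi>\<close> has a closed graph in a compact space: near \<open>q\<close> no solution of \<open>\<Phi> = x\<close> lies in \<open>C\<close>.\<close>
    have W1: "openin (prod_topology (prod_topology P (top_of_set K)) (top_of_set K)) W"
      unfolding W_def
    proof (rule openin_continuous_map_preimage[where Y=euclidean])
      have "continuous_map (prod_topology (prod_topology P (top_of_set K)) (top_of_set K))
         (prod_topology P (top_of_set K)) (\<lambda>w. (fst (fst w), snd w))"
        by (intro continuous_map_pairedI continuous_map_snd
            continuous_map_compose[OF continuous_map_fst continuous_map_fst, unfolded o_def])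
      from continuous_map_compose[OF this c\<Phi>]
      have 1: "continuous_map (prod_topology (prod_topology P (top_of_set K)) (top_of_set K)) euclidean
         (\<lambda>w. \<Phi> (fst (fst w)) (snd w))" by (simp add: o_def)
      have 2: "continuous_map (prod_topology (prod_topology P (top_of_set K)) (top_of_set K)) euclidean
         (\<lambda>w. snd (fst w))"
        using continuous_map_compose[OF continuous_map_fst continuous_map_snd, of P "top_of_set K" "top_of_set K"]
        by (auto simp: o_def continuous_map_in_subtopology)
      show "continuous_map (prod_topology (prod_topology P (top_of_set K)) (top_of_set K)) euclidean
         (\<lambda>w. \<Phi> (fst (fst w)) (snd w) - snd (fst w))"
        using 1 2 unfolding continuous_map_euclidean_iff_tendsto by (auto intro: tendsto_diff)
    qed (simp add: open_Compl)
    have W2: "{q} \<times> C \<subseteq> W" using p x C(2) ne by (auto simp: W_def)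
    have W3: "compactin (top_of_set K) C" using C by (simp add: compactin_subtopology)
    obtain U V where U: "openin (prod_topology P (top_of_set K)) U" "q \<in> U" "C \<subseteq> V" "U \<times> V \<subseteq> W"
      using tube_lemma_right[OF W1 W3 q W2] by blast
    have "dist (\<psi> (fst w) (snd w)) (\<psi> (fst q) (snd q)) < e" if w: "w \<in> U" for w
    proof (rule ccontr)
      have monomial: "fst w \<in> topspace P" "snd w \<in> K" using openin_subset[OF U(1)] w by auto
      assume "\<not> ?thesis"
      then have "\<psi> (fst w) (snd w) \<in> C" using inK[OF monomial] by (auto simp: C_def)
      then have "(w, \<psi> (fst w) (snd w)) \<in> W" using U w by blast
      then show False using \<phi>\<psi>[OF monomial] by (simp add: W_def)
    qed
    then show "\<exists>U. openin (prod_topology P (top_of_set K)) U \<and> q \<in> U \<and>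
       (\<forall>w\<in>U. dist (\<psi> (fst w) (snd w)) (\<psi> (fst q) (snd q)) < e)" using U by blast
  qed
  have c\<psi>: "jointly_cont (\<lambda>p x. \<psi> p x $ l)" for l
    using c\<psi>v unfolding jointly_cont_def continuous_map_euclidean_iff_tendsto by (auto intro: tendsto_vec_nth)
  have x\<psi>: "space_deriv (\<lambda>p x. \<psi> p x $ l) (\<lambda>i p x. (matrix_inv (M p (\<psi> p x)) *v axis i 1) $ l)" for l
    unfolding space_deriv_def
  proof (intro ballI)
    fix p x assume p: "p \<in> topspace P" and x: "x \<in> interior K"
    have "(\<psi> p has_derivative (\<lambda>h. matrix_inv (M p (\<psi> p x)) *v h)) (at x)"
    proof (rule has_derivative_inverse_basic[where T="interior K" and f="\<Phi> p" and f'="\<lambda>h. M p (\<psi> p x) *v h"])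
      have "(\<Phi> p has_derivative (\<lambda>h. \<chi> l. \<Sum>i\<in>UNIV. h$i * J l i p (\<psi> p x))) (at (\<psi> p x))"
        unfolding \<Phi>_def using J p int[OF p x] by (intro has_derivative_vec) (auto simp: space_deriv_def)
      moreover have "(\<chi> l. \<Sum>i\<in>UNIV. h$i * J l i p (\<psi> p x)) = M p (\<psi> p x) *v h" for h
        by (simp add: vec_eq_iff Mv)
      ultimately show "(\<Phi> p has_derivative (\<lambda>h. M p (\<psi> p x) *v h)) (at (\<psi> p x))" by simp
      show "(*v) (matrix_inv (M p (\<psi> p x))) \<circ> (*v) (M p (\<psi> p x)) = id"
        using Mi[OF p inK[OF p interior_in_K[OF x]]] by (auto simp: fun_eq_iff matrix_vector_mul_assoc)
      have "continuous_on K (\<psi> p)"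
        using continuous_map_compose[OF _ c\<psi>v, of "top_of_set K" "\<lambda>x. (p, x)"] p
        by (simp add: o_def continuous_map_paired)
      then show "continuous (at x) (\<psi> p)" using x continuous_on_interior by blast
    qed (use x \<phi>\<psi> p interior_in_K in auto)
    then have "((\<lambda>x. \<psi> p x $ l) has_derivative (\<lambda>h. (matrix_inv (M p (\<psi> p x)) *v h) $ l)) (at x)"
      by (rule bounded_linear.has_derivative[OF bounded_linear_vec_nth])
    then show "((\<lambda>x. \<psi> p x $ l) has_derivative
       (\<lambda>h. \<Sum>i\<in>UNIV. h$i * (matrix_inv (M p (\<psi> p x)) *v axis i 1) $ l)) (at x)"
      by (rule has_derivative_eq_rhs)
        (simp add: fun_eq_iff matrix_vector_mult_def axis_def if_distrib mult.commute cong: if_cong)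
  qed
  show ?thesis
    using assms(1)
  proof (induction "s + r" arbitrary: s r l rule: less_induct)
    case less
    note \<phi> = less.prems
    \<comment> \<open>\<open>J\<close> is only assumed to be a jointly continuous derivative;
      uniqueness identifies it on \<open>K\<close> with the derivative that \<open>Csr\<close>
      provides, and so with its orders.\<close>
    have JS: "Csr s n (J l i)" if n: "r + s = Suc n" for l i n
    proof -
      obtain b where b: "space_deriv (\<phi> l) b" "\<And>i. Csr s n (b i)" using Csr_space_deriv \<phi>[of l] n by metis
      show ?thesis
        by (rule Csr_cong[OF _ b(2)]) (use space_deriv_unique[OF b(1) J Csr_jointly_cont[OF b(2)] Jc] in auto)
    qed
    show ?case
    proof (rule CsrI; (intro allI impI)?)
      show "jointly_cont (\<lambda>p x. \<psi> p x $ l)" by (rule c\<psi>)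
    next
      fix s' j assume s: "s = Suc s'"
      have "\<forall>l. \<exists>u. param_deriv j (\<phi> l) u \<and> Csr s' (r + s') u"
        using Csr_param_deriv[of s' "r + s"] \<phi> s Csr_mono[of s' "r + s" _ s' "r + s'"] by (meson add_left_mono le_SucI order_refl)
      then obtain u where u: "\<And>l. param_deriv j (\<phi> l) (u l)" "\<And>l. Csr s' (r + s') (u l)" by metis
      have IH: "Csr s' r (\<lambda>p x. \<psi> p x $ l)" for l
        by (rule less.hyps) (use s Csr_mono[OF \<phi>] in auto)
      \<comment> \<open>The point \<open>\<psi> p x\<close> is spelled out as the vector of its
        coordinates to match the shape of \<open>Csr_comp\<close>.\<close>
      have "Csr s' r (\<lambda>p x. - (matrix_inv (\<chi> l i. J l i p (\<chi> l. \<psi> p x $ l)) *v (\<chi> i. u i p (\<chi> l. \<psi> p x $ l))) $ k)" for k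
      proof (rule Csr_minus, rule Csr_comp[where G="\<lambda>p x. (matrix_inv (\<chi> l i. J l i p x) *v (\<chi> i. u i p x)) $ k"])
        show "Csr s' (r + s') (\<lambda>p x. (matrix_inv (\<chi> l i. J l i p x) *v (\<chi> i. u i p x)) $ k)"
          by (rule Csr_solve) (use Csr_mono[OF JS[of "r + s'"], of s' "r + s'"] s u(2) nz[unfolded M_def] in auto)
      qed (use IH int fr in auto)
      then have kC: "Csr s' r (\<lambda>p x. - (matrix_inv (M p (\<psi> p x)) *v (\<chi> i. u i p (\<psi> p x))) $ k)" for k
        by (simp add: M_def)
      have "param_deriv j (\<lambda>p x. \<psi> p x $ l) (\<lambda>p x. - (matrix_inv (M p (\<psi> p x)) *v (\<chi> i. u i p (\<psi> p x))) $ l)"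
        unfolding param_deriv_def
      proof (intro ballI)
        fix p x assume p: "p \<in> topspace P" and x: "x \<in> K"
        let ?z = "\<psi> p x" let ?u = "\<chi> i. u i p ?z"
        show "((\<lambda>t. \<psi> (fl j p t) x $ l) has_real_derivative - (matrix_inv (M p ?z) *v ?u) $ l) (at 0)"
        proof (cases "x \<in> interior K")
          case True
          obtain \<delta> where d: "\<delta> > 0" "\<And>t. t \<in> {-\<delta><..<\<delta>} \<Longrightarrow> fl j p t \<in> topspace P"
            "\<And>g. jointly_cont g \<Longrightarrow> continuous_on ({-\<delta><..<\<delta>} \<times> K) (\<lambda>q. g (fl j p (fst q)) (snd q))"
            using jointly_cont_flow[OF p] by metis
          \<comment> \<open>Carrying t along turns the family into one map (t, z) -> (t, \<Phi> z),
            where \<Phi> is taken at time t, with an inverse of the same kind. The derivative is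
            block triangular, with inverse (\<tau>, h) -> (\<tau>, M^-1 (h - \<tau> u)). Restriction
            to fixed \<open>x\<close> leaves the velocity - M^-1 u.\<close>
          have "((\<lambda>q. (fst q, \<psi> (fl j p (fst q)) (snd q))) has_derivative
             (\<lambda>q. (fst q, matrix_inv (M p ?z) *v (snd q - fst q *\<^sub>R ?u)))) (at (0, x))"
          proof (rule has_derivative_inverse_basic[where T="{-\<delta><..<\<delta>} \<times> interior K"
                and f="\<lambda>q. (fst q, \<Phi> (fl j p (fst q)) (snd q))"
                and f'="\<lambda>q. (fst q, M p ?z *v snd q + fst q *\<^sub>R ?u)"])
            have "((\<lambda>q. \<phi> l (fl j p (fst q)) (snd q)) has_derivative
               (\<lambda>q. fst q * u l p ?z + (\<Sum>i\<in>UNIV. snd q $ i * J l i p ?z))) (at (0, ?z))" for l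
              using joint_derivative[OF u(1) J Jc p int[OF p True]] by (simp add: case_prod_unfold)
            then have "((\<lambda>q. \<Phi> (fl j p (fst q)) (snd q)) has_derivative
               (\<lambda>q. \<chi> l. fst q * u l p ?z + (\<Sum>i\<in>UNIV. snd q $ i * J l i p ?z))) (at (0, ?z))"
              unfolding \<Phi>_def by (rule has_derivative_vec)
            moreover have "(\<chi> l. fst q * u l p ?z + (\<Sum>i\<in>UNIV. snd q $ i * J l i p ?z))
                = M p ?z *v snd q + fst q *\<^sub>R ?u" for q
              by (simp add: vec_eq_iff Mv)
            ultimately have "((\<lambda>q. \<Phi> (fl j p (fst q)) (snd q)) has_derivative
               (\<lambda>q. M p ?z *v snd q + fst q *\<^sub>R ?u)) (at (0, ?z))" by simp
            then show "((\<lambda>q. (fst q, \<Phi> (fl j p (fst q)) (snd q))) has_derivative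
               (\<lambda>q. (fst q, M p ?z *v snd q + fst q *\<^sub>R ?u)))
               (at (fst (0, x), \<psi> (fl j p (fst (0, x))) (snd (0, x))))"
              using p by (simp add: fl_0 has_derivative_Pair has_derivative_fst has_derivative_ident)
            show "bounded_linear (\<lambda>q. (fst q, matrix_inv (M p ?z) *v (snd q - fst q *\<^sub>R ?u)))"
              by (intro bounded_linear_Pair bounded_linear_fst
                  bounded_linear_compose[OF matrix_vector_mul_bounded_linear] bounded_linear_sub bounded_linear_snd
                  bounded_linear_compose[OF bounded_linear_scaleR_left bounded_linear_fst])
            show "(\<lambda>q. (fst q, matrix_inv (M p ?z) *v (snd q - fst q *\<^sub>R ?u))) \<circ>
               (\<lambda>q. (fst q, M p ?z *v snd q + fst q *\<^sub>R ?u)) = id"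
              using Mi[OF p inK[OF p x]] by (auto simp: fun_eq_iff matrix_vector_mul_assoc)
            have "continuous_on ({-\<delta><..<\<delta>} \<times> K) (\<lambda>q. \<chi> l. \<psi> (fl j p (fst q)) (snd q) $ l)"
              using d(3)[OF c\<psi>] by (rule continuous_on_vec_lambda)
            then have "continuous_on ({-\<delta><..<\<delta>} \<times> interior K) (\<lambda>q. (fst q, \<psi> (fl j p (fst q)) (snd q)))"
              by (intro continuous_on_Pair continuous_on_fst continuous_on_id)
                (auto intro: continuous_on_subset simp: interior_in_K)
            then show "continuous (at (0, x)) (\<lambda>q. (fst q, \<psi> (fl j p (fst q)) (snd q)))"
              using d(1) True by (subst (asm) continuous_on_eq_continuous_at) (auto intro: open_Times)
          qed (use d True \<phi>\<psi> interior_in_K in \<open>auto intro: open_Times\<close>)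
          moreover have "((\<lambda>t. (t, x)) has_derivative (\<lambda>t. (t, 0))) (at (0::real))"
            by (intro has_derivative_Pair has_derivative_ident has_derivative_const)
          ultimately have "((\<lambda>t. (t, \<psi> (fl j p t) x)) has_derivative
              (\<lambda>t. (t, matrix_inv (M p ?z) *v (0 - t *\<^sub>R ?u)))) (at 0)"
            using has_derivative_compose[of "\<lambda>t. (t, x)" "\<lambda>t. (t, 0)" 0 UNIV] by force
          from bounded_linear.has_derivative[OF bounded_linear_compose[OF bounded_linear_vec_nth bounded_linear_snd] this]
          have "((\<lambda>t. \<psi> (fl j p t) x $ l) has_derivative
              (\<lambda>t. (matrix_inv (M p ?z) *v (0 - t *\<^sub>R ?u)) $ l)) (at 0)" by simp
          then show ?thesis
            unfolding has_field_derivative_def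
          proof (rule has_derivative_eq_rhs, intro ext)
            fix t
            have "0 - t *\<^sub>R ?u = (- t) *\<^sub>R ?u" by simp
            then show "(matrix_inv (M p ?z) *v (0 - t *\<^sub>R ?u)) $ l = - (matrix_inv (M p ?z) *v ?u) $ l * t"
              by (simp only: matrix_vector_mult_scaleR vector_scaleR_component) simp
          qed
        next
          case False
          have ev: "\<forall>\<^sub>F t in nhds 0. \<psi> (fl j p t) x = x"
            using fl_in[OF p] by (rule eventually_mono) (use fr x False in auto)
          \<comment> \<open>At a boundary point both \<open>\<phi>\<close> and \<open>\<psi>\<close>
            stay put for small times, so both sides of the claimed formula vanish.\<close>
          have "u i p x = 0" for i
          proof -
            have d1: "((\<lambda>t. \<phi> i (fl j p t) x) has_real_derivative u i p x) (at 0)"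
              using u(1)[of i] p x by (simp add: param_deriv_def)
            have ev1: "\<forall>\<^sub>F t in nhds 0. \<phi> i (fl j p t) x = x $ i"
              using fl_in[OF p]
            proof (rule eventually_mono)
              fix t assume t: "fl j p t \<in> topspace P"
              then have "\<Phi> (fl j p t) x = x" using \<phi>\<psi>[OF t x] fr[OF t x False] by simp
              then show "\<phi> i (fl j p t) x = x $ i" by (metis \<Phi>_def vec_lambda_beta)
            qed
            have "((\<lambda>t. x $ i) has_real_derivative u i p x) (at 0)"
              by (rule iffD1[OF DERIV_cong_ev[OF refl ev1 refl] d1])
            then show ?thesis using DERIV_unique DERIV_const by blast
          qed
          then have "?u = 0" unfolding fr[OF p x False] by (simp add: vec_eq_iff)
          moreover have "((\<lambda>t. \<psi> (fl j p t) x $ l) has_real_derivative 0) (at 0)"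
          proof (rule iffD1[OF DERIV_cong_ev[OF refl _ refl]])
            show "\<forall>\<^sub>F t in nhds 0. x $ l = \<psi> (fl j p t) x $ l" using ev by (rule eventually_mono) simp
          qed simp
          ultimately show ?thesis by simp
        qed
      qed
      then show "\<exists>k. param_deriv j (\<lambda>p x. \<psi> p x $ l) k \<and> Csr s' r k" using kC by blast
    next
      fix r' assume r: "r = Suc r'"
      have IH: "Csr s r' (\<lambda>p x. \<psi> p x $ l)" for l
        by (rule less.hyps) (use r Csr_mono[OF \<phi>] in auto)
      have "Csr s r' (\<lambda>p x. (matrix_inv (\<chi> l i. J l i p (\<chi> l. \<psi> p x $ l)) *v (\<chi> m. axis i 1 $ m)) $ k)" for i k
      proof (rule Csr_comp[where G="\<lambda>p x. (matrix_inv (\<chi> l i. J l i p x) *v (\<chi> m. axis i 1 $ m)) $ k"])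
        show "Csr s (r' + s) (\<lambda>p x. (matrix_inv (\<chi> l i. J l i p x) *v (\<chi> m. axis i 1 $ m)) $ k)"
          by (rule Csr_solve) (use JS[of "r' + s"] r Csr_const nz[unfolded M_def] in auto)
      qed (use IH int fr in auto)
      then have "Csr s r' (\<lambda>p x. (matrix_inv (M p (\<psi> p x)) *v axis i 1) $ l)" for i
        by (simp add: M_def)
      then show "\<exists>k. space_deriv (\<lambda>p x. \<psi> p x $ l) k \<and> (\<forall>i. Csr s r' (k i))" using x\<psi> by blast
    qed
  qed
qed

text \<open>Evaluation is jointly continuous because the norm bounds derivatives uniformly on
  \<open>K\<close>: one half of \<open>e\<close> goes into changing the map, the other into moving
  the point for the fixed map.\<close>

lemma jointly_cont_atom:
  assumes \<pi>: "continuous_map P (Cr_bdry_topology m K) \<pi>" and a: "enat (length \<alpha>) \<le> m"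
  shows "jointly_cont (\<lambda>p x. PD K (\<pi> p) \<alpha> x $ c)"
  unfolding jointly_cont_def
proof (rule continuous_map_euclideanI)
  fix q and e :: real assume q: "q \<in> topspace (prod_topology P (top_of_set K))" and e: "0 < e"
  obtain p x where [simp]: "q = (p, x)" and p: "p \<in> topspace P" and x: "x \<in> K" using q by auto
  have X: "\<pi> p' \<in> X m" if "p' \<in> topspace P" for p' using \<pi> that by (auto simp: continuous_map_def)
  define U where "U = {p' \<in> topspace P. \<pi> p' \<in> {g \<in> X m. snorm (length \<alpha>) (g - \<pi> p) < e/2}}"
  have U: "openin P U" unfolding U_def
    by (rule openin_continuous_map_preimage[OF \<pi> openin_snorm_ball[OF X[OF p] a]])
  have "0 \<le> e/2" using e by simp
  have pU: "p \<in> U" using p X e by (simp add: U_def snorm_zero)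
  have "continuous_map (top_of_set K) euclidean (PD K (\<pi> p) \<alpha>)"
    using jet_cont[OF X_jet[OF X[OF p]] a] by simp
  then obtain V where V: "openin (top_of_set K) V" "x \<in> V"
    "\<And>y. y \<in> V \<Longrightarrow> dist (PD K (\<pi> p) \<alpha> y) (PD K (\<pi> p) \<alpha> x) < e/2"
    using continuous_map_euclideanD[of "top_of_set K" "PD K (\<pi> p) \<alpha>" x "e/2"] x e by auto
  show "\<exists>U. openin (prod_topology P (top_of_set K)) U \<and> q \<in> U \<and>
      (\<forall>y\<in>U. dist (PD K (\<pi> (fst y)) \<alpha> (snd y) $ c) (PD K (\<pi> (fst q)) \<alpha> (snd q) $ c) < e)"
  proof (intro exI[of _ "U \<times> V"] conjI ballI)
    show "openin (prod_topology P (top_of_set K)) (U \<times> V)" using U V by (simp add: openin_prod_Times_iff)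
    show "q \<in> U \<times> V" using pU V by simp
    fix y assume y: "y \<in> U \<times> V"
    then have y1: "fst y \<in> topspace P" "snorm (length \<alpha>) (\<pi> (fst y) - \<pi> p) < e/2" and y2: "snd y \<in> V" "snd y \<in> K"
      using openin_subset[OF V(1)] by (auto simp: U_def)
    have "norm (PD K (\<pi> (fst y) - \<pi> p) \<alpha> (snd y)) \<le> snorm (length \<alpha>) (\<pi> (fst y) - \<pi> p)"
      by (rule norm_PD_le[OF X_diff[OF X X] a]) (use y1 y2 p in auto)
    then have "dist (PD K (\<pi> (fst y)) \<alpha> (snd y)) (PD K (\<pi> p) \<alpha> (snd y)) < e/2"
      using PD_diff[OF X[OF y1(1)] X[OF p] a y2(2)] y1(2) by (simp add: dist_norm)
    with V(3)[OF y2(1)] have "dist (PD K (\<pi> (fst y)) \<alpha> (snd y)) (PD K (\<pi> p) \<alpha> x) < e"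
      using dist_triangle_half_l by (metis dist_commute)
    then show "dist (PD K (\<pi> (fst y)) \<alpha> (snd y) $ c) (PD K (\<pi> (fst q)) \<alpha> (snd q) $ c) < e"
      using dist_vec_nth_le[of "PD K (\<pi> (fst y)) \<alpha> (snd y)" c "PD K (\<pi> p) \<alpha> x"] by simp
  qed
qed

lemma space_deriv_atom:
  assumes X: "\<And>p. p \<in> topspace P \<Longrightarrow> \<pi> p \<in> X m" and a: "enat (Suc (length \<alpha>)) \<le> m"
  shows "space_deriv (\<lambda>p x. PD K (\<pi> p) \<alpha> x $ c) (\<lambda>i p x. PD K (\<pi> p) (\<alpha> @ [i]) x $ c)"
  unfolding space_deriv_def
proof (intro ballI)
  fix p x assume p: "p \<in> topspace P" and x: "x \<in> interior K"
  from bounded_linear.has_derivative[OF bounded_linear_vec_nth jet_deriv[OF X_jet[OF X[OF p]] a x], of c]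
  show "((\<lambda>x. PD K (\<pi> p) \<alpha> x $ c) has_derivative
     (\<lambda>h. \<Sum>i\<in>UNIV. h$i * PD K (\<pi> p) (\<alpha> @ [i]) x $ c)) (at x)" by simp
qed

text \<open>A map that the flow leaves alone has parameter derivative 0, so only space orders are
  consumed. This covers the direction components of a parameter and single fixed C^r-maps.\<close>

lemma Csr_atom_constant:
  assumes \<pi>: "continuous_map P (Cr_bdry_topology m K) \<pi>" and inv: "\<And>j p t. \<pi> (fl j p t) = \<pi> p"
  shows "enat (length \<alpha> + r) \<le> m \<Longrightarrow> Csr s r (\<lambda>p x. PD K (\<pi> p) \<alpha> x $ c)"
proof (induction "s + r" arbitrary: s r \<alpha> rule: less_induct)
  case less
  have a: "enat (length \<alpha>) \<le> m" using less.prems enat_le_trans le_add1 by blast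
  show ?case
  proof (rule CsrI; (intro allI impI)?)
    show "jointly_cont (\<lambda>p x. PD K (\<pi> p) \<alpha> x $ c)" by (rule jointly_cont_atom[OF \<pi> a])
  next
    fix s' j assume "s = Suc s'"
    show "\<exists>k. param_deriv j (\<lambda>p x. PD K (\<pi> p) \<alpha> x $ c) k \<and> Csr s' r k"
      by (intro exI[of _ "\<lambda>p x. 0"] conjI Csr_const) (simp add: param_deriv_def inv)
  next
    fix r' assume r: "r = Suc r'"
    have "enat (length (\<alpha> @ [i]) + r') \<le> m" for i using less.prems r by simp
    then have "Csr s r' (\<lambda>p x. PD K (\<pi> p) (\<alpha> @ [i]) x $ c)" for i
      using less.hyps[of s r'] r by auto
    moreover have "enat (Suc (length \<alpha>)) \<le> m"
      by (rule enat_le_trans[OF _ less.prems]) (simp add: r)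
    ultimately show "\<exists>k. space_deriv (\<lambda>p x. PD K (\<pi> p) \<alpha> x $ c) k \<and> (\<forall>i. Csr s r' (k i))"
      using space_deriv_atom[of \<pi> m] \<pi> by (intro exI[of _ "\<lambda>i p x. PD K (\<pi> p) (\<alpha> @ [i]) x $ c"]) (auto simp: continuous_map_def Pi_iff)
  qed
qed

text \<open>Along the flow the map is affine in t with slope \<open>\<rho> j p\<close>, which the
  flow in turn leaves alone: after one parameter derivative the situation of
  \<open>Csr_atom_constant\<close> is reached. Hence \<open>s\<close> is arbitrary.\<close>

lemma Csr_atom:
  assumes \<pi>: "continuous_map P (Cr_bdry_topology m K) \<pi>"
    and \<rho>: "\<And>j. continuous_map P (Cr_bdry_topology m K) (\<rho> j)"
    and inv: "\<And>j j' p t. \<rho> j (fl j' p t) = \<rho> j p"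
    and flow: "\<And>j p t. p \<in> topspace P \<Longrightarrow> \<pi> (fl j p t) = \<pi> p + t *\<^sub>R \<rho> j p"
  shows "enat (length \<alpha> + r) \<le> m \<Longrightarrow> Csr s r (\<lambda>p x. PD K (\<pi> p) \<alpha> x $ c)"
proof (induction "s + r" arbitrary: s r \<alpha> rule: less_induct)
  case less
  have a: "enat (length \<alpha>) \<le> m" using less.prems enat_le_trans le_add1 by blast
  have X: "\<pi> p \<in> X m" "\<rho> j p \<in> X m" if "p \<in> topspace P" for p j
    using \<pi> \<rho>[of j] that by (auto simp: continuous_map_def)
  show ?case
  proof (rule CsrI; (intro allI impI)?)
    show "jointly_cont (\<lambda>p x. PD K (\<pi> p) \<alpha> x $ c)" by (rule jointly_cont_atom[OF \<pi> a])
  next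
    fix s' j assume "s = Suc s'"
    have "param_deriv j (\<lambda>p x. PD K (\<pi> p) \<alpha> x $ c) (\<lambda>p x. PD K (\<rho> j p) \<alpha> x $ c)"
      unfolding param_deriv_def
    proof (intro ballI)
      fix p x assume p: "p \<in> topspace P" and x: "x \<in> K"
      have "PD K (\<pi> (fl j p t)) \<alpha> x $ c = PD K (\<pi> p) \<alpha> x $ c + t * PD K (\<rho> j p) \<alpha> x $ c" for t
        unfolding flow[OF p]
        using PD_add[OF X(1)[OF p] X_scale[OF X(2)[OF p]] a x] PD_scale[OF X(2)[OF p] a x] by simp
      then show "((\<lambda>t. PD K (\<pi> (fl j p t)) \<alpha> x $ c) has_real_derivative PD K (\<rho> j p) \<alpha> x $ c) (at 0)"
        by (auto intro!: derivative_eq_intros)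
    qed
    then show "\<exists>k. param_deriv j (\<lambda>p x. PD K (\<pi> p) \<alpha> x $ c) k \<and> Csr s' r k"
      using Csr_atom_constant[OF \<rho> inv less.prems] by blast
  next
    fix r' assume r: "r = Suc r'"
    have "enat (length (\<alpha> @ [i]) + r') \<le> m" for i using less.prems r by simp
    then have "Csr s r' (\<lambda>p x. PD K (\<pi> p) (\<alpha> @ [i]) x $ c)" for i
      using less.hyps[of s r'] r by auto
    moreover have "enat (Suc (length \<alpha>)) \<le> m"
      by (rule enat_le_trans[OF _ less.prems]) (simp add: r)
    ultimately show "\<exists>k. space_deriv (\<lambda>p x. PD K (\<pi> p) \<alpha> x $ c) k \<and> (\<forall>i. Csr s r' (k i))"
      using space_deriv_atom[OF X(1)] by (intro exI[of _ "\<lambda>i p x. PD K (\<pi> p) (\<alpha> @ [i]) x $ c"]) auto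
  qed
qed

end

section \<open>Local convexity and completeness\<close>

context convex_body begin

lemma nbhd_snorm_ball:
  assumes "f \<in> X r" "enat k \<le> r" "0 < e"
  shows "f \<in> {g \<in> X r. snorm k (g - f) < e}"
  using assms by (simp add: snorm_zero)

lemma Hausdorff_Cr_bdry: "Hausdorff_space (Cr_bdry_topology r K)"
  unfolding Hausdorff_space_def
proof (intro allI impI)
  fix f g assume fg: "f \<in> X r \<and> g \<in> X r \<and> f \<noteq> g"
  have 0: "enat 0 \<le> r" by (simp add: zero_enat_def[symmetric])
  define d where "d = snorm 0 (f - g)"
  have fgX: "f - g \<in> X r" using fg X_diff by blast
  have "d \<noteq> 0" using nrm_0_eq[OF fgX _ 0] fg by (auto simp: d_def)
  then have d: "d > 0" using snorm_nonneg[OF fgX 0] by (simp add: d_def)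
  have "disjnt {h \<in> X r. snorm 0 (h - f) < d/2} {h \<in> X r. snorm 0 (h - g) < d/2}"
    unfolding disjnt_iff
  proof (intro allI notI)
    fix h assume h: "h \<in> {h \<in> X r. snorm 0 (h - f) < d/2} \<and> h \<in> {h \<in> X r. snorm 0 (h - g) < d/2}"
    have "d \<le> snorm 0 (f - h) + snorm 0 (h - g)"
      unfolding d_def using snorm_triangle_diff[of f r h g 0] fg h 0 by blast
    then show False using h fg snorm_diff_commute[of f r h 0] 0 by simp
  qed
  then show "\<exists>U V. openin (Cr_bdry_topology r K) U \<and> openin (Cr_bdry_topology r K) V \<and> f \<in> U \<and> g \<in> V \<and> disjnt U V"
    using openin_snorm_ball fg 0 nbhd_snorm_ball[of _ r 0 "d/2"] d by (meson half_gt_zero)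
qed

lemma continuous_add_Cr_bdry:
  "continuous_map (prod_topology (Cr_bdry_topology r K) (Cr_bdry_topology r K)) (Cr_bdry_topology r K) (\<lambda>(f, g). f + g)"
proof (rule continuous_map_Cr_bdryI)
  show "(case p of (f, g) \<Rightarrow> f + g) \<in> X r"
    if "p \<in> topspace (prod_topology (Cr_bdry_topology r K) (Cr_bdry_topology r K))" for p
    using that X_add by (auto simp: case_prod_unfold mem_Times_iff)
  fix p k and e :: real
  assume p: "p \<in> topspace (prod_topology (Cr_bdry_topology r K) (Cr_bdry_topology r K))" and k: "enat k \<le> r" and e: "0 < e"
  obtain f g where [simp]: "p = (f, g)" by fastforce
  have fg: "f \<in> X r" "g \<in> X r" using p by auto
  let ?B = "\<lambda>f. {h \<in> X r. snorm k (h - f) < e/2}"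
  show "\<exists>N. openin (prod_topology (Cr_bdry_topology r K) (Cr_bdry_topology r K)) N \<and> p \<in> N \<and>
     (\<forall>q\<in>N. snorm k ((case q of (f, g) \<Rightarrow> f + g) - (case p of (f, g) \<Rightarrow> f + g)) < e)"
  proof (intro exI[of _ "?B f \<times> ?B g"] conjI ballI)
    show "openin (prod_topology (Cr_bdry_topology r K) (Cr_bdry_topology r K)) (?B f \<times> ?B g)"
      unfolding openin_prod_Times_iff
      using openin_snorm_ball[OF fg(1) k, of "e/2"] openin_snorm_ball[OF fg(2) k, of "e/2"] by blast
    show "p \<in> ?B f \<times> ?B g" using fg e by (simp add: snorm_zero)
    fix q assume q: "q \<in> ?B f \<times> ?B g"
    have "snorm k ((fst q - f) + (snd q - g)) \<le> snorm k (fst q - f) + snorm k (snd q - g)"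
      by (rule snorm_triangle[OF X_diff X_diff k]) (use q fg in auto)
    moreover have "(fst q - f) + (snd q - g) = fst q + snd q - (f + g)" by simp
    ultimately show "snorm k ((case q of (f, g) \<Rightarrow> f + g) - (case p of (f, g) \<Rightarrow> f + g)) < e"
      using q by (auto simp: case_prod_unfold)
  qed
qed

lemma continuous_scaleR_Cr_bdry:
  "continuous_map (prod_topology euclideanreal (Cr_bdry_topology r K)) (Cr_bdry_topology r K) (\<lambda>(c, f). c *\<^sub>R f)"
proof (rule continuous_map_Cr_bdryI)
  show "(case p of (c, f) \<Rightarrow> c *\<^sub>R f) \<in> X r"
    if "p \<in> topspace (prod_topology euclideanreal (Cr_bdry_topology r K))" for p
    using that X_scale by (auto simp: case_prod_unfold mem_Times_iff)
  fix p k and e :: real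
  assume p: "p \<in> topspace (prod_topology euclideanreal (Cr_bdry_topology r K))" and k: "enat k \<le> r" and e: "0 < e"
  obtain c f where [simp]: "p = (c, f)" by fastforce
  have f: "f \<in> X r" using p by auto
  define M where "M = snorm k f + 1"
  have M: "M > 0" using snorm_nonneg[OF f k] by (simp add: M_def)
  \<comment> \<open>Sizes for c' g - c f = c' (g - f) + (c' - c) f: the bound \<delta> \<le> 1 gives
    an absolute value of at most 1 plus that of c for c', and each summand is allotted e/2.
    \<open>M\<close> exceeds the norm of \<open>f\<close> by 1 so that it is positive.\<close>
  define \<delta> where "\<delta> = min 1 (e / (2 * M))"
  define \<eta> where "\<eta> = e / (2 * (\<bar>c\<bar> + 1))"
  have \<delta>: "\<delta> > 0" "\<delta> \<le> 1" "\<delta> * M \<le> e/2" and \<eta>: "\<eta> > 0" "(\<bar>c\<bar> + 1) * \<eta> = e/2"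
    using e M by (auto simp: \<delta>_def \<eta>_def min_def field_simps)
  let ?B = "{h \<in> X r. snorm k (h - f) < \<eta>}"
  show "\<exists>N. openin (prod_topology euclideanreal (Cr_bdry_topology r K)) N \<and> p \<in> N \<and>
     (\<forall>q\<in>N. snorm k ((case q of (c, f) \<Rightarrow> c *\<^sub>R f) - (case p of (c, f) \<Rightarrow> c *\<^sub>R f)) < e)"
  proof (intro exI[of _ "ball c \<delta> \<times> ?B"] conjI ballI)
    show "openin (prod_topology euclideanreal (Cr_bdry_topology r K)) (ball c \<delta> \<times> ?B)"
      using openin_snorm_ball f k by (simp add: openin_prod_Times_iff)
    show "p \<in> ball c \<delta> \<times> ?B" using f \<eta> \<delta> by (simp add: snorm_zero)
    fix q assume q: "q \<in> ball c \<delta> \<times> ?B"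
    obtain c' g where [simp]: "q = (c', g)" by fastforce
    have g: "g \<in> X r" "snorm k (g - f) < \<eta>" and c': "\<bar>c' - c\<bar> < \<delta>" using q by (auto simp: dist_real_def)
    have "c' *\<^sub>R g - c *\<^sub>R f = c' *\<^sub>R (g - f) + (c' - c) *\<^sub>R f" by (simp add: algebra_simps)
    then have "snorm k (c' *\<^sub>R g - c *\<^sub>R f) \<le> \<bar>c'\<bar> * snorm k (g - f) + \<bar>c' - c\<bar> * snorm k f"
      using snorm_triangle[OF X_scale[OF X_diff[OF g(1) f]] X_scale[OF f] k, of c' "c' - c"]
      by (simp only: snorm_scale[OF X_diff[OF g(1) f] k] snorm_scale[OF f k])
    also have "\<bar>c'\<bar> * snorm k (g - f) \<le> (\<bar>c\<bar> + 1) * snorm k (g - f)"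
      using c' \<delta>(2) snorm_nonneg[OF X_diff[OF g(1) f] k] by (intro mult_right_mono) auto
    also have "(\<bar>c\<bar> + 1) * snorm k (g - f) < (\<bar>c\<bar> + 1) * \<eta>"
      using g(2) by (intro mult_strict_left_mono) auto
    also have "\<bar>c' - c\<bar> * snorm k f \<le> \<delta> * M"
      using c' snorm_nonneg[OF f k] by (intro mult_mono) (auto simp: M_def)
    finally show "snorm k ((case q of (c, f) \<Rightarrow> c *\<^sub>R f) - (case p of (c, f) \<Rightarrow> c *\<^sub>R f)) < e"
      using \<delta>(3) \<eta>(2) by simp
  qed
qed

lemma locally_convex_Cr_bdry: "locally_convex_space (Cr_bdry_topology r K)"
  unfolding locally_convex_space_def
proof (intro conjI allI impI)
  fix W assume W: "openin (Cr_bdry_topology r K) W \<and> 0 \<in> W"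
  then obtain k e where k: "enat k \<le> r" and e: "0 < e" and sub: "{g \<in> X r. snorm k (g - 0) < e} \<subseteq> W"
    unfolding openin_Cr_bdry by blast
  let ?V = "{g \<in> X r. snorm k (g - 0) < e}"
  have "convex ?V"
    unfolding convex_def
  proof (intro ballI allI impI)
    fix f g and u v :: real
    assume f: "f \<in> ?V" and g: "g \<in> ?V" and uv: "0 \<le> u" "0 \<le> v" "u + v = 1"
    have X: "f \<in> X r" "g \<in> X r" using f g by auto
    have "snorm k (u *\<^sub>R f + v *\<^sub>R g) \<le> u * snorm k f + v * snorm k g"
      using snorm_triangle[OF X_scale X_scale k, of f g u v] uv X
      by (simp only: snorm_scale[OF X(1) k] snorm_scale[OF X(2) k]) simp
    also have "\<dots> < e"
      using f g uv convex_bound_lt[of "snorm k f" e "snorm k g" u v] by simp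
    finally show "u *\<^sub>R f + v *\<^sub>R g \<in> ?V" using X X_add X_scale by simp
  qed
  then show "\<exists>V. openin (Cr_bdry_topology r K) V \<and> convex V \<and> 0 \<in> V \<and> V \<subseteq> W"
    using openin_snorm_ball[OF X_zero k] nbhd_snorm_ball[OF X_zero k e] sub by blast
qed (simp_all add: subspace_X Hausdorff_Cr_bdry continuous_add_Cr_bdry continuous_scaleR_Cr_bdry)

text \<open>For finite \<open>r\<close> the top norm dominates all the others and defines the
  topology. A Cauchy sequence has uniformly convergent jets, and by \<open>jet_uniform_limit\<close>
  the limits form a jet again.\<close>

lemma Banach_Cr_bdry: "Banach_space (Cr_bdry_topology (enat r) K)"
proof -
  let ?X = "X (enat r)" and ?T = "Cr_bdry_topology (enat r) K"
  \<comment> \<open>\<open>Metric_space\<close> demands nonnegativity and symmetry of the distance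
    for all arguments, not just those in the space. The default 0 provides both.\<close>
  define N where "N f = (if f \<in> ?X then snorm r f else 0)" for f
  have r: "enat r \<le> enat r" by simp
  have Nd: "N (f - g) = snorm r (f - g)" if "f \<in> ?X" "g \<in> ?X" for f g
    using that X_diff by (auto simp: N_def)
  have Nd': "N (f - g) = snorm r (g - f)" if "f \<in> ?X" "g \<in> ?X" for f g
    using Nd[OF that] snorm_diff_commute[OF that r] by (rule trans)
  have X_minus: "- f \<in> ?X" if "f \<in> ?X" for f using X_scale[OF that, of "-1"] by simp
  interpret N: Metric_space ?X "\<lambda>f g. N (f - g)"
  proof
    show "0 \<le> N (f - g)" for f g by (auto simp: N_def snorm_nonneg)
    show "N (f - g) = N (g - f)" for f g
    proof -
      have "N (- h) = N h" for h
        using X_minus[of h] X_minus[of "- h"] snorm_scale[OF _ r, of h "-1"] by (auto simp: N_def)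
      from this[of "f - g"] show ?thesis by simp
    qed
    show "N (f - g) = 0 \<longleftrightarrow> f = g" if "f \<in> ?X" "g \<in> ?X" for f g
      using nrm_0_eq[OF X_diff[OF that] _ r] by (auto simp: Nd that snorm_zero)
    show "N (f - h) \<le> N (f - g) + N (g - h)" if "f \<in> ?X" "g \<in> ?X" "h \<in> ?X" for f g h
      using snorm_triangle_diff[OF that r] that by (simp add: Nd)
  qed
  have "openin N.mtopology V \<longleftrightarrow> openin ?T V" for V
  proof
    assume V: "openin N.mtopology V"
    show "openin ?T V"
      unfolding openin_Cr_bdry
    proof (intro conjI ballI)
      show sub: "V \<subseteq> ?X" using V by (simp add: N.openin_mtopology)
      fix f assume f: "f \<in> V"
      then obtain e where e: "e > 0" "N.mball f e \<subseteq> V" using V by (auto simp: N.openin_mtopology)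
      have *: "g \<in> N.mball f e" if "g \<in> ?X" "snorm r (g - f) < e" for g
        using that subsetD[OF sub f] Nd'[of f g] by (simp only: N.in_mball)
      show "\<exists>k e. enat k \<le> enat r \<and> 0 < e \<and> {g \<in> ?X. snorm k (g - f) < e} \<subseteq> V"
      proof (intro exI conjI)
        show "{g \<in> ?X. snorm r (g - f) < e} \<subseteq> V" using * e(2) by blast
      qed (simp_all add: e)
    qed
  next
    assume V: "openin ?T V"
    show "openin N.mtopology V"
      unfolding N.openin_mtopology
    proof (intro conjI allI impI)
      show sub: "V \<subseteq> ?X" using V by (simp add: openin_Cr_bdry)
      fix f assume f: "f \<in> V"
      then obtain k e where k: "enat k \<le> enat r" "0 < e" "{g \<in> ?X. snorm k (g - f) < e} \<subseteq> V"
        using V by (auto simp: openin_Cr_bdry)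
      have "N.mball f e \<subseteq> V"
      proof
        fix g assume g: "g \<in> N.mball f e"
        then have gX: "g \<in> ?X" "f \<in> ?X" by (auto simp: N.in_mball)
        have "snorm k (g - f) \<le> snorm r (g - f)" by (rule snorm_mono[OF X_diff[OF gX] r]) (use k in simp)
        also have "\<dots> < e" using g Nd'[OF gX(2,1)] by (simp only: N.in_mball)
        finally show "g \<in> V" using k(3) gX by blast
      qed
      then show "\<exists>e>0. N.mball f e \<subseteq> V" using k by blast
    qed
  qed
  then have top: "N.mtopology = ?T" by (simp add: topology_eq)
  have "N.mcomplete"
    unfolding N.mcomplete_def
  proof (intro allI impI)
    fix \<sigma> assume C: "N.MCauchy \<sigma>"
    then have \<sigma>: "\<sigma> n \<in> ?X" for n by (auto simp: N.MCauchy_def)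
    have Cau: "\<exists>M. \<forall>n\<ge>M. \<forall>m\<ge>M. snorm r (\<sigma> n - \<sigma> m) < e" if e: "e > 0" for e
    proof -
      have "\<exists>M. \<forall>n n'. M \<le> n \<longrightarrow> M \<le> n' \<longrightarrow> N (\<sigma> n - \<sigma> n') < e"
        using C[unfolded N.MCauchy_def] e by simp
      then show ?thesis unfolding Nd[OF \<sigma> \<sigma>] by auto
    qed
    have PDle: "norm (PD K (\<sigma> n) \<alpha> x - PD K (\<sigma> m) \<alpha> x) \<le> snorm r (\<sigma> n - \<sigma> m)"
      if "length \<alpha> \<le> r" "x \<in> K" for \<alpha> x n m
      using norm_PD_le[OF X_diff[OF \<sigma> \<sigma>] r that, of n m] PD_diff[OF \<sigma> \<sigma>, of \<alpha> x n m] that by simp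
    have "\<exists>D. uniform_limit K (\<lambda>n. PD K (\<sigma> n) \<alpha>) D sequentially" if a: "length \<alpha> \<le> r" for \<alpha>
    proof -
      have "uniformly_Cauchy_on K (\<lambda>n. PD K (\<sigma> n) \<alpha>)"
        unfolding uniformly_Cauchy_on_def
      proof (intro allI impI)
        fix e :: real assume "e > 0"
        from Cau[OF this] obtain M where M: "\<And>n m. n \<ge> M \<Longrightarrow> m \<ge> M \<Longrightarrow> snorm r (\<sigma> n - \<sigma> m) < e" by blast
        show "\<exists>M. \<forall>x\<in>K. \<forall>m\<ge>M. \<forall>n\<ge>M. dist (PD K (\<sigma> m) \<alpha> x) (PD K (\<sigma> n) \<alpha> x) < e"
          using le_less_trans[OF PDle[OF a] M] by (intro exI[of _ M]) (auto simp: dist_norm)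
      qed
      then show ?thesis
        using Cauchy_uniformly_convergent uniformly_convergent_on_def by blast
    qed
    then obtain D where D: "\<And>\<alpha>. length \<alpha> \<le> r \<Longrightarrow> uniform_limit K (\<lambda>n. PD K (\<sigma> n) \<alpha>) (D \<alpha>) sequentially"
      by metis
    have jD: "jet K (enat r) D"
      by (rule jet_uniform_limit[OF convex_K X_jet[OF \<sigma>] D]) simp
    have D0: "(\<lambda>n. \<sigma> n x) \<longlonglongrightarrow> D [] x" if "x \<in> K" for x
      using tendsto_uniform_limitI[OF D[of "[]"] that] PD_Nil[OF \<sigma> that] by simp
    define f where "f x = (if x \<in> K then D [] x else 0)" for x
    have "f x = 0" if "x \<notin> interior K" for x
    proof (cases "x \<in> K")
      case True
      then have "D [] x = 0" using LIMSEQ_unique[OF D0[OF True]] X_outside[OF \<sigma> that] by simp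
      then show ?thesis by (simp add: f_def)
    qed (simp add: f_def)
    then have f: "f \<in> ?X" by (intro X_I[OF jD]) (auto simp: f_def)
    have PDf: "PD K f \<alpha> x = D \<alpha> x" if "length \<alpha> \<le> r" "x \<in> K" for \<alpha> x
      by (rule PD_eq[OF jD]) (use that in \<open>auto simp: f_def\<close>)
    have "limitin ?T \<sigma> f sequentially"
    proof (rule limitin_Cr_bdryI[OF f])
      fix k and e :: real assume k: "enat k \<le> enat r" and e: "0 < e"
      have "\<forall>\<^sub>F n in sequentially. \<forall>\<alpha>\<in>{\<alpha>::'n list. length \<alpha> \<le> k}. \<forall>x\<in>K. dist (PD K (\<sigma> n) \<alpha> x) (D \<alpha> x) < e/2"
      proof (rule eventually_ball_finite)
        show "finite {\<alpha>::'n list. length \<alpha> \<le> k}"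
          using finite_lists_length_le[of "UNIV :: 'n set" k] by simp
      qed (use uniform_limitD[OF D, of _ "e/2"] k e in auto)
      then show "\<forall>\<^sub>F n in sequentially. snorm k (\<sigma> n - f) < e"
      proof (rule eventually_mono)
        fix n assume n: "\<forall>\<alpha>\<in>{\<alpha>::'n list. length \<alpha> \<le> k}. \<forall>x\<in>K. dist (PD K (\<sigma> n) \<alpha> x) (D \<alpha> x) < e/2"
        have "snorm k (\<sigma> n - f) \<le> e/2"
          unfolding snorm_le_iff[OF X_diff[OF \<sigma> f] k]
        proof (intro allI impI)
          fix \<alpha> :: "'n list" and x assume a: "length \<alpha> \<le> k" "x \<in> K"
          have "norm (PD K (\<sigma> n) \<alpha> x - D \<alpha> x) < e/2" using n a by (auto simp: dist_norm)
          then show "norm (PD K (\<sigma> n - f) \<alpha> x) \<le> e/2"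
            using PD_diff[OF \<sigma> f enat_le_trans[OF a(1) k] a(2)] PDf[of \<alpha> x] a k by simp
        qed
        then show "snorm k (\<sigma> n - f) < e" using e by simp
      qed
    qed (simp add: \<sigma>)
    then show "\<exists>f. limitin N.mtopology \<sigma> f sequentially" unfolding top by blast
  qed
  moreover have "\<forall>c. \<forall>f\<in>?X. N (c *\<^sub>R f) = \<bar>c\<bar> * N f"
    using snorm_scale[OF _ r] X_scale by (simp add: N_def)
  ultimately show ?thesis
    unfolding Banach_space_def using subspace_X top N.Metric_space_axioms by blast
qed

end

section \<open>Maps into the space of maps\<close>

lemma norm_vec_le_sum: "norm (\<chi> c. a c :: real^'n) \<le> (\<Sum>c\<in>UNIV. \<bar>a c\<bar>)"
  using norm_le_l1_cart[of "\<chi> c. a c"] by simp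

context convex_body begin

lemma jet_from_finite: "(\<And>k. enat k \<le> r \<Longrightarrow> jet K (enat k) D) \<Longrightarrow> jet K r D"
  unfolding jet_def by auto

text \<open>\<open>Csr\<close> counts orders by natural numbers, so an infinite \<open>r\<close> is
  reached through all finite \<open>k\<close>.\<close>

lemma X_from_finite:
  assumes "\<And>k. enat k \<le> r \<Longrightarrow> f \<in> X (enat k)"
  shows "f \<in> X r"
proof -
  have 0: "enat 0 \<le> r" by (simp add: zero_enat_def[symmetric])
  show ?thesis
  proof (rule X_I)
    show "jet K r (PD K f)" by (rule jet_from_finite) (rule X_jet[OF assms])
  qed (use PD_Nil[OF assms[OF 0]] X_outside[OF assms[OF 0]] in auto)
qed

end

context param_calculus begin

text \<open>The value 0 off the interior yields directly the representation of elements of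
  \<open>X r\<close>. For a family satisfying \<open>vanishing\<close> and a parameter in
  \<open>P\<close>, it agrees with the given components on \<open>K\<close>.\<close>

definition to_map :: "('n \<Rightarrow> 'p \<Rightarrow> real^'n \<Rightarrow> real) \<Rightarrow> 'p \<Rightarrow> real^'n \<Rightarrow> real^'n" where
  "to_map G p = (\<lambda>x. if x \<in> interior K then (\<chi> c. G c p x) else 0)"

definition vanishing :: "('n \<Rightarrow> 'p \<Rightarrow> real^'n \<Rightarrow> real) \<Rightarrow> bool" where
  "vanishing G \<longleftrightarrow> (\<forall>c. \<forall>p\<in>topspace P. \<forall>x\<in>K - interior K. G c p x = 0)"

text \<open>\<open>Csr\<close> asserts the existence of one derivative at a time; here the choices
  are made coherently. The word i # \<beta> stands for the chosen derivative in coordinate i,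
  followed by its own family at \<beta>.\<close>

lemma Csr_jet:
  "Csr s r g \<Longrightarrow> \<exists>D. D [] = g \<and> (\<forall>\<alpha>. length \<alpha> \<le> r \<longrightarrow> Csr s (r - length \<alpha>) (D \<alpha>)) \<and>
     (\<forall>\<alpha>. length \<alpha> < r \<longrightarrow> space_deriv (D \<alpha>) (\<lambda>i. D (\<alpha> @ [i])))"
proof (induction r arbitrary: g)
  case 0
  then show ?case by (intro exI[of _ "\<lambda>_. g"]) auto
next
  case (Suc r)
  obtain g' where g': "space_deriv g g'" "\<And>i. Csr s r (g' i)" using Csr_space_deriv[OF Suc.prems] by blast
  from Suc.IH[OF g'(2)] obtain D where D: "\<And>i. D i [] = g' i"
    "\<And>i \<alpha>. length \<alpha> \<le> r \<Longrightarrow> Csr s (r - length \<alpha>) (D i \<alpha>)"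
    "\<And>i \<alpha>. length \<alpha> < r \<Longrightarrow> space_deriv (D i \<alpha>) (\<lambda>j. D i (\<alpha> @ [j]))"
    by metis
  define E where "E \<alpha> = (case \<alpha> of [] \<Rightarrow> g | i # \<beta> \<Rightarrow> D i \<beta>)" for \<alpha>
  have E: "E [] = g" "E (i # \<beta>) = D i \<beta>" for i \<beta> by (simp_all add: E_def)
  have "Csr s (Suc r - length \<alpha>) (E \<alpha>)" if "length \<alpha> \<le> Suc r" for \<alpha>
    using that Suc.prems D(2) by (cases \<alpha>) (auto simp: E)
  moreover have "space_deriv (E \<alpha>) (\<lambda>i. E (\<alpha> @ [i]))" if "length \<alpha> < Suc r" for \<alpha>
    using that g'(1) D(3) by (cases \<alpha>) (auto simp: E D(1))
  ultimately show ?case using E(1) by blast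
qed

lemma jet_components:
  assumes c: "\<And>c \<alpha>. length \<alpha> \<le> r \<Longrightarrow> jointly_cont (D c \<alpha>)"
    and x: "\<And>c \<alpha>. length \<alpha> < r \<Longrightarrow> space_deriv (D c \<alpha>) (\<lambda>i. D c (\<alpha> @ [i]))"
    and p: "p \<in> topspace P"
  shows "jet K (enat r) (\<lambda>\<alpha> x. (\<chi> c. D c \<alpha> p x) :: real^'n)"
  unfolding jet_def
proof (intro conjI allI impI ballI)
  fix \<alpha> :: "'n list" assume "enat (length \<alpha>) \<le> enat r"
  then show "continuous_on K (\<lambda>x. \<chi> c. D c \<alpha> p x)"
    by (intro continuous_on_vec_lambda jointly_cont_x[OF c p]) simp
next
  fix \<alpha> :: "'n list" and z assume "enat (Suc (length \<alpha>)) \<le> enat r" and z: "z \<in> interior K"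
  then have "length \<alpha> < r" by simp
  then have "((\<lambda>x. \<chi> c. D c \<alpha> p x) has_derivative (\<lambda>h. \<chi> c. \<Sum>i\<in>UNIV. h$i * D c (\<alpha> @ [i]) p z)) (at z)"
    using x p z by (intro has_derivative_vec) (simp add: space_deriv_def)
  then show "((\<lambda>x. \<chi> c. D c \<alpha> p x) has_derivative (\<lambda>h. \<Sum>i\<in>UNIV. (h$i) *\<^sub>R (\<chi> c. D c (\<alpha> @ [i]) p z))) (at z)"
    by (rule has_derivative_eq_rhs) (simp add: fun_eq_iff vec_eq_iff)
qed

lemma to_map_PD:
  assumes D0: "\<And>c. D c [] = G c" and van: "vanishing G"
    and c: "\<And>c \<alpha>. length \<alpha> \<le> r \<Longrightarrow> jointly_cont (D c \<alpha>)"
    and x: "\<And>c \<alpha>. length \<alpha> < r \<Longrightarrow> space_deriv (D c \<alpha>) (\<lambda>i. D c (\<alpha> @ [i]))"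
    and p: "p \<in> topspace P"
  shows "to_map G p \<in> X (enat r)"
    and "length \<alpha> \<le> r \<Longrightarrow> z \<in> K \<Longrightarrow> PD K (to_map G p) \<alpha> z = (\<chi> c. D c \<alpha> p z)"
proof -
  have j: "jet K (enat r) (\<lambda>\<alpha> x. (\<chi> c. D c \<alpha> p x) :: real^'n)"
    by (rule jet_components[OF c x p])
  have f: "to_map G p x = (\<chi> c. D c [] p x)" if "x \<in> K" for x
    using that van p by (auto simp: to_map_def D0 vanishing_def vec_eq_iff)
  show "to_map G p \<in> X (enat r)" by (rule X_I[OF j f]) (simp_all add: to_map_def)
  show "length \<alpha> \<le> r \<Longrightarrow> z \<in> K \<Longrightarrow> PD K (to_map G p) \<alpha> z = (\<chi> c. D c \<alpha> p z)"
    by (rule PD_eq[OF j f]) auto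
qed

lemma to_map_in_X:
  assumes G: "\<And>c k. enat k \<le> r \<Longrightarrow> Csr 0 k (G c)" and van: "vanishing G" and p: "p \<in> topspace P"
  shows "to_map G p \<in> X r"
proof (rule X_from_finite)
  fix k assume k: "enat k \<le> r"
  have "\<forall>c. \<exists>D. D [] = G c \<and> (\<forall>\<alpha>. length \<alpha> \<le> k \<longrightarrow> Csr 0 (k - length \<alpha>) (D \<alpha>)) \<and>
     (\<forall>\<alpha>. length \<alpha> < k \<longrightarrow> space_deriv (D \<alpha>) (\<lambda>i. D (\<alpha> @ [i])))" using Csr_jet[OF G[OF k]] by blast
  then obtain D where "\<And>c. D c [] = G c" "\<And>c \<alpha>. length \<alpha> \<le> k \<Longrightarrow> Csr 0 (k - length \<alpha>) (D c \<alpha>)"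
     "\<And>c \<alpha>. length \<alpha> < k \<Longrightarrow> space_deriv (D c \<alpha>) (\<lambda>i. D c (\<alpha> @ [i]))" by metis
  then show "to_map G p \<in> X (enat k)"
    by (intro to_map_PD(1)[of D, OF _ van _ _ p]) (rule Csr_jointly_cont | assumption)+
qed

text \<open>The tube lemma over the compact \<open>K\<close> turns joint continuity into continuity
  in the parameter, uniform in \<open>x\<close>.\<close>

lemma jointly_cont_close:
  assumes g: "jointly_cont g" and p: "p \<in> topspace P" and e: "0 < e"
  shows "\<exists>N. openin P N \<and> p \<in> N \<and> (\<forall>q\<in>N. \<forall>x\<in>K. \<bar>g q x - g p x\<bar> < e)"
proof -
  define W where "W = {w \<in> topspace (prod_topology P (top_of_set K)). g (fst w) (snd w) - g p (snd w) \<in> ball 0 e}"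
  have c2: "continuous_map (prod_topology P (top_of_set K)) euclideanreal (\<lambda>w. g p (snd w))"
    using jointly_cont_x[OF g p] by (intro continuous_map_compose[OF continuous_map_snd, unfolded o_def]) simp
  have W: "openin (prod_topology P (top_of_set K)) W"
    unfolding W_def
    by (rule openin_continuous_map_preimage[OF continuous_map_diff[OF g[unfolded jointly_cont_def] c2]]) simp
  have W2: "{p} \<times> K \<subseteq> W" using p e by (auto simp: W_def)
  have W3: "compactin (top_of_set K) K" using compact_K by (simp add: compactin_subtopology)
  obtain U V where U: "openin P U" "p \<in> U" "K \<subseteq> V" "U \<times> V \<subseteq> W"
    using tube_lemma_right[OF W W3 p W2] by (elim exE conjE)
  have "\<bar>g q x - g p x\<bar> < e" if "q \<in> U" "x \<in> K" for q x
  proof -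
    have "(q, x) \<in> W" using U that by blast
    then show ?thesis by (simp add: W_def)
  qed
  then show ?thesis using U by blast
qed

lemma to_map_continuous:
  assumes G: "\<And>c k. enat k \<le> r \<Longrightarrow> Csr 0 k (G c)" and van: "vanishing G"
  shows "continuous_map P (Cr_bdry_topology r K) (to_map G)"
proof (rule continuous_map_Cr_bdryI)
  show X: "p \<in> topspace P \<Longrightarrow> to_map G p \<in> X r" for p by (rule to_map_in_X[OF G van])
  fix p k and e :: real assume p: "p \<in> topspace P" and k: "enat k \<le> r" and e: "0 < e"
  have "\<forall>c. \<exists>D. D [] = G c \<and> (\<forall>\<alpha>. length \<alpha> \<le> k \<longrightarrow> Csr 0 (k - length \<alpha>) (D \<alpha>)) \<and>
     (\<forall>\<alpha>. length \<alpha> < k \<longrightarrow> space_deriv (D \<alpha>) (\<lambda>i. D (\<alpha> @ [i])))" using Csr_jet[OF G[OF k]] by blast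
  then obtain D where D: "\<And>c. D c [] = G c" "\<And>c \<alpha>. length \<alpha> \<le> k \<Longrightarrow> Csr 0 (k - length \<alpha>) (D c \<alpha>)"
     "\<And>c \<alpha>. length \<alpha> < k \<Longrightarrow> space_deriv (D c \<alpha>) (\<lambda>i. D c (\<alpha> @ [i]))" by metis
  have Dc: "jointly_cont (D c \<alpha>)" if "length \<alpha> \<le> k" for c \<alpha> using D(2) Csr_jointly_cont that by blast
  note PDmk = to_map_PD(2)[of D, OF D(1) van Dc D(3)]
  \<comment> \<open>The deviations of the \<open>CARD('n)\<close> components add up to e/2, which
    leaves room for the strict inequality after taking the supremum.\<close>
  define e' where "e' = e / (2 * CARD('n))"
  have e': "e' > 0" using e by (simp add: e'_def)
  let ?I = "(UNIV :: 'n set) \<times> {\<alpha>::'n list. length \<alpha> \<le> k}"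
  have "\<forall>w\<in>?I. \<exists>N. openin P N \<and> p \<in> N \<and> (\<forall>q\<in>N. \<forall>x\<in>K. \<bar>D (fst w) (snd w) q x - D (fst w) (snd w) p x\<bar> < e')"
    using jointly_cont_close[OF Dc p e'] by auto
  from bchoice[OF this] obtain N where N': "\<forall>w\<in>?I. openin P (N w) \<and> p \<in> N w \<and>
      (\<forall>q\<in>N w. \<forall>x\<in>K. \<bar>D (fst w) (snd w) q x - D (fst w) (snd w) p x\<bar> < e')" ..
  have N: "openin P (N w)" "p \<in> N w"
    "\<And>q x. q \<in> N w \<Longrightarrow> x \<in> K \<Longrightarrow> \<bar>D (fst w) (snd w) q x - D (fst w) (snd w) p x\<bar> < e'"
    if "w \<in> ?I" for w using bspec[OF N' that] by simp_all
  have fin: "finite ?I"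
    using finite_lists_length_le[of "UNIV :: 'n set" k] by simp
  have "(undefined, []) \<in> ?I" by simp
  then have ne: "?I \<noteq> {}" by blast
  show "\<exists>N. openin P N \<and> p \<in> N \<and> (\<forall>q\<in>N. snorm k (to_map G q - to_map G p) < e)"
  proof (intro exI conjI ballI)
    show op: "openin P (\<Inter>(N ` ?I))" using fin ne N(1) by (intro openin_Inter) auto
    show "p \<in> \<Inter>(N ` ?I)" using N(2) by blast
    fix q assume q: "q \<in> \<Inter>(N ` ?I)"
    then have qP: "q \<in> topspace P" using openin_subset[OF op] by blast
    have "snorm k (to_map G q - to_map G p) \<le> e/2"
      unfolding snorm_le_iff[OF X_diff[OF X[OF qP] X[OF p]] k]
    proof (intro allI impI)
      fix \<alpha> :: "'n list" and x assume a: "length \<alpha> \<le> k" "x \<in> K"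
      have "PD K (to_map G q - to_map G p) \<alpha> x = (\<chi> c. D c \<alpha> q x - D c \<alpha> p x)"
        unfolding PD_diff[OF X[OF qP] X[OF p] enat_le_trans[OF a(1) k] a(2)]
        using PDmk[OF _ _ qP a] PDmk[OF _ _ p a] by (simp add: vec_eq_iff)
      also have "norm \<dots> \<le> (\<Sum>c\<in>UNIV. \<bar>D c \<alpha> q x - D c \<alpha> p x\<bar>)" by (rule norm_vec_le_sum)
      also have "\<dots> \<le> (\<Sum>c\<in>(UNIV::'n set). e')"
      proof (rule sum_mono)
        fix c
        have "(c, \<alpha>) \<in> ?I" using a by simp
        then have "q \<in> N (c, \<alpha>)" using q by blast
        then show "\<bar>D c \<alpha> q x - D c \<alpha> p x\<bar> \<le> e'" using N(3)[of "(c, \<alpha>)" q x] a by simp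
      qed
      also have "\<dots> = e/2" by (simp add: e'_def)
      finally show "norm (PD K (to_map G q - to_map G p) \<alpha> x) \<le> e/2" .
    qed
    then show "snorm k (to_map G q - to_map G p) < e" using e by simp
  qed
qed

text \<open>By the mean value inequality the difference quotient deviates from \<open>a p x\<close>
  by at most the oscillation of \<open>a\<close> along the flow, which
  \<open>jointly_cont_close\<close> bounds for all \<open>x\<close> at once.\<close>

lemma param_deriv_uniform:
  assumes u: "param_deriv j g a" and a: "jointly_cont a" and p: "p \<in> topspace P" and e: "0 < e"
  shows "\<forall>\<^sub>F t in at 0. \<forall>x\<in>K. \<bar>(1/t) * (g (fl j p t) x - g p x) - a p x\<bar> < e"
proof -
  obtain N where N: "openin P N" "p \<in> N" "\<And>q x. q \<in> N \<Longrightarrow> x \<in> K \<Longrightarrow> \<bar>a q x - a p x\<bar> < e/2"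
    using jointly_cont_close[OF a p, of "e/2"] e by auto
  obtain \<delta> where d: "\<delta> > 0" "continuous_map (top_of_set {-\<delta><..<\<delta>}) P (fl j p)" using fl_cont[OF p] by blast
  have "openin (top_of_set {-\<delta><..<\<delta>}) {t \<in> topspace (top_of_set {-\<delta><..<\<delta>}). fl j p t \<in> N}"
    by (rule openin_continuous_map_preimage[OF d(2) N(1)])
  then have "open {t \<in> {-\<delta><..<\<delta>}. fl j p t \<in> N}"
    by (simp add: openin_open_eq)
  moreover have "0 \<in> {t \<in> {-\<delta><..<\<delta>}. fl j p t \<in> N}" using d(1) N(2) p by (simp add: fl_0)
  ultimately obtain \<eta> where \<eta>: "\<eta> > 0" "ball 0 \<eta> \<subseteq> {t \<in> {-\<delta><..<\<delta>}. fl j p t \<in> N}"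
    unfolding open_contains_ball by blast
  have inN: "fl j p t \<in> N" if "\<bar>t\<bar> < \<eta>" for t using that \<eta>(2) by auto
  have inP: "fl j p t \<in> topspace P" if "\<bar>t\<bar> < \<eta>" for t using inN[OF that] openin_subset[OF N(1)] by blast
  have "\<bar>(1/t) * (g (fl j p t) x - g p x) - a p x\<bar> < e" if t: "t \<noteq> 0" "\<bar>t\<bar> < \<eta>" and x: "x \<in> K" for t x
  proof -
    let ?\<phi> = "\<lambda>s. g (fl j p s) x - s * a p x"
    have B1: "norm (?\<phi> t - ?\<phi> 0) \<le> (e/2) * norm (t - 0)"
    proof (rule differentiable_bound[where S="closed_segment 0 t" and f'="\<lambda>s h. h * (a (fl j p s) x - a p x)"])
      fix s assume "s \<in> closed_segment 0 t"
      then have s: "\<bar>s\<bar> < \<eta>" using t by (auto simp: closed_segment_eq_real_ivl split: if_splits)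
      have "((\<lambda>\<tau>. g (fl j (fl j p s) \<tau>) x) has_real_derivative a (fl j p s) x) (at 0)"
        using u inP[OF s] x by (simp add: param_deriv_def)
      \<comment> \<open>By the flow law, the derivative at time 0 starting from
        \<open>fl j p s\<close> is the derivative at time \<open>s\<close> starting from
        \<open>p\<close>.\<close>
      then have "((\<lambda>\<tau>. g (fl j p (\<tau> + s)) x) has_real_derivative a (fl j p s) x) (at 0)"
        by (simp add: fl_add[OF p] add.commute)
      then have "((\<lambda>\<tau>. g (fl j p \<tau>) x) has_real_derivative a (fl j p s) x) (at (0 + s))"
        by (simp only: DERIV_shift)
      then have "(?\<phi> has_real_derivative a (fl j p s) x - a p x) (at s)"
        by (auto intro!: derivative_eq_intros)
      then have "(?\<phi> has_derivative (\<lambda>h. h * (a (fl j p s) x - a p x))) (at s)"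
        unfolding has_field_derivative_def by (rule has_derivative_eq_rhs) (simp add: fun_eq_iff)
      then show "(?\<phi> has_derivative (\<lambda>h. h * (a (fl j p s) x - a p x))) (at s within closed_segment 0 t)"
        by (rule has_derivative_at_withinI)
      have ab: "\<bar>a (fl j p s) x - a p x\<bar> \<le> e/2" using N(3)[OF inN[OF s] x] by simp
      show "onorm (\<lambda>h. h * (a (fl j p s) x - a p x)) \<le> e/2"
      proof (rule onorm_le)
        fix h :: real
        have "norm (h * (a (fl j p s) x - a p x)) = \<bar>a (fl j p s) x - a p x\<bar> * \<bar>h\<bar>"
          by (simp add: abs_mult mult.commute)
        also have "\<dots> \<le> e/2 * norm h" using mult_right_mono[OF ab, of "\<bar>h\<bar>"] by simp
        finally show "norm (h * (a (fl j p s) x - a p x)) \<le> e/2 * norm h" .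
      qed
    qed auto
    have E1: "?\<phi> t - ?\<phi> 0 = g (fl j p t) x - g p x - t * a p x" using p by (simp add: fl_0)
    have "\<bar>g (fl j p t) x - g p x - t * a p x\<bar> \<le> (e/2) * \<bar>t\<bar>"
      using B1[unfolded E1] by (simp only: real_norm_def diff_zero)
    moreover have "\<bar>(1/t) * (g (fl j p t) x - g p x) - a p x\<bar> = \<bar>g (fl j p t) x - g p x - t * a p x\<bar> / \<bar>t\<bar>"
      using t(1) by (simp add: abs_divide[symmetric] diff_divide_distrib)
    ultimately have "\<bar>(1/t) * (g (fl j p t) x - g p x) - a p x\<bar> \<le> e/2"
      using t(1) by (simp add: pos_divide_le_eq)
    then show ?thesis using e by simp
  qed
  then show ?thesis
    unfolding eventually_at using \<eta>(1) by (intro exI[of _ \<eta>]) (auto simp: dist_real_def)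
qed

lemma vanishing_param_deriv:
  assumes "vanishing G" and u: "\<And>c. param_deriv j (G c) (G' c)"
  shows "vanishing G'"
  unfolding vanishing_def
proof (intro allI ballI)
  fix c p x assume p: "p \<in> topspace P" and x: "x \<in> K - interior K"
  have ev: "\<forall>\<^sub>F t in nhds 0. G c (fl j p t) x = 0"
    using fl_in[OF p] by (rule eventually_mono) (use assms(1) x in \<open>auto simp: vanishing_def\<close>)
  have "((\<lambda>t. G c (fl j p t) x) has_real_derivative G' c p x) (at 0)"
    using u[of c] p x by (simp add: param_deriv_def)
  from iffD1[OF DERIV_cong_ev[OF refl ev refl] this] show "G' c p x = 0"
    using DERIV_unique DERIV_const by blast
qed

text \<open>A derivative in the function space requires convergence in every C^k-norm. Each space
  derivative of the difference quotients converges uniformly to the parameter derivative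
  \<open>E\<close> of that space derivative; what remains is that \<open>E\<close> is the jet of the
  limit.\<close>

lemma to_map_dir_deriv:
  assumes G: "\<And>c k. enat k \<le> r \<Longrightarrow> Csr 1 k (G c)" and van: "vanishing G"
    and u: "\<And>c. param_deriv j (G c) (G' c)" and p: "p \<in> topspace P"
  shows "limitin (Cr_bdry_topology r K) (\<lambda>t. (1/t) *\<^sub>R (to_map G (fl j p t) - to_map G p)) (to_map G' p) (at 0)"
proof (rule limitin_Cr_bdryI)
  have X: "to_map G q \<in> X r" if "q \<in> topspace P" for q
    by (rule to_map_in_X[OF Csr_mono[OF G] van that]) auto
  have G'S: "Csr 0 k (G' c)" if k: "enat k \<le> r" for k c
  proof -
    obtain h where h: "param_deriv j (G c) h" "Csr 0 k h" using Csr_param_deriv[of 0 k "G c" j] G[OF k, of c] by auto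
    show ?thesis by (rule Csr_cong[OF _ h(2)]) (use param_deriv_unique[OF h(1) u] in auto)
  qed
  note van' = vanishing_param_deriv[OF van u]
  show X': "to_map G' p \<in> X r" by (rule to_map_in_X[OF G'S van' p])
  have ev: "\<forall>\<^sub>F t in at 0. fl j p t \<in> topspace P"
    using fl_in[OF p, of j] unfolding eventually_at_filter by (rule eventually_mono) simp
  then show "\<forall>\<^sub>F t in at 0. (1/t) *\<^sub>R (to_map G (fl j p t) - to_map G p) \<in> X r"
    by (rule eventually_mono) (intro X_scale X_diff X p)
  fix k and e :: real assume k: "enat k \<le> r" and e: "0 < e"
  have "\<forall>c. \<exists>D. D [] = G c \<and> (\<forall>\<alpha>. length \<alpha> \<le> k \<longrightarrow> Csr 1 (k - length \<alpha>) (D \<alpha>)) \<and>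
     (\<forall>\<alpha>. length \<alpha> < k \<longrightarrow> space_deriv (D \<alpha>) (\<lambda>i. D (\<alpha> @ [i])))" using Csr_jet[OF G[OF k]] by blast
  then obtain D where D: "\<And>c. D c [] = G c" "\<And>c \<alpha>. length \<alpha> \<le> k \<Longrightarrow> Csr 1 (k - length \<alpha>) (D c \<alpha>)"
     "\<And>c \<alpha>. length \<alpha> < k \<Longrightarrow> space_deriv (D c \<alpha>) (\<lambda>i. D c (\<alpha> @ [i]))" by metis
  have Dc: "jointly_cont (D c \<alpha>)" if "length \<alpha> \<le> k" for c \<alpha> using D(2) Csr_jointly_cont that by blast
  note PDmk = to_map_PD(2)[of D, OF D(1) van Dc D(3)]
  \<comment> \<open>The functions \<open>E c \<alpha>\<close> are chosen separately for each word;
    that they fit together as a jet is the content of \<open>jE\<close>.\<close>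
  have "\<forall>c \<alpha>. \<exists>E. length \<alpha> \<le> k \<longrightarrow> param_deriv j (D c \<alpha>) E \<and> jointly_cont E"
    using Csr_param_deriv[of 0 _ _ j] D(2) Csr_jointly_cont by (metis One_nat_def)
  then obtain E where E: "\<And>c \<alpha>. length \<alpha> \<le> k \<Longrightarrow> param_deriv j (D c \<alpha>) (E c \<alpha>)"
    "\<And>c \<alpha>. length \<alpha> \<le> k \<Longrightarrow> jointly_cont (E c \<alpha>)" by metis
  let ?I = "(UNIV :: 'n set) \<times> {\<alpha>::'n list. length \<alpha> \<le> k}"
  have fin: "finite ?I"
    using finite_lists_length_le[of "UNIV :: 'n set" k] by simp
  define q where "q t \<alpha> x = (1/t) *\<^sub>R ((\<chi> c. D c \<alpha> (fl j p t) x) - (\<chi> c. D c \<alpha> p x))" for t \<alpha> x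
  have unif: "\<forall>\<^sub>F t in at 0. \<forall>\<alpha>. length \<alpha> \<le> k \<longrightarrow> (\<forall>x\<in>K. norm (q t \<alpha> x - (\<chi> c. E c \<alpha> p x)) \<le> e/2)"
    if e: "0 < e" for e :: real
  proof -
    define e' where "e' = e / (2 * CARD('n))"
    have e': "e' > 0" using e by (simp add: e'_def)
    have "\<forall>\<^sub>F t in at 0. \<forall>w\<in>?I. \<forall>x\<in>K. \<bar>(1/t) * (D (fst w) (snd w) (fl j p t) x - D (fst w) (snd w) p x) - E (fst w) (snd w) p x\<bar> < e'"
      by (intro eventually_ball_finite[OF fin] ballI param_deriv_uniform[OF E p e']) auto
    then show ?thesis
    proof (rule eventually_mono, intro allI impI ballI)
      fix t :: real and \<alpha> :: "'n list" and x
      assume *: "\<forall>w\<in>?I. \<forall>x\<in>K. \<bar>(1/t) * (D (fst w) (snd w) (fl j p t) x - D (fst w) (snd w) p x) - E (fst w) (snd w) p x\<bar> < e'"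
        and a: "length \<alpha> \<le> k" "x \<in> K"
      have "q t \<alpha> x - (\<chi> c. E c \<alpha> p x) = (\<chi> c. (1/t) * (D c \<alpha> (fl j p t) x - D c \<alpha> p x) - E c \<alpha> p x)"
        by (simp add: q_def vec_eq_iff)
      also have "norm \<dots> \<le> (\<Sum>c\<in>UNIV. \<bar>(1/t) * (D c \<alpha> (fl j p t) x - D c \<alpha> p x) - E c \<alpha> p x\<bar>)"
        by (rule norm_vec_le_sum)
      also have "\<dots> \<le> (\<Sum>c\<in>(UNIV::'n set). e')"
        using * a by (intro sum_mono) (force intro: less_imp_le)
      also have "\<dots> = e/2" by (simp add: e'_def)
      finally show "norm (q t \<alpha> x - (\<chi> c. E c \<alpha> p x)) \<le> e/2" .
    qed
  qed
  have jq: "jet K (enat k) (q t)" if "fl j p t \<in> topspace P" for t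
  proof -
    have "jet K (enat k) (\<lambda>\<alpha> x. (1/t) *\<^sub>R ((\<chi> c. D c \<alpha> (fl j p t) x) + (-1) *\<^sub>R (\<chi> c. D c \<alpha> p x) :: real^'n))"
      by (intro jet_scale jet_add jet_components Dc D(3) that p)
    then show ?thesis by (rule jet_cong) (simp add: q_def)
  qed
  \<comment> \<open>Interchange of derivatives: the jets of the difference quotients converge uniformly.\<close>
  have jE: "jet K (enat k) (\<lambda>\<alpha> x. (\<chi> c. E c \<alpha> p x) :: real^'n)"
  proof -
    obtain \<delta> where d: "\<delta> > 0" "\<And>t. t \<noteq> 0 \<Longrightarrow> \<bar>t\<bar> < \<delta> \<Longrightarrow> fl j p t \<in> topspace P"
      using ev unfolding eventually_at by (auto simp: dist_real_def)
    \<comment> \<open>With n + 2 in the denominator the strict bound by \<delta> holds from n = 0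
      on.\<close>
    define \<tau> where "\<tau> n = \<delta> / real (n + 2)" for n
    have \<tau>: "\<tau> n \<noteq> 0" "\<bar>\<tau> n\<bar> < \<delta>" for n using d(1) by (auto simp: \<tau>_def field_simps intro: add_pos_nonneg)
    have "\<tau> \<longlonglongrightarrow> 0"
      unfolding \<tau>_def by (rule LIMSEQ_ignore_initial_segment[OF lim_const_over_n])
    then have \<tau>0: "filterlim \<tau> (at 0) sequentially" using \<tau>(1) by (simp add: filterlim_at)
    show ?thesis
    proof (rule jet_uniform_limit[OF convex_K, where D'="\<lambda>n. q (\<tau> n)"])
      show "jet K (enat k) (q (\<tau> n))" for n by (rule jq) (use \<tau> d in auto)
      fix \<alpha> :: "'n list" assume a: "enat (length \<alpha>) \<le> enat k"
      show "uniform_limit K (\<lambda>n. q (\<tau> n) \<alpha>) (\<lambda>x. \<chi> c. E c \<alpha> p x) sequentially"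
        unfolding uniform_limit_iff
      proof (intro allI impI)
        fix e :: real assume e: "0 < e"
        show "\<forall>\<^sub>F n in sequentially. \<forall>x\<in>K. dist (q (\<tau> n) \<alpha> x) (\<chi> c. E c \<alpha> p x) < e"
          using filterlim_iff[THEN iffD1, OF \<tau>0, rule_format, OF unif[OF e]]
        proof (rule eventually_mono, intro ballI)
          fix n x assume *: "\<forall>\<alpha>. length \<alpha> \<le> k \<longrightarrow> (\<forall>x\<in>K. norm (q (\<tau> n) \<alpha> x - (\<chi> c. E c \<alpha> p x)) \<le> e/2)" and x: "x \<in> K"
          have "norm (q (\<tau> n) \<alpha> x - (\<chi> c. E c \<alpha> p x)) \<le> e/2" using * x a by simp
          then show "dist (q (\<tau> n) \<alpha> x) (\<chi> c. E c \<alpha> p x) < e" using e by (simp add: dist_norm)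
        qed
      qed
    qed
  qed
  have PDE: "PD K (to_map G' p) \<alpha> x = (\<chi> c. E c \<alpha> p x)" if "length \<alpha> \<le> k" "x \<in> K" for \<alpha> x
  proof (rule PD_eq[OF jE])
    fix x assume x: "x \<in> K"
    have "E c [] p x = G' c p x" for c
      using param_deriv_unique[OF E(1)[of "[]" c] _ p x] u[of c] by (simp add: D(1))
    then show "to_map G' p x = (\<chi> c. E c [] p x)"
      using x van' p by (auto simp: to_map_def vanishing_def vec_eq_iff)
  qed (use that in auto)
  from eventually_conj[OF ev unif[OF e]]
  show "\<forall>\<^sub>F t in at 0. snorm k ((1/t) *\<^sub>R (to_map G (fl j p t) - to_map G p) - to_map G' p) < e"
  proof (rule eventually_mono)
    fix t assume t: "fl j p t \<in> topspace P \<and>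
      (\<forall>\<alpha>. length \<alpha> \<le> k \<longrightarrow> (\<forall>x\<in>K. norm (q t \<alpha> x - (\<chi> c. E c \<alpha> p x)) \<le> e/2))"
    then have tP: "fl j p t \<in> topspace P" by blast
    note dX = X_diff[OF X[OF tP] X[OF p]]
    have "snorm k ((1/t) *\<^sub>R (to_map G (fl j p t) - to_map G p) - to_map G' p) \<le> e/2"
      unfolding snorm_le_iff[OF X_diff[OF X_scale[OF dX] X'] k]
    proof (intro allI impI)
      fix \<alpha> :: "'n list" and x assume a: "length \<alpha> \<le> k" "x \<in> K"
      note a' = enat_le_trans[OF a(1) k] a(2)
      have "PD K ((1/t) *\<^sub>R (to_map G (fl j p t) - to_map G p) - to_map G' p) \<alpha> x = q t \<alpha> x - (\<chi> c. E c \<alpha> p x)"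
        unfolding PD_diff[OF X_scale[OF dX] X' a'] PD_scale[OF dX a'] PD_diff[OF X[OF tP] X[OF p] a'] q_def PDE[OF a]
        using PDmk[OF _ _ tP a] PDmk[OF _ _ p a] by simp
      then show "norm (PD K ((1/t) *\<^sub>R (to_map G (fl j p t) - to_map G p) - to_map G' p) \<alpha> x) \<le> e/2"
        using t a by simp
    qed
    then show "snorm k ((1/t) *\<^sub>R (to_map G (fl j p t) - to_map G p) - to_map G' p) < e" using e by simp
  qed
qed

end

section \<open>Maps from an open set of parameters into the space of C^r-maps\<close>

locale open_calculus = convex_body K for K :: "(real^'n) set" +
  fixes T :: "'e::real_vector topology" and U :: "'e set"
  assumes subspace_T: "subspace (topspace T)"
    and add_T: "continuous_map (prod_topology T T) T (\<lambda>(x, y). x + y)"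
    and scale_T: "continuous_map (prod_topology euclideanreal T) T (\<lambda>(c, x). c *\<^sub>R x)"
    and open_U: "openin T U"
begin

definition Pt :: "('e \<times> (nat \<Rightarrow> 'e)) topology" where
  "Pt = prod_topology (subtopology T U) (product_topology (\<lambda>_. T) UNIV)"

definition flow :: "nat \<Rightarrow> 'e \<times> (nat \<Rightarrow> 'e) \<Rightarrow> real \<Rightarrow> 'e \<times> (nat \<Rightarrow> 'e)" where
  "flow j p t = (fst p + t *\<^sub>R snd p j, snd p)"

lemma topspace_Pt: "topspace Pt = U \<times> {y. \<forall>i. y i \<in> topspace T}"
  using openin_subset[OF open_U] by (auto simp: Pt_def PiE_def Pi_def)

lemma continuous_line:
  assumes "u \<in> topspace T" "v \<in> topspace T"
  shows "continuous_map euclideanreal T (\<lambda>t. u + t *\<^sub>R v)"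
proof -
  have "continuous_map euclideanreal (prod_topology euclideanreal T) (\<lambda>t. (t, v))"
    using assms by (intro continuous_map_pairedI) auto
  from continuous_map_compose[OF this scale_T] have "continuous_map euclideanreal T (\<lambda>t. t *\<^sub>R v)"
    by (simp add: o_def)
  then have "continuous_map euclideanreal (prod_topology T T) (\<lambda>t. (u, t *\<^sub>R v))"
    using assms by (intro continuous_map_pairedI) auto
  from continuous_map_compose[OF this add_T] show ?thesis by (simp add: o_def)
qed

lemma flow_nbhd:
  assumes u: "u \<in> U" and v: "v \<in> topspace T"
  obtains \<delta> where "\<delta> > 0" "\<And>t. \<bar>t\<bar> < \<delta> \<Longrightarrow> u + t *\<^sub>R v \<in> U"
proof -
  have uT: "u \<in> topspace T" using u openin_subset[OF open_U] by blast
  have "openin euclideanreal {t \<in> topspace euclideanreal. u + t *\<^sub>R v \<in> U}"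
    by (rule openin_continuous_map_preimage[OF continuous_line[OF uT v] open_U])
  then have "open {t. u + t *\<^sub>R v \<in> U}" by simp
  moreover have "0 \<in> {t. u + t *\<^sub>R v \<in> U}" using u by simp
  ultimately obtain \<delta> where "\<delta> > 0" "ball 0 \<delta> \<subseteq> {t. u + t *\<^sub>R v \<in> U}"
    unfolding open_contains_ball by blast
  then show ?thesis by (intro that) auto
qed

sublocale param_calculus K Pt flow
proof
  show "flow j p 0 = p" for p j by (simp add: flow_def)
  show "flow j (flow j p t) s = flow j p (t + s)" for j p t s
    by (simp add: flow_def scaleR_add_left)
  fix p j assume p: "p \<in> topspace Pt"
  then have u: "fst p \<in> U" and y: "snd p i \<in> topspace T" for i by (auto simp: topspace_Pt)
  obtain \<delta> where d: "\<delta> > 0" "\<And>t. \<bar>t\<bar> < \<delta> \<Longrightarrow> fst p + t *\<^sub>R snd p j \<in> U"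
    using flow_nbhd[OF u y[of j]] by blast
  have "continuous_map (top_of_set {-\<delta><..<\<delta>}) Pt (flow j p)"
    unfolding Pt_def flow_def
  proof (intro continuous_map_pairedI continuous_map_into_subtopology)
    show "continuous_map (top_of_set {-\<delta><..<\<delta>}) T (\<lambda>t. fst p + t *\<^sub>R snd p j)"
      using continuous_line u y openin_subset[OF open_U] by (intro continuous_map_from_subtopology) blast
    show "continuous_map (top_of_set {-\<delta><..<\<delta>}) (product_topology (\<lambda>_. T) UNIV) (\<lambda>t. snd p)"
      using y by auto
  qed (use d(2) in auto)
  then show "\<exists>\<delta>>0. continuous_map (top_of_set {-\<delta><..<\<delta>}) Pt (flow j p)" using d(1) by blast
qed

text \<open>Step \<open>k\<close> differentiates along direction \<open>k\<close>, as in
  \<open>iter_dir_deriv\<close>. The arbitrary choice is harmless because parameter derivatives are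
  unique on the parameter space times \<open>K\<close>.\<close>

primrec iter_param_deriv :: "('n \<Rightarrow> 'e \<times> (nat \<Rightarrow> 'e) \<Rightarrow> real^'n \<Rightarrow> real) \<Rightarrow> nat
    \<Rightarrow> 'n \<Rightarrow> 'e \<times> (nat \<Rightarrow> 'e) \<Rightarrow> real^'n \<Rightarrow> real" where
  "iter_param_deriv G 0 = G"
| "iter_param_deriv G (Suc k) = (\<lambda>c. SOME g'. param_deriv k (iter_param_deriv G k c) g')"

lemma iter_param_deriv_step:
  assumes "Csr (Suc s) r (iter_param_deriv G k c)"
  shows "param_deriv k (iter_param_deriv G k c) (iter_param_deriv G (Suc k) c)" "Csr s r (iter_param_deriv G (Suc k) c)"
proof -
  obtain g' where g': "param_deriv k (iter_param_deriv G k c) g'" "Csr s r g'" using Csr_param_deriv[OF assms] by blast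
  show u: "param_deriv k (iter_param_deriv G k c) (iter_param_deriv G (Suc k) c)"
    using someI[of "param_deriv k (iter_param_deriv G k c)", OF g'(1)] by simp
  show "Csr s r (iter_param_deriv G (Suc k) c)"
    by (rule Csr_cong[OF _ g'(2)]) (rule param_deriv_unique[OF g'(1) u])
qed

lemma iter_param_deriv_Csr:
  assumes G: "\<And>c s' r'. enat s' \<le> s \<Longrightarrow> enat r' \<le> r \<Longrightarrow> Csr s' r' (G c)" and r: "enat r' \<le> r"
  shows "enat (s' + k) \<le> s \<Longrightarrow> Csr s' r' (iter_param_deriv G k c)"
proof (induction k arbitrary: s')
  case 0
  then show ?case using G r by simp
next
  case (Suc k)
  then show ?case by (intro iter_param_deriv_step(2)) simp
qed

text \<open>The bridge from real-valued families to differentiability in the function space: the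
  iterated directional derivatives of \<open>f\<close> are the maps built from
  \<open>iter_param_deriv\<close>. They exist by \<open>to_map_dir_deriv\<close> and are continuous
  by \<open>to_map_continuous\<close>.\<close>

theorem Cr_on_open_to_map:
  assumes G: "\<And>c s' r'. enat s' \<le> s \<Longrightarrow> enat r' \<le> r \<Longrightarrow> Csr s' r' (G c)" and van: "vanishing G"
    and f: "\<And>u y. (u, y) \<in> topspace Pt \<Longrightarrow> f u = to_map G (u, y)"
  shows "Cr_on_open T (Cr_bdry_topology r K) s U f"
proof -
  let ?F = "Cr_bdry_topology r K"
  have 0: "enat 0 \<le> s" "enat 0 \<le> r" by (simp_all add: zero_enat_def[symmetric])
  have T0: "0 \<in> topspace T" using subspace_T subspace_0 by blast
  have van_k: "vanishing (iter_param_deriv G k)" if "enat k \<le> s" for k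
    using that
  proof (induction k)
    case (Suc k)
    have "enat k \<le> s" using Suc.prems by (rule enat_le_trans[rotated]) simp
    moreover have "param_deriv k (iter_param_deriv G k c) (iter_param_deriv G (Suc k) c)" for c
      by (rule iter_param_deriv_step(1)[of 0 0]) (rule iter_param_deriv_Csr[OF G 0(2)], use Suc.prems in auto)
    ultimately show ?case using vanishing_param_deriv[OF Suc.IH] by blast
  qed (simp add: van)
  have dd: "has_dir_deriv ?F h (Y k) u (to_map (iter_param_deriv G (Suc k)) (u, Y))"
    if k: "enat (Suc k) \<le> s" and p: "(u, Y) \<in> topspace Pt"
      and h: "\<And>u. u \<in> U \<Longrightarrow> h u = to_map (iter_param_deriv G k) (u, Y)" for k u Y and h :: "'e \<Rightarrow> real^'n \<Rightarrow> real^'n"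
  proof -
    have k': "enat k \<le> s" using k by (rule enat_le_trans[rotated]) simp
    have lim: "limitin ?F (\<lambda>t. (1/t) *\<^sub>R (to_map (iter_param_deriv G k) (flow k (u, Y) t) - to_map (iter_param_deriv G k) (u, Y)))
        (to_map (iter_param_deriv G (Suc k)) (u, Y)) (at 0)"
    proof (rule to_map_dir_deriv[OF _ van_k[OF k'] _ p])
      show "Csr 1 r' (iter_param_deriv G k c)" if "enat r' \<le> r" for r' c
        by (rule iter_param_deriv_Csr[OF G that]) (use k in auto)
      show "param_deriv k (iter_param_deriv G k c) (iter_param_deriv G (Suc k) c)" for c
        by (rule iter_param_deriv_step(1)[of 0 0]) (rule iter_param_deriv_Csr[OF G 0(2)], use k in auto)
    qed
    have u: "u \<in> U" and v: "Y k \<in> topspace T" using p by (auto simp: topspace_Pt)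
    obtain \<delta> where d: "\<delta> > 0" "\<And>t. \<bar>t\<bar> < \<delta> \<Longrightarrow> u + t *\<^sub>R Y k \<in> U"
      using flow_nbhd[OF u v] by blast
    show ?thesis
      unfolding has_dir_deriv_def
    proof (rule limitin_transform_eventually[OF _ lim])
      show "\<forall>\<^sub>F t in at 0. (1/t) *\<^sub>R (to_map (iter_param_deriv G k) (flow k (u, Y) t) - to_map (iter_param_deriv G k) (u, Y))
          = (1/t) *\<^sub>R (h (u + t *\<^sub>R Y k) - h u)"
        unfolding eventually_at using d by (intro exI[of _ \<delta>]) (auto simp: flow_def h u dist_real_def)
    qed
  qed
  have ddI: "dir_deriv ?F h v u = l" if "has_dir_deriv ?F h v u l" for h :: "'e \<Rightarrow> real^'n \<Rightarrow> real^'n" and v u l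
    unfolding dir_deriv_def
  proof (rule the_equality, rule that)
    fix l' assume l': "has_dir_deriv ?F h v u l'"
    show "l' = l"
      by (rule limitin_Hausdorff_unique[OF l'[unfolded has_dir_deriv_def] that[unfolded has_dir_deriv_def]
            _ Hausdorff_Cr_bdry]) simp
  qed
  \<comment> \<open>\<open>Y\<close> has to be a full sequence in the space of directions to form a
    parameter, whereas \<open>y\<close> is only meaningful up to \<open>k\<close>; hence agreement
    is asked on that range.\<close>
  have iter: "iter_dir_deriv ?F f k y u = to_map (iter_param_deriv G k) (u, Y)"
    if "enat k \<le> s" "(u, Y) \<in> topspace Pt" "\<And>i. i < k \<Longrightarrow> Y i = y i" for k y u Y
    using that
  proof (induction k arbitrary: u)
    case 0
    then show ?case using f by simp
  next
    case (Suc k)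
    have k: "enat k \<le> s" using Suc.prems(1) by (rule enat_le_trans[rotated]) simp
    have "has_dir_deriv ?F (iter_dir_deriv ?F f k y) (Y k) u (to_map (iter_param_deriv G (Suc k)) (u, Y))"
    proof (rule dd[OF Suc.prems(1,2)])
      fix u' assume "u' \<in> U"
      then have "(u', Y) \<in> topspace Pt" using Suc.prems(2) by (simp add: topspace_Pt)
      then show "iter_dir_deriv ?F f k y u' = to_map (iter_param_deriv G k) (u', Y)"
        using Suc.IH[OF k] Suc.prems(3) by simp
    qed
    then show ?case using ddI Suc.prems(3)[of k] by simp
  qed
  \<comment> \<open>Padding with 0 makes a parameter out of a finite family of directions, that is,
    out of a point in the domain of the k-th derivative.\<close>
  define ext where "ext k y = (\<lambda>i. if i < k then y i else 0)" for k and y :: "nat \<Rightarrow> 'e"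
  have extP: "(u, ext k y) \<in> topspace Pt" if "u \<in> U" "y \<in> topspace (power_topology T k)" for u y k
    using that T0 by (auto simp: topspace_Pt ext_def power_topology_def PiE_iff)
  have "continuous_map (deriv_dom T U k) ?F (\<lambda>(x, y). iter_dir_deriv ?F f k y x)" if k: "enat k \<le> s" for k
  proof -
    have "continuous_map (deriv_dom T U k) Pt (\<lambda>p. (fst p, ext k (snd p)))"
      unfolding Pt_def deriv_dom_def
    proof (intro continuous_map_pairedI continuous_map_fst)
      show "continuous_map (prod_topology (subtopology T U) (power_topology T k)) (product_topology (\<lambda>_. T) UNIV)
         (\<lambda>p. ext k (snd p))"
        unfolding continuous_map_componentwise_UNIV
      proof
        fix i
        show "continuous_map (prod_topology (subtopology T U) (power_topology T k)) T (\<lambda>p. ext k (snd p) i)"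
        proof (cases "i < k")
          case True
          then show ?thesis
            unfolding ext_def power_topology_def
            using continuous_map_compose[OF continuous_map_snd continuous_map_product_projection[of i "{..<k}" "\<lambda>_. T"]]
            by (auto simp: o_def)
        qed (use T0 in \<open>simp add: ext_def\<close>)
      qed
    qed
    from continuous_map_compose[OF this to_map_continuous[OF iter_param_deriv_Csr[OF G] van_k[OF k]]]
    have "continuous_map (deriv_dom T U k) ?F (\<lambda>p. to_map (iter_param_deriv G k) (fst p, ext k (snd p)))"
      using k by (simp add: o_def)
    then show ?thesis
    proof (rule continuous_map_eq)
      fix p assume p: "p \<in> topspace (deriv_dom T U k)"
      then have "(fst p, ext k (snd p)) \<in> topspace Pt" by (intro extP) (auto simp: deriv_dom_def)
      from iter[OF k this, of "snd p"]
      show "to_map (iter_param_deriv G k) (fst p, ext k (snd p)) = (case p of (x, y) \<Rightarrow> iter_dir_deriv ?F f k y x)"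
        by (simp add: case_prod_unfold ext_def)
    qed
  qed
  moreover have "\<exists>l. has_dir_deriv ?F (iter_dir_deriv ?F f k y) (y k) x l"
    if k: "enat (Suc k) \<le> s" and x: "x \<in> U" and y: "y \<in> topspace (power_topology T (Suc k))" for k x y
  proof -
    have k': "enat k \<le> s" using k by (rule enat_le_trans[rotated]) simp
    have P: "(u, ext (Suc k) y) \<in> topspace Pt" if "u \<in> U" for u using extP[OF that y] .
    have "has_dir_deriv ?F (iter_dir_deriv ?F f k y) (ext (Suc k) y k) x (to_map (iter_param_deriv G (Suc k)) (x, ext (Suc k) y))"
      by (rule dd[OF k P[OF x]]) (rule iter[OF k' P], auto simp: ext_def)
    then show ?thesis by (auto simp: ext_def)
  qed
  moreover have "continuous_map (subtopology T U) ?F f"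
  proof -
    \<comment> \<open>\<open>f\<close> equals \<open>to_map G\<close> for every choice of
      directions; the constant 0 is a continuous choice.\<close>
    have "continuous_map (subtopology T U) Pt (\<lambda>u. (u, \<lambda>_. 0))"
      unfolding Pt_def using T0 by (intro continuous_map_pairedI) auto
    from continuous_map_compose[OF this to_map_continuous[OF G[OF 0(1)] van]]
    have "continuous_map (subtopology T U) ?F (\<lambda>u. to_map G (u, \<lambda>_. 0))" by (simp add: o_def)
    then show ?thesis
    proof (rule continuous_map_eq)
      fix u assume "u \<in> topspace (subtopology T U)"
      then have "(u, \<lambda>_. 0) \<in> topspace Pt" using T0 by (auto simp: topspace_Pt)
      from f[OF this] show "to_map G (u, \<lambda>_. 0) = f u" by simp
    qed
  qed
  ultimately show ?thesis unfolding Cr_on_open_def using open_U by blast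
qed

context
  fixes L :: "'e \<Rightarrow> real^'n \<Rightarrow> real^'n" and m :: enat
  assumes L: "continuous_map T (Cr_bdry_topology m K) L"
    and L_add: "\<And>u v t. u \<in> topspace T \<Longrightarrow> v \<in> topspace T \<Longrightarrow> L (u + t *\<^sub>R v) = L u + t *\<^sub>R L v"
begin

lemma continuous_L_fst: "continuous_map Pt (Cr_bdry_topology m K) (\<lambda>p. L (fst p))"
proof -
  have "continuous_map Pt T fst"
    unfolding Pt_def using continuous_map_fst continuous_map_in_subtopology by blast
  from continuous_map_compose[OF this L] show ?thesis by (simp add: o_def)
qed

lemma L_X: "p \<in> topspace Pt \<Longrightarrow> L (fst p) \<in> X m"
  using continuous_L_fst by (auto simp: continuous_map_def)

text \<open>Linearity makes \<open>L (fst p)\<close> affine along the flow with slope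
  \<open>L (snd p j)\<close>, as \<open>Csr_atom\<close> wants. In the applications \<open>L\<close>
  is the identity or a projection from a product.\<close>

lemma S_PD_linear:
  assumes "enat (length \<alpha> + k) \<le> m"
  shows "Csr s k (\<lambda>p x. PD K (L (fst p)) \<alpha> x $ c)"
proof (rule Csr_atom[OF continuous_L_fst _ _ _ assms])
  show "continuous_map Pt (Cr_bdry_topology m K) (\<lambda>p. L (snd p j))" for j
  proof -
    have "continuous_map Pt T (\<lambda>p. snd p j)"
      unfolding Pt_def
      using continuous_map_compose[OF continuous_map_snd continuous_map_product_projection[of j UNIV "\<lambda>_. T"]]
      by (simp add: o_def)
    from continuous_map_compose[OF this L] show ?thesis by (simp add: o_def)
  qed
  show "L (snd (flow j' p t) j) = L (snd p j)" for j j' p t by (simp add: flow_def)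
  show "L (fst (flow j p t)) = L (fst p) + t *\<^sub>R L (snd p j)" if "p \<in> topspace Pt" for j p t
    using that openin_subset[OF open_U] by (auto simp: flow_def topspace_Pt intro!: L_add)
qed

lemma Csr_eval_linear:
  assumes "enat k \<le> m"
  shows "Csr s k (\<lambda>p x. L (fst p) x $ c)"
  by (rule Csr_cong[OF _ S_PD_linear[of "[]" k s c]]) (use assms in \<open>auto simp: PD_Nil[OF L_X]\<close>)

end

end

section \<open>Boundary-fixing diffeomorphisms\<close>

context convex_body begin

definition shift :: "(real^'n \<Rightarrow> real^'n) \<Rightarrow> real^'n \<Rightarrow> real^'n" where
  "shift \<gamma> x = x + \<gamma> x"

text \<open>Being built from \<open>PD\<close>, it has values on the boundary of \<open>K\<close>
  too; for \<gamma> of order at least 1 it is continuous on \<open>K\<close> and represents the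
  derivative of \<open>shift \<gamma>\<close> inside.\<close>

definition jacobian :: "(real^'n \<Rightarrow> real^'n) \<Rightarrow> real^'n \<Rightarrow> real^'n^'n" where
  "jacobian \<gamma> x = (\<chi> l i. (if l = i then 1 else 0) + PD K \<gamma> [i] x $ l)"

text \<open>The image of the chart, described without reference to the inverse map.\<close>

definition Diff_domain :: "enat \<Rightarrow> (real^'n \<Rightarrow> real^'n) set" where
  "Diff_domain r = {\<gamma> \<in> X r. bij (shift \<gamma>) \<and> (\<forall>x\<in>K. det (jacobian \<gamma> x) \<noteq> 0)}"

lemma Diff_domain_X: "\<gamma> \<in> Diff_domain r \<Longrightarrow> \<gamma> \<in> X r" and Diff_domain_bij: "\<gamma> \<in> Diff_domain r \<Longrightarrow> bij (shift \<gamma>)"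
  by (simp_all add: Diff_domain_def)

lemma shift_outside: "\<gamma> \<in> X r \<Longrightarrow> x \<notin> interior K \<Longrightarrow> shift \<gamma> x = x"
  by (simp add: shift_def X_outside)

text \<open>An interior point sent out of the interior would share its image with the fixed point it
  lands on, contradicting injectivity.\<close>

lemma shift_interior:
  assumes "\<gamma> \<in> X r" "bij (shift \<gamma>)" "x \<in> interior K"
  shows "shift \<gamma> x \<in> interior K"
  using shift_outside[OF assms(1), of "shift \<gamma> x"] assms(2,3) by (metis bij_def injD)

lemma inv_shift_outside:
  assumes "\<gamma> \<in> X r" "bij (shift \<gamma>)" "x \<notin> interior K"
  shows "inv_into UNIV (shift \<gamma>) x = x"
  using shift_outside[OF assms(1,3)] assms(2) by (simp add: bij_def inv_f_eq)

lemma inv_shift_interior: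
  assumes "\<gamma> \<in> X r" "bij (shift \<gamma>)" "x \<in> interior K"
  shows "inv_into UNIV (shift \<gamma>) x \<in> interior K"
  using shift_outside[OF assms(1), of "inv_into UNIV (shift \<gamma>) x"] assms(2,3) by (metis bij_def surj_f_inv_f)

lemma bij_betw_K_if_bij:
  assumes "bij \<phi>" "\<And>x. x \<notin> K \<Longrightarrow> \<phi> x = x"
  shows "bij_betw \<phi> K K"
proof -
  have "\<phi> ` (- K) = - K" using assms(2) by force
  then have "\<phi> ` K = K" using bij_image_Compl_eq[OF assms(1), of K] by auto
  then show ?thesis using assms(1) by (simp add: bij_betw_def bij_def inj_on_def)
qed

lemma bij_if_bij_betw_K:
  assumes "bij_betw \<phi> K K" "\<And>x. x \<notin> K \<Longrightarrow> \<phi> x = x"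
  shows "bij \<phi>"
proof -
  have "bij_betw \<phi> (- K) (- K)"
    using assms(2) bij_betw_id[of "- K"] by (subst bij_betw_cong[of _ _ id]) auto
  from bij_betw_combine[OF assms(1) this] show ?thesis by simp
qed

lemma shift_derivative:
  assumes \<gamma>: "\<gamma> \<in> X r" and r: "1 \<le> r" and x: "x \<in> interior K"
  shows "(shift \<gamma> has_derivative (\<lambda>h. jacobian \<gamma> x *v h)) (at x)"
proof -
  have "(PD K \<gamma> [] has_derivative (\<lambda>h. \<Sum>i\<in>UNIV. (h$i) *\<^sub>R PD K \<gamma> [i] x)) (at x)"
    using jet_deriv[OF X_jet[OF \<gamma>] _ x, of "[]"] r by (simp add: one_enat_def)
  then have "(\<gamma> has_derivative (\<lambda>h. \<Sum>i\<in>UNIV. (h$i) *\<^sub>R PD K \<gamma> [i] x)) (at x)"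
    by (rule has_derivative_transform_within_open[of _ _ _ _ "interior K"])
      (use x PD_Nil[OF \<gamma>] subsetD[OF interior_subset[of K]] in auto)
  from has_derivative_add[OF has_derivative_ident this]
  show ?thesis
    unfolding shift_def[abs_def]
    by (rule has_derivative_eq_rhs)
      (simp add: fun_eq_iff vec_eq_iff jacobian_def matrix_vector_mult_def distrib_left sum.distrib
        if_distrib[where f="\<lambda>c. _ * c"] mult.commute cong: if_cong)
qed

lemma continuous_jacobian:
  assumes \<gamma>: "\<gamma> \<in> X r" and r: "1 \<le> r"
  shows "continuous_on K (\<lambda>x. jacobian \<gamma> x $ l $ i)"
proof -
  have "continuous_on K (PD K \<gamma> [i])"
    using jet_cont[OF X_jet[OF \<gamma>], of "[i]"] r by (simp add: one_enat_def)
  then show ?thesis by (simp add: jacobian_def continuous_on_add bounded_linear.continuous_on[OF bounded_linear_vec_nth])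
qed

definition id_jet :: "'n list \<Rightarrow> real^'n \<Rightarrow> real^'n" where
  "id_jet \<alpha> x = (if \<alpha> = [] then x else if length \<alpha> = 1 then axis (hd \<alpha>) 1 else 0)"

lemma jet_id: "jet K r id_jet"
  unfolding jet_def
proof (intro conjI allI impI ballI)
  fix \<alpha> :: "'n list" and x
  show "continuous_on K (id_jet \<alpha>)"
    by (cases "\<alpha> = []"; cases "length \<alpha> = 1") (auto simp: id_jet_def[abs_def])
  have "h = (\<Sum>i\<in>UNIV. h $ i *\<^sub>R axis i 1)" for h :: "real^'n"
    by (simp add: vec_eq_iff axis_def if_distrib cong: if_cong)
  then show "(id_jet \<alpha> has_derivative (\<lambda>h. \<Sum>i\<in>UNIV. (h$i) *\<^sub>R id_jet (\<alpha> @ [i]) x)) (at x)"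
    by (cases "\<alpha> = []"; cases "length \<alpha> = 1") (auto simp: id_jet_def[abs_def])
qed

lemma jet_shift: "\<gamma> \<in> X r \<Longrightarrow> jet K r (\<lambda>\<alpha> x. id_jet \<alpha> x + PD K \<gamma> \<alpha> x)"
  by (intro jet_add jet_id X_jet)

lemma shift_jet_Nil: "\<gamma> \<in> X r \<Longrightarrow> x \<in> K \<Longrightarrow> shift \<gamma> x = id_jet [] x + PD K \<gamma> [] x"
  by (simp add: id_jet_def PD_Nil shift_def)

lemma Cr_on_shift: "\<gamma> \<in> X r \<Longrightarrow> Cr_on euclidean euclidean r K (shift \<gamma>)"
  by (rule Cr_on_jet[OF jet_shift[of \<gamma> r]]) (assumption, rule shift_jet_Nil)

text \<open>The factor arises because the operator norm of the derivative is at most the sum of the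
  norms of its partial derivatives.\<close>

definition lip_const :: "(real^'n \<Rightarrow> real^'n) \<Rightarrow> real" where "lip_const \<beta> = real CARD('n) * snorm 1 \<beta>"

lemma enat_1_le: "1 \<le> r \<Longrightarrow> enat 1 \<le> r" by (simp add: one_enat_def)

text \<open>The mean value inequality gives the bound on the convex interior and continuity extends
  it to \<open>K\<close>. A segment that leaves \<open>K\<close> may be cut off at the frontier,
  where \<beta> is already 0, as it is beyond.\<close>

lemma X_lipschitz:
  assumes \<beta>: "\<beta> \<in> X r" and r: "1 \<le> r"
  shows "norm (\<beta> x - \<beta> y) \<le> lip_const \<beta> * norm (x - y)"
proof -
  have L0: "0 \<le> lip_const \<beta>" using snorm_nonneg[OF \<beta> enat_1_le[OF r]] by (simp add: lip_const_def)
  have \<beta>K: "continuous_on K \<beta>"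
    using continuous_on_eq[OF jet_cont[OF X_jet[OF \<beta>], of "[]"] PD_Nil[OF \<beta>]]
    by (simp add: zero_enat_def[symmetric])
  have "(lip_const \<beta>)-lipschitz_on (interior K) \<beta>"
  proof (rule lipschitz_onI)
    fix x y assume xy: "x \<in> interior K" "y \<in> interior K"
    have "norm (\<beta> x - \<beta> y) \<le> lip_const \<beta> * norm (x - y)"
    proof (rule differentiable_bound[OF convex_interior[OF convex_K] _ _ xy])
      fix z assume z: "z \<in> interior K"
      have "(PD K \<beta> [] has_derivative (\<lambda>h. \<Sum>i\<in>UNIV. (h$i) *\<^sub>R PD K \<beta> [i] z)) (at z)"
        using jet_deriv[OF X_jet[OF \<beta>] _ z, of "[]"] r by (simp add: one_enat_def)
      then have "(\<beta> has_derivative (\<lambda>h. \<Sum>i\<in>UNIV. (h$i) *\<^sub>R PD K \<beta> [i] z)) (at z)"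
        by (rule has_derivative_transform_within_open[of _ _ _ _ "interior K"])
          (use z PD_Nil[OF \<beta>] subsetD[OF interior_subset[of K]] in auto)
      then show "(\<beta> has_derivative (\<lambda>h. \<Sum>i\<in>UNIV. (h$i) *\<^sub>R PD K \<beta> [i] z)) (at z within interior K)"
        by (rule has_derivative_at_withinI)
      show "onorm (\<lambda>h. \<Sum>i\<in>UNIV. (h$i) *\<^sub>R PD K \<beta> [i] z) \<le> lip_const \<beta>"
      proof (rule onorm_le)
        fix h :: "real^'n"
        have "norm (\<Sum>i\<in>UNIV. (h$i) *\<^sub>R PD K \<beta> [i] z) \<le> (\<Sum>i\<in>(UNIV::'n set). norm h * snorm 1 \<beta>)"
        proof (rule sum_norm_le)
          fix i
          have "norm (PD K \<beta> [i] z) \<le> snorm 1 \<beta>"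
            by (rule norm_PD_le[OF \<beta> enat_1_le[OF r]]) (use z subsetD[OF interior_subset[of K]] in auto)
          then show "norm ((h$i) *\<^sub>R PD K \<beta> [i] z) \<le> norm h * snorm 1 \<beta>"
            by (simp add: component_le_norm_cart mult_mono)
        qed
        also have "\<dots> = lip_const \<beta> * norm h" by (simp add: lip_const_def)
        finally show "norm (\<Sum>i\<in>UNIV. (h$i) *\<^sub>R PD K \<beta> [i] z) \<le> lip_const \<beta> * norm h" .
      qed
    qed
    then show "dist (\<beta> x) (\<beta> y) \<le> lip_const \<beta> * dist x y" by (simp add: dist_norm)
  qed (rule L0)
  from lipschitz_on_closure[OF this] \<beta>K have lip: "(lip_const \<beta>)-lipschitz_on K \<beta>" by (simp add: closure_interior_K)
  have mixed: "norm (\<beta> a - \<beta> b) \<le> lip_const \<beta> * norm (a - b)" if "a \<in> K" "b \<notin> K" for a b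
  proof -
    have "closed_segment a b \<inter> frontier K \<noteq> {}"
      by (rule connected_Int_frontier) (use that in auto)
    then obtain z where z: "z \<in> closed_segment a b" "z \<in> frontier K" by blast
    have zK: "z \<in> K" "z \<notin> interior K" using z(2) compact_K by (auto simp: frontier_def compact_imp_closed)
    have "norm (\<beta> a - \<beta> b) = norm (\<beta> a - \<beta> z)"
      using X_outside[OF \<beta> zK(2)] \<beta> that(2) by (simp add: X_iff)
    also have "\<dots> \<le> lip_const \<beta> * norm (a - z)"
      using lipschitz_onD[OF lip that(1) zK(1)] by (simp add: dist_norm)
    also have "\<dots> \<le> lip_const \<beta> * norm (a - b)"
      using segment_bound(1)[OF z(1)] L0 by (intro mult_left_mono) (auto simp: norm_minus_commute)
    finally show ?thesis .
  qed
  show ?thesis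
  proof (cases "x \<in> K"; cases "y \<in> K")
    assume "x \<in> K" "y \<in> K"
    then show ?thesis using lipschitz_onD[OF lip, of x y] by (simp add: dist_norm)
  next
    assume "x \<notin> K" "y \<in> K"
    then show ?thesis using mixed[of y x] by (simp add: norm_minus_commute)
  next
    assume "x \<notin> K" "y \<notin> K"
    then have "\<beta> x = 0" "\<beta> y = 0" using \<beta> by (auto simp: X_iff)
    then show ?thesis using L0 by simp
  qed (rule mixed)
qed

text \<open>The lower bound holds for difference quotients and so for the Jacobian inside
  \<open>K\<close>. As a non-strict inequality it survives the passage to the boundary, and it
  leaves no room for a kernel.\<close>

lemma det_jacobian_nonzero:
  assumes \<gamma>: "\<gamma> \<in> X r" and r: "1 \<le> r" and c: "0 < c"
    and low: "\<And>a b. c * norm (a - b) \<le> norm (shift \<gamma> a - shift \<gamma> b)" and x: "x \<in> K"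
  shows "det (jacobian \<gamma> x) \<noteq> 0"
proof -
  have int: "c * norm h \<le> norm (jacobian \<gamma> z *v h)" if z: "z \<in> interior K" for z h
  proof -
    have "((\<lambda>t. (1/t) *\<^sub>R (shift \<gamma> (z + t *\<^sub>R h) - shift \<gamma> z)) \<longlongrightarrow> jacobian \<gamma> z *v h) (at 0)"
      using has_dir_deriv_of_derivative[OF shift_derivative[OF \<gamma> r z], of h] by (simp add: has_dir_deriv_def)
    from tendsto_norm[OF this] show ?thesis
    proof (rule tendsto_lowerbound)
      have "c * norm h \<le> norm ((1/t) *\<^sub>R (shift \<gamma> (z + t *\<^sub>R h) - shift \<gamma> z))" if "t \<noteq> 0" for t
        using low[of "z + t *\<^sub>R h" z] that by (simp only: norm_scaleR) (simp add: field_simps)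
      then show "\<forall>\<^sub>F t in at 0. c * norm h \<le> norm ((1/t) *\<^sub>R (shift \<gamma> (z + t *\<^sub>R h) - shift \<gamma> z))"
        by (simp add: eventually_at_filter)
    qed simp
  qed
  have all: "c * norm h \<le> norm (jacobian \<gamma> x *v h)" for h
  proof (rule continuous_ge_on_closure[of "interior K" "\<lambda>x. norm (jacobian \<gamma> x *v h)"])
    show "continuous_on (closure (interior K)) (\<lambda>x. norm (jacobian \<gamma> x *v h))"
      unfolding closure_interior_K matrix_vector_mult_def
      by (intro continuous_on_norm continuous_on_vec_lambda continuous_on_sum continuous_on_mult
          continuous_on_const continuous_jacobian[OF \<gamma> r])
  qed (use x closure_interior_K int in auto)
  have "h = 0" if "jacobian \<gamma> x *v h = 0" for h
    using all[of h] that c by (simp add: mult_le_0_iff)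
  then have "\<exists>B. B ** jacobian \<gamma> x = mat 1" by (simp add: matrix_left_invertible_ker)
  then show ?thesis by (simp add: invertible_det_nz[symmetric] invertible_left_inverse)
qed

end

context param_calculus begin

text \<open>Two orders are kept apart: \<open>m\<close> places the maps in their domain and supplies
  jointly continuous first derivatives, while \<open>A\<close> carries the orders that the inverse
  inherits.\<close>

lemma Csr_inverse_shift:
  assumes \<pi>: "continuous_map P (Cr_bdry_topology m K) \<pi>" and m: "1 \<le> m"
    and A: "\<And>l. Csr s (r + s) (\<lambda>p x. \<pi> p x $ l)"
    and U: "\<And>p. p \<in> topspace P \<Longrightarrow> \<pi> p \<in> Diff_domain m"
  shows "Csr s r (\<lambda>p x. inv_into UNIV (shift (\<pi> p)) x $ l)"
proof (rule Csr_inverse_map[where \<phi>="\<lambda>l p x. x $ l + \<pi> p x $ l"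
      and J="\<lambda>l i p x. (if l = i then 1 else 0) + PD K (\<pi> p) [i] x $ l"])
  note X = Diff_domain_X[OF U] and bij = Diff_domain_bij[OF U]
  have surj: "surj (shift (\<pi> p))" and inj: "inj (shift (\<pi> p))" if "p \<in> topspace P" for p
    using bij[OF that] by (auto simp: bij_def)
  show "Csr s (r + s) (\<lambda>p x. x $ l + \<pi> p x $ l)" for l by (intro Csr_add Csr_coord A)
  have "space_deriv (\<lambda>p x. PD K (\<pi> p) [] x $ l) (\<lambda>i p x. PD K (\<pi> p) [i] x $ l)" for l
    using space_deriv_atom[of \<pi> m "[]" l] X m by (simp add: one_enat_def)
  then have "space_deriv (\<lambda>p x. \<pi> p x $ l) (\<lambda>i p x. PD K (\<pi> p) [i] x $ l)" for l
    by (rule space_deriv_cong[rotated]) (simp add: PD_Nil[OF X])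
  then show "space_deriv (\<lambda>p x. x $ l + \<pi> p x $ l) (\<lambda>i p x. (if l = i then 1 else 0) + PD K (\<pi> p) [i] x $ l)" for l
    unfolding space_deriv_def
    by (auto simp: distrib_left sum.distrib if_distrib[where f="\<lambda>c. _ * c"] cong: if_cong
        intro!: has_derivative_add bounded_linear_imp_has_derivative bounded_linear_vec_nth)
  have "Csr 0 0 (\<lambda>p x. if l = i then 1 else 0)" for l i :: 'n by (rule Csr_const)
  then show "jointly_cont (\<lambda>p x. (if l = i then 1 else 0) + PD K (\<pi> p) [i] x $ l)" for l i
    using jointly_cont_atom[OF \<pi>, of "[i]" l] m Csr_jointly_cont[of 0 0] unfolding jointly_cont_def
    by (intro continuous_map_add) (auto simp: one_enat_def)
  show "det (\<chi> l i. (if l = i then 1 else 0) + PD K (\<pi> p) [i] x $ l) \<noteq> 0"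
    if "p \<in> topspace P" "x \<in> K" for p x
    using U[OF that(1)] that(2) by (simp add: Diff_domain_def jacobian_def)
  have v: "(\<chi> l. x $ l + \<pi> p x $ l) = shift (\<pi> p) x" for p x by (simp add: vec_eq_iff shift_def)
  show "(\<chi> l. inv_into UNIV (shift (\<pi> p)) x $ l + \<pi> p (inv_into UNIV (shift (\<pi> p)) x) $ l) = x" if "p \<in> topspace P" for p x
    unfolding v by (rule surj_f_inv_f[OF surj[OF that]])
  show "inv_into UNIV (shift (\<pi> p)) (\<chi> l. x $ l + \<pi> p x $ l) = x" if "p \<in> topspace P" for p x
    unfolding v by (rule inv_f_f[OF inj[OF that]])
  show "inv_into UNIV (shift (\<pi> p)) x \<in> interior K" if "p \<in> topspace P" "x \<in> interior K" for p x
    by (rule inv_shift_interior[OF X bij]) (use that in auto)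
  show "inv_into UNIV (shift (\<pi> p)) x = x" if "p \<in> topspace P" "x \<notin> interior K" for p x
    by (rule inv_shift_outside[OF X bij]) (use that in auto)
qed

text \<open>The inverse is the identity off the interior, so the cut-off in \<open>to_map\<close>
  agrees with it.\<close>

lemma to_map_inverse_shift:
  assumes "\<And>p. p \<in> topspace P \<Longrightarrow> \<pi> p \<in> Diff_domain m" and p: "p \<in> topspace P"
  shows "to_map (\<lambda>c p x. inv_into UNIV (shift (\<pi> p)) x $ c - x $ c) p = inv_into UNIV (shift (\<pi> p)) - id"
    and "vanishing (\<lambda>c p x. inv_into UNIV (shift (\<pi> p)) x $ c - x $ c)"
proof -
  have out: "inv_into UNIV (shift (\<pi> p)) x = x" if "p \<in> topspace P" "x \<notin> interior K" for p x
    by (rule inv_shift_outside[OF Diff_domain_X Diff_domain_bij]) (use assms(1) that in auto)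
  show "to_map (\<lambda>c p x. inv_into UNIV (shift (\<pi> p)) x $ c - x $ c) p = inv_into UNIV (shift (\<pi> p)) - id"
    using out[OF p] by (auto simp: to_map_def fun_eq_iff vec_eq_iff)
  show "vanishing (\<lambda>c p x. inv_into UNIV (shift (\<pi> p)) x $ c - x $ c)"
    using out by (auto simp: vanishing_def)
qed

end

context convex_body begin

text \<open>A one-point parameter space with constant flow and s = 0 turns the calculus of families
  into a statement on a single map, with no loss of order.\<close>

lemma inverse_X:
  assumes \<gamma>: "\<gamma> \<in> Diff_domain r" and r: "1 \<le> r"
  shows "inv_into UNIV (shift \<gamma>) - id \<in> X r"
proof -
  interpret Q: param_calculus K "discrete_topology UNIV :: unit topology" "\<lambda>j p t. p"
    by unfold_locales (auto intro: exI[of _ "1::real"])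
  have cont: "continuous_map (discrete_topology UNIV :: unit topology) (Cr_bdry_topology r K) (\<lambda>_. \<gamma>)"
    using Diff_domain_X[OF \<gamma>] by simp
  have A: "Q.Csr 0 k (\<lambda>p x. \<gamma> x $ l)" if "enat k \<le> r" for k l
    by (rule Q.Csr_cong[OF _ Q.Csr_atom_constant[OF cont, of "[]" k 0 l]])
      (use that PD_Nil[OF Diff_domain_X[OF \<gamma>]] in auto)
  have "Q.Csr 0 k (\<lambda>p x. inv_into UNIV (shift \<gamma>) x $ c - x $ c)" if "enat k \<le> r" for k c
    by (intro Q.Csr_diff Q.Csr_coord Q.Csr_inverse_shift[OF cont r]) (use A[OF that] \<gamma> in auto)
  then have "Q.to_map (\<lambda>c p x. inv_into UNIV (shift \<gamma>) x $ c - x $ c) () \<in> X r"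
    using Q.to_map_inverse_shift(2)[of "\<lambda>_. \<gamma>" r "()"] \<gamma> by (intro Q.to_map_in_X) auto
  then show ?thesis using Q.to_map_inverse_shift(1)[of "\<lambda>_. \<gamma>" r "()"] \<gamma> by simp
qed

lemma open_Diff_domain:
  assumes r: "1 \<le> r"
  shows "openin (Cr_bdry_topology r K) (Diff_domain r)"
  unfolding openin_Cr_bdry
proof (intro conjI ballI)
  show "Diff_domain r \<subseteq> X r" using Diff_domain_X by blast
  fix \<gamma>0 assume \<gamma>0: "\<gamma>0 \<in> Diff_domain r"
  note X0 = Diff_domain_X[OF \<gamma>0]
  have surj0: "surj (shift \<gamma>0)" and inj0: "inj (shift \<gamma>0)" using Diff_domain_bij[OF \<gamma>0] by (auto simp: bij_def)
  let ?\<psi> = "inv_into UNIV (shift \<gamma>0)"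
  \<comment> \<open>A Lipschitz constant of the inverse of \<open>shift \<gamma>0\<close>, since
    that inverse is the identity plus an element of \<open>X r\<close>.\<close>
  define A where "A = 1 + lip_const (?\<psi> - id)"
  have A: "A > 0"
    using snorm_nonneg[OF inverse_X[OF \<gamma>0 r] enat_1_le[OF r]] by (simp add: A_def lip_const_def add_pos_nonneg)
  have \<psi>L: "norm (?\<psi> z - ?\<psi> w) \<le> A * norm (z - w)" for z w
  proof -
    have "?\<psi> z - ?\<psi> w = (z - w) + ((?\<psi> - id) z - (?\<psi> - id) w)" by simp
    then have "norm (?\<psi> z - ?\<psi> w) \<le> norm (z - w) + norm ((?\<psi> - id) z - (?\<psi> - id) w)"
      by (simp only: norm_triangle_ineq)
    also have "\<dots> \<le> A * norm (z - w)"
      using X_lipschitz[OF inverse_X[OF \<gamma>0 r] r, of z w] by (simp add: A_def distrib_right)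
    finally show ?thesis .
  qed
  \<comment> \<open>Chosen so that \<gamma> - \<gamma>0 has Lipschitz constant at most 1 / (2 A),
    hence at most 1/2 after composition with the inverse.\<close>
  define e where "e = 1 / (2 * A * CARD('n))"
  have e: "e > 0" using A by (simp add: e_def)
  have "\<gamma> \<in> Diff_domain r" if \<gamma>: "\<gamma> \<in> X r" "snorm 1 (\<gamma> - \<gamma>0) < e" for \<gamma>
  proof -
    have dX: "\<gamma> - \<gamma>0 \<in> X r" using X_diff[OF \<gamma>(1) X0] .
    have LA: "lip_const (\<gamma> - \<gamma>0) * A \<le> 1/2"
    proof -
      have "lip_const (\<gamma> - \<gamma>0) \<le> CARD('n) * e" using \<gamma>(2) by (simp add: lip_const_def mult_left_mono)
      also have "\<dots> = 1 / (2 * A)" by (simp add: e_def)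
      finally show ?thesis using A by (simp add: field_simps)
    qed
    \<comment> \<open>\<open>shift \<gamma>\<close> is \<open>shift \<gamma>0\<close> followed by \<open>id + h\<close>, where \<open>h\<close> is a contraction.\<close>
    define h where "h z = (\<gamma> - \<gamma>0) (?\<psi> z)" for z
    have h: "norm (h z - h w) \<le> 1/2 * norm (z - w)" for z w
    proof -
      have "norm (h z - h w) \<le> lip_const (\<gamma> - \<gamma>0) * norm (?\<psi> z - ?\<psi> w)"
        unfolding h_def by (rule X_lipschitz[OF dX r])
      also have "\<dots> \<le> lip_const (\<gamma> - \<gamma>0) * (A * norm (z - w))"
        using snorm_nonneg[OF dX enat_1_le[OF r]] by (intro mult_left_mono \<psi>L) (simp add: lip_const_def)
      also have "\<dots> \<le> 1/2 * norm (z - w)"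
        using mult_right_mono[OF LA, of "norm (z - w)"] by (simp add: mult.assoc)
      finally show ?thesis .
    qed
    have shF: "shift \<gamma> a = shift \<gamma>0 a + h (shift \<gamma>0 a)" for a
    proof -
      have "h (shift \<gamma>0 a) = (\<gamma> - \<gamma>0) a" by (simp only: h_def inv_f_f[OF inj0])
      then show ?thesis by (simp add: shift_def)
    qed
    \<comment> \<open>The perturbation \<open>h\<close> costs at most half of the distance between
      the images under \<open>shift \<gamma>0\<close>. The bound gives injectivity and, through
      \<open>det_jacobian_nonzero\<close>, the condition on the Jacobian.\<close>
    have low: "1 / (2 * A) * norm (a - b) \<le> norm (shift \<gamma> a - shift \<gamma> b)" for a b
    proof -
      let ?z = "shift \<gamma>0 a" and ?w = "shift \<gamma>0 b"
      have "norm (a - b) \<le> A * norm (?z - ?w)"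
        using \<psi>L[of ?z ?w] by (simp add: inv_f_f[OF inj0])
      then have "1 / (2 * A) * norm (a - b) \<le> 1/2 * norm (?z - ?w)" using A by (simp add: field_simps)
      also have "\<dots> \<le> norm (?z - ?w) - norm (h ?z - h ?w)" using h[of ?z ?w] by simp
      also have "\<dots> \<le> norm ((?z - ?w) + (h ?z - h ?w))"
        using norm_diff_ineq by blast
      also have "(?z - ?w) + (h ?z - h ?w) = shift \<gamma> a - shift \<gamma> b" by (simp add: shF)
      finally show ?thesis .
    qed
    have "inj (shift \<gamma>)"
    proof (rule injI)
      fix a b assume "shift \<gamma> a = shift \<gamma> b"
      then have "1 / (2 * A) * norm (a - b) \<le> 0" using low[of a b] by simp
      then show "a = b" using A by (simp add: divide_le_0_iff)
    qed
    moreover have "surj (shift \<gamma>)"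
      unfolding surj_def
    proof
      fix y
      \<comment> \<open>The equation z + h z = y, solved as a fixed point of a contraction, makes id
        + h surjective.\<close>
      have "\<exists>!z. y - h z = z"
      proof (rule banach_fix_type)
        show "\<forall>z w. dist (y - h z) (y - h w) \<le> 1/2 * dist z w"
          using h by (simp add: dist_norm norm_minus_commute)
      qed auto
      then obtain z where "y - h z = z" by blast
      moreover obtain a where "z = shift \<gamma>0 a" using surj0 by (rule surjE)
      ultimately show "\<exists>a. y = shift \<gamma> a" by (metis shF diff_add_cancel)
    qed
    ultimately have "bij (shift \<gamma>)" by (simp add: bij_def)
    moreover have "det (jacobian \<gamma> x) \<noteq> 0" if "x \<in> K" for x
      by (rule det_jacobian_nonzero[OF \<gamma>(1) r _ low that]) (use A in simp)
    ultimately show ?thesis using \<gamma>(1) by (simp add: Diff_domain_def)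
  qed
  then show "\<exists>k e. enat k \<le> r \<and> 0 < e \<and> {g \<in> X r. snorm k (g - \<gamma>0) < e} \<subseteq> Diff_domain r"
    using e enat_1_le[OF r] by blast
qed

lemma frontier_K: "frontier K = K - interior K"
  using compact_K by (simp add: frontier_def compact_imp_closed)

text \<open>From the side of \<open>Diff_domain\<close>, the inverse is C^r by
  \<open>inverse_X\<close>. From the side of the group, the chain rule makes the Jacobians of \<phi>
  and its inverse mutually inverse inside \<open>K\<close>; the product of their determinants is
  continuous, so it equals 1 up to the boundary.\<close>

lemma Diff_bdry_iff:
  assumes r: "1 \<le> r"
  shows "\<phi> \<in> Diff_bdry r K \<longleftrightarrow> \<phi> - id \<in> Diff_domain r"
proof
  assume U: "\<phi> - id \<in> Diff_domain r"
  have \<phi>: "shift (\<phi> - id) = \<phi>" by (simp add: fun_eq_iff shift_def)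
  have bij: "bij \<phi>" using Diff_domain_bij[OF U] \<phi> by simp
  have out: "\<phi> x = x" if "x \<notin> interior K" for x using shift_outside[OF Diff_domain_X[OF U] that] \<phi> by simp
  have outK: "\<phi> x = x" if "x \<notin> K" for x using out that subsetD[OF interior_subset[of K]] by blast
  have bK: "bij_betw \<phi> K K" by (rule bij_betw_K_if_bij[OF bij outK])
  \<comment> \<open>\<open>Diff_bdry\<close> inverts \<phi> on \<open>K\<close> alone; since \<phi>
    is the identity elsewhere, the global inverse agrees with that one on \<open>K\<close>.\<close>
  have inv: "inv_into K \<phi> x = shift (inv_into UNIV \<phi> - id) x" if "x \<in> K" for x
  proof -
    have "inv_into K \<phi> x = inv_into UNIV \<phi> x"
    proof (rule inv_into_f_eq)
      show "inj_on \<phi> K" using bK by (simp add: bij_betw_def)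
      show "\<phi> (inv_into UNIV \<phi> x) = x" using bij by (simp add: bij_def surj_f_inv_f)
      then show "inv_into UNIV \<phi> x \<in> K" using that outK by (cases "inv_into UNIV \<phi> x \<in> K") auto
    qed
    then show ?thesis by (simp add: shift_def)
  qed
  have "inv_into UNIV \<phi> - id \<in> X r" using inverse_X[OF U r] \<phi> by simp
  then have "Cr_on euclidean euclidean r K (inv_into K \<phi>)"
    by (intro Cr_on_jet[OF jet_shift]) (use inv shift_jet_Nil in auto)
  then show "\<phi> \<in> Diff_bdry r K"
    using bK outK out Cr_on_shift[OF Diff_domain_X[OF U]] \<phi> by (simp add: Diff_bdry_def frontier_K)
next
  assume D: "\<phi> \<in> Diff_bdry r K"
  define \<gamma> where "\<gamma> = \<phi> - id"
  have \<phi>: "shift \<gamma> = \<phi>" by (simp add: fun_eq_iff shift_def \<gamma>_def)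
  have bK: "bij_betw \<phi> K K" and outK: "\<And>x. x \<notin> K \<Longrightarrow> \<phi> x = x"
    and C\<phi>: "Cr_on euclidean euclidean r K \<phi>" and C\<psi>: "Cr_on euclidean euclidean r K (inv_into K \<phi>)"
    and fr: "\<And>x. x \<in> frontier K \<Longrightarrow> \<phi> x = x"
    using D by (auto simp: Diff_bdry_def)
  have out: "\<phi> x = x" if "x \<notin> interior K" for x using outK fr that by (cases "x \<in> K") (auto simp: frontier_K)
  have j\<gamma>: "jet K r (\<lambda>\<alpha> x. PD K \<phi> \<alpha> x + (-1) *\<^sub>R id_jet \<alpha> x)"
    by (intro jet_add jet_scale jet_id jet_PD(1) C\<phi>)
  have \<gamma>: "\<gamma> \<in> X r"
    by (rule X_I[OF j\<gamma>]) (use jet_PD(2)[OF C\<phi>] out in \<open>auto simp: \<gamma>_def id_jet_def\<close>)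
  have bij: "bij (shift \<gamma>)" unfolding \<phi> by (rule bij_if_bij_betw_K[OF bK outK])
  define \<psi> where "\<psi> = inv_into K \<phi>"
  define N where "N x = (\<chi> l i. PD K \<psi> [i] x $ l)" for x
  have d\<psi>: "(\<psi> has_derivative (\<lambda>h. N x *v h)) (at x)" if x: "x \<in> interior K" for x
  proof -
    have "(PD K \<psi> [] has_derivative (\<lambda>h. \<Sum>i\<in>UNIV. (h$i) *\<^sub>R PD K \<psi> [i] x)) (at x)"
      using jet_deriv[OF jet_PD(1)[OF C\<psi>[folded \<psi>_def]] _ x, of "[]"] r by (simp add: one_enat_def)
    then have "(\<psi> has_derivative (\<lambda>h. \<Sum>i\<in>UNIV. (h$i) *\<^sub>R PD K \<psi> [i] x)) (at x)"
      by (rule has_derivative_transform_within_open[of _ _ _ _ "interior K"])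
        (use x jet_PD(2)[OF C\<psi>[folded \<psi>_def]] subsetD[OF interior_subset[of K]] in auto)
    then show ?thesis
      by (rule has_derivative_eq_rhs)
        (simp add: fun_eq_iff vec_eq_iff N_def matrix_vector_mult_def mult.commute)
  qed
  have \<psi>\<phi>: "\<psi> (\<phi> x) = x" if "x \<in> K" for x
    using bK that by (simp add: \<psi>_def bij_betw_def inv_into_f_f)
  have NM: "N (\<phi> x) ** jacobian \<gamma> x = mat 1" if x: "x \<in> interior K" for x
  proof -
    have "((\<lambda>x. \<psi> (\<phi> x)) has_derivative (\<lambda>h. N (\<phi> x) *v (jacobian \<gamma> x *v h))) (at x)"
      using shift_derivative[OF \<gamma> r x] d\<psi>[OF shift_interior[OF \<gamma> bij x]] unfolding \<phi> by (rule has_derivative_compose)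
    then have "((\<lambda>x. x) has_derivative (\<lambda>h. N (\<phi> x) *v (jacobian \<gamma> x *v h))) (at x)"
      by (rule has_derivative_transform_within_open[of _ _ _ _ "interior K"])
        (use x \<psi>\<phi> subsetD[OF interior_subset[of K]] in auto)
    then have "(\<lambda>h. N (\<phi> x) *v (jacobian \<gamma> x *v h)) = (\<lambda>h. h)"
      using has_derivative_unique has_derivative_ident by blast
    then have "(N (\<phi> x) ** jacobian \<gamma> x) *v h = mat 1 *v h" for h
      by (simp add: matrix_vector_mul_assoc[symmetric] fun_eq_iff)
    then show ?thesis by (simp add: matrix_eq)
  qed
  have det_cont: "continuous_on K (\<lambda>x. det (M x))" if "\<And>l i. continuous_on K (\<lambda>x. M x $ l $ i)"
    for M :: "real^'n \<Rightarrow> real^'n^'n"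
    unfolding det_def by (intro continuous_on_sum continuous_on_mult continuous_on_const continuous_on_prod that)
  have "det (jacobian \<gamma> x) \<noteq> 0" if x: "x \<in> K" for x
  proof -
    have cN: "continuous_on K (\<lambda>x. N x $ l $ i)" for l i
      using jet_cont[OF jet_PD(1)[OF C\<psi>[folded \<psi>_def]], of "[i]"] r
      by (simp add: N_def bounded_linear.continuous_on[OF bounded_linear_vec_nth] one_enat_def)
    have c\<phi>: "continuous_on K \<phi>" using C\<phi> by (simp add: Cr_on_def)
    have "\<phi> ` K \<subseteq> K" using bK by (simp add: bij_betw_def)
    then have c1: "continuous_on K (\<lambda>x. det (N (\<phi> x)))"
      by (intro continuous_on_compose2[OF det_cont[OF cN] c\<phi>])
    have c2: "continuous_on K (\<lambda>x. det (jacobian \<gamma> x))" by (intro det_cont continuous_jacobian[OF \<gamma> r])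
    have "det (N (\<phi> x)) * det (jacobian \<gamma> x) = 1"
    proof (rule eq_on_K[OF continuous_on_mult[OF c1 c2] continuous_on_const _ x])
      fix z assume "z \<in> interior K"
      from arg_cong[OF NM[OF this], of det] show "det (N (\<phi> z)) * det (jacobian \<gamma> z) = 1"
        by (simp add: det_mul)
    qed
    then show ?thesis by auto
  qed
  then show "\<phi> - id \<in> Diff_domain r" using \<gamma> bij by (simp add: Diff_domain_def \<gamma>_def)
qed

lemma Diff_chart_image: "1 \<le> r \<Longrightarrow> Diff_chart ` Diff_bdry r K = Diff_domain r"
proof
  assume r: "1 \<le> r"
  show "Diff_chart ` Diff_bdry r K \<subseteq> Diff_domain r" using Diff_bdry_iff[OF r] by (auto simp: Diff_chart_def)
  show "Diff_domain r \<subseteq> Diff_chart ` Diff_bdry r K"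
  proof
    fix \<gamma> assume "\<gamma> \<in> Diff_domain r"
    moreover have "Diff_chart (shift \<gamma>) = \<gamma>" "shift \<gamma> - id = \<gamma>" by (simp_all add: Diff_chart_def fun_eq_iff shift_def)
    ultimately show "\<gamma> \<in> Diff_chart ` Diff_bdry r K" using Diff_bdry_iff[OF r] by (metis imageI)
  qed
qed

lemma inj_Diff_chart: "inj_on Diff_chart A"
  by (rule inj_onI) (simp add: Diff_chart_def fun_eq_iff)

lemma inv_Diff_chart:
  assumes "1 \<le> r" "\<gamma> \<in> Diff_domain r"
  shows "inv_into (Diff_bdry r K) Diff_chart \<gamma> = shift \<gamma>"
proof (rule inv_into_f_eq[OF inj_Diff_chart])
  have "shift \<gamma> - id = \<gamma>" by (simp add: fun_eq_iff shift_def)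
  then show "shift \<gamma> \<in> Diff_bdry r K" "Diff_chart (shift \<gamma>) = \<gamma>"
    using assms Diff_bdry_iff by (simp_all add: Diff_chart_def)
qed

end

section \<open>The manifold of diffeomorphisms\<close>

context convex_body begin

lemma X_antimono:
  assumes "r \<le> m"
  shows "X m \<subseteq> X r"
proof
  fix f assume f: "f \<in> X m"
  show "f \<in> X r"
    by (rule X_I[OF jet_mono[OF X_jet[OF f] assms]]) (simp_all add: PD_Nil[OF f] X_outside[OF f])
qed

lemma topspace_Diff_manifold:
  assumes "1 \<le> r"
  shows "topspace (mtop (Diff_manifold r K)) = Diff_bdry r K"
  using Diff_chart_image[OF assms] Diff_domain_X
  by (auto simp: Diff_manifold_def topspace_pullback_topology)

lemma openin_Diff_manifold:
  assumes r: "1 \<le> r"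
  shows "openin (mtop (Diff_manifold r K)) V \<longleftrightarrow>
    V \<subseteq> Diff_bdry r K \<and> openin (Cr_bdry_topology r K) (Diff_chart ` V)"
proof
  assume "openin (mtop (Diff_manifold r K)) V"
  then obtain W where W: "openin (Cr_bdry_topology r K) W" "V = Diff_chart -` W \<inter> Diff_bdry r K"
    by (auto simp: Diff_manifold_def openin_pullback_topology)
  then have "Diff_chart ` V = W \<inter> Diff_chart ` Diff_bdry r K" by blast
  then have "Diff_chart ` V = W \<inter> Diff_domain r" by (simp only: Diff_chart_image[OF r])
  then show "V \<subseteq> Diff_bdry r K \<and> openin (Cr_bdry_topology r K) (Diff_chart ` V)"
    using W open_Diff_domain[OF r] by auto
next
  assume V: "V \<subseteq> Diff_bdry r K \<and> openin (Cr_bdry_topology r K) (Diff_chart ` V)"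
  then have "V = Diff_chart -` (Diff_chart ` V) \<inter> Diff_bdry r K"
    using inj_onD[OF inj_Diff_chart[of UNIV]] by auto
  then show "openin (mtop (Diff_manifold r K)) V"
    using V by (auto simp: Diff_manifold_def openin_pullback_topology)
qed

lemma homeomorphic_Diff_chart:
  assumes r: "1 \<le> r"
  shows "homeomorphic_map (mtop (Diff_manifold r K)) (subtopology (Cr_bdry_topology r K) (Diff_domain r)) Diff_chart"
  unfolding homeomorphic_map_def quotient_map_def
proof (intro conjI allI impI)
  let ?M = "mtop (Diff_manifold r K)" and ?T = "subtopology (Cr_bdry_topology r K) (Diff_domain r)"
  have U: "Diff_domain r \<subseteq> X r" using Diff_domain_X by blast
  show "Diff_chart ` topspace ?M = topspace ?T"
    using Diff_chart_image[OF r] U by (auto simp: topspace_Diff_manifold[OF r])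
  show "inj_on Diff_chart (topspace ?M)" by (rule inj_Diff_chart)
  fix W assume W: "W \<subseteq> topspace ?T"
  let ?V = "{\<phi> \<in> topspace ?M. Diff_chart \<phi> \<in> W}"
  have "Diff_chart ` ?V = W" using W Diff_chart_image[OF r] by (auto simp: topspace_Diff_manifold[OF r])
  moreover have "openin ?T W \<longleftrightarrow> openin (Cr_bdry_topology r K) W"
    using W by (simp add: openin_open_subtopology[OF open_Diff_domain[OF r]])
  ultimately show "openin ?M ?V = openin ?T W"
    by (auto simp: openin_Diff_manifold[OF r] topspace_Diff_manifold[OF r])
qed

lemma continuous_Diff_chart:
  assumes "1 \<le> r"
  shows "continuous_map (mtop (Diff_manifold r K)) (subtopology (Cr_bdry_topology r K) (Diff_domain r)) Diff_chart"
  using homeomorphic_imp_continuous_map[OF homeomorphic_Diff_chart[OF assms]] .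

lemma continuous_into_Diff_manifold:
  assumes "continuous_map M (Cr_bdry_topology r K) (Diff_chart \<circ> F)" "F ` topspace M \<subseteq> Diff_bdry r K"
  shows "continuous_map M (mtop (Diff_manifold r K)) F"
  unfolding Diff_manifold_def using assms by (auto intro: continuous_map_pullback')

lemma open_calculus_Diff_domain:
  assumes "1 \<le> r"
  shows "open_calculus K (Cr_bdry_topology r K) (Diff_domain r)"
  using subspace_X continuous_add_Cr_bdry continuous_scaleR_Cr_bdry open_Diff_domain[OF assms]
  by unfold_locales

text \<open>The only transition map is the identity of \<open>Diff_domain r\<close>, and evaluation
  has parameter derivatives of every order.\<close>

lemma smooth_chart_change:
  assumes r: "1 \<le> r"
  shows "Cr_on_open (Cr_bdry_topology r K) (Cr_bdry_topology r K) \<infinity> (Diff_domain r)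
    (Diff_chart \<circ> inv_into (Diff_bdry r K) Diff_chart)"
proof -
  interpret Q: open_calculus K "Cr_bdry_topology r K" "Diff_domain r" by (rule open_calculus_Diff_domain[OF r])
  show ?thesis
  proof (rule Q.Cr_on_open_to_map[where G="\<lambda>c p x. fst p x $ c"])
    show "Q.Csr s' r' (\<lambda>p x. fst p x $ c)" if "enat r' \<le> r" for s' r' c
      by (rule Q.Csr_eval_linear[of r "\<lambda>u. u"]) (use that in simp_all)
    show "Q.vanishing (\<lambda>c p x. fst p x $ c)"
      by (auto simp: Q.vanishing_def Q.topspace_Pt X_outside[OF Diff_domain_X[of _ r]])
    show "(Diff_chart \<circ> inv_into (Diff_bdry r K) Diff_chart) u = Q.to_map (\<lambda>c p x. fst p x $ c) (u, y)"
      if "(u, y) \<in> topspace Q.Pt" for u y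
    proof -
      have u: "u \<in> Diff_domain r" using that by (simp add: Q.topspace_Pt)
      show ?thesis
        using X_outside[OF Diff_domain_X[OF u]]
        by (auto simp: fun_eq_iff inv_Diff_chart[OF r u] Diff_chart_def shift_def Q.to_map_def)
    qed
  qed
qed

lemma smooth_manifold_Diff:
  assumes r: "1 \<le> r"
  shows "smooth_manifold (Diff_manifold r K)"
proof -
  have "Hausdorff_space (mtop (Diff_manifold r K))"
    using homeomorphic_Hausdorff_space[OF homeomorphic_map_imp_homeomorphic_space[OF homeomorphic_Diff_chart[OF r]]]
      Hausdorff_space_subtopology[OF Hausdorff_Cr_bdry] by blast
  moreover have "openin (mtop (Diff_manifold r K)) (Diff_bdry r K)"
    by (metis openin_topspace topspace_Diff_manifold[OF r])
  moreover have "subtopology (mtop (Diff_manifold r K)) (Diff_bdry r K) = mtop (Diff_manifold r K)"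
    by (metis subtopology_topspace topspace_Diff_manifold[OF r])
  ultimately show ?thesis
    unfolding smooth_manifold_def
    using topspace_Diff_manifold[OF r] locally_convex_Cr_bdry open_Diff_domain[OF r] homeomorphic_Diff_chart[OF r]
      smooth_chart_change[OF r]
    by (simp add: Diff_manifold_def Diff_chart_image[OF r])
qed

text \<open>With one chart on each side the chart expression contains everything, since its
  continuity gives that of \<open>F\<close>. The source is left general because composition starts
  from a product manifold.\<close>

lemma Cr_manifold_map_into_Diff:
  assumes atl: "atlas M = {(V, \<kappa>)}" and V: "topspace (mtop M) = V"
    and \<kappa>: "continuous_map (mtop M) (subtopology (model M) (\<kappa> ` V)) \<kappa>" and inj: "inj_on \<kappa> V"
    and F: "\<And>v. v \<in> V \<Longrightarrow> F v \<in> Diff_bdry r K"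
    and C: "Cr_on_open (model M) (Cr_bdry_topology r K) s (\<kappa> ` V) (Diff_chart \<circ> F \<circ> inv_into V \<kappa>)"
  shows "Cr_manifold_map s M (Diff_manifold r K) F"
proof -
  have "continuous_map (subtopology (model M) (\<kappa> ` V)) (Cr_bdry_topology r K) (Diff_chart \<circ> F \<circ> inv_into V \<kappa>)"
    using C by (simp add: Cr_on_open_def)
  from continuous_map_compose[OF \<kappa> this]
  have "continuous_map (mtop M) (Cr_bdry_topology r K) (Diff_chart \<circ> F)"
    by (rule continuous_map_eq) (use inj V in simp)
  then have "continuous_map (mtop M) (mtop (Diff_manifold r K)) F"
    by (rule continuous_into_Diff_manifold) (use F V in auto)
  moreover have "{v \<in> V. F v \<in> Diff_bdry r K} = V" using F by blast
  ultimately show ?thesis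
    using C by (simp add: Cr_manifold_map_def atl Diff_manifold_def)
qed

text \<open>In \<open>Diff_domain\<close> the order enters only through \<open>X\<close>;
  bijectivity and the Jacobian condition do not refer to it.\<close>

lemma Diff_bdry_mono:
  assumes "1 \<le> r" "r \<le> m"
  shows "Diff_bdry m K \<subseteq> Diff_bdry r K"
proof
  fix \<phi> assume "\<phi> \<in> Diff_bdry m K"
  then have "\<phi> - id \<in> Diff_domain m" using Diff_bdry_iff[of m \<phi>] assms by simp
  moreover have "X m \<subseteq> X r" using assms(2) by (rule X_antimono)
  ultimately have "\<phi> - id \<in> Diff_domain r" by (auto simp: Diff_domain_def)
  then show "\<phi> \<in> Diff_bdry r K" using Diff_bdry_iff assms by blast
qed

text \<open>This is composition in the charts, with the outer map \<eta> paying the s extra space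
  orders. The parameter space is an explicit argument so that the lemma serves both a one-point
  space and the parameters of \<open>open_calculus\<close>.\<close>

lemma Csr_comp_shift:
  assumes "param_calculus K P fl"
    and \<gamma>: "\<And>c. param_calculus.Csr K P fl s r (\<lambda>p x. \<gamma> p x $ c)"
    and \<eta>: "\<And>c. param_calculus.Csr K P fl s (r + s) (\<lambda>p x. \<eta> p x $ c)"
    and U: "\<And>p. p \<in> topspace P \<Longrightarrow> \<gamma> p \<in> Diff_domain m"
  shows "param_calculus.Csr K P fl s r (\<lambda>p x. \<gamma> p x $ c + \<eta> p (shift (\<gamma> p) x) $ c)"
proof -
  interpret Q: param_calculus K P fl by fact
  have v: "(\<chi> l. x $ l + \<gamma> p x $ l) = shift (\<gamma> p) x" for p x by (simp add: vec_eq_iff shift_def)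
  have "Q.Csr s r (\<lambda>p x. (\<lambda>p x. \<eta> p x $ c) p (\<chi> l. x $ l + \<gamma> p x $ l))"
    by (rule Q.Csr_comp[OF \<eta> Q.Csr_add[OF Q.Csr_coord \<gamma>]], unfold v)
      (use shift_interior[OF Diff_domain_X[OF U] Diff_domain_bij[OF U]] shift_outside[OF Diff_domain_X[OF U]] in blast)+
  then show ?thesis by (intro Q.Csr_add \<gamma>) (simp add: v)
qed

text \<open>Order r comes from the calculus over a one-point space with s = 0, and the Jacobian
  condition from multiplying lower Lipschitz bounds of the two factors.\<close>

lemma Diff_bdry_comp:
  assumes r: "1 \<le> r" and \<psi>: "\<psi> \<in> Diff_bdry r K" and \<phi>: "\<phi> \<in> Diff_bdry r K"
  shows "\<psi> \<circ> \<phi> \<in> Diff_bdry r K"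
proof -
  define \<gamma> \<eta> where "\<gamma> = \<phi> - id" and "\<eta> = \<psi> - id"
  have \<gamma>: "\<gamma> \<in> Diff_domain r" and \<eta>: "\<eta> \<in> Diff_domain r" using \<phi> \<psi> Diff_bdry_iff[OF r] by (simp_all add: \<gamma>_def \<eta>_def)
  have "shift \<gamma> = \<phi>" "shift \<eta> = \<psi>" by (simp_all add: fun_eq_iff shift_def \<gamma>_def \<eta>_def)
  interpret Q: param_calculus K "discrete_topology UNIV :: unit topology" "\<lambda>j p t. p"
    by unfold_locales (auto intro: exI[of _ "1::real"])
  have A: "Q.Csr 0 k (\<lambda>p x. \<beta> x $ l)" if k: "enat k \<le> r" and \<beta>: "\<beta> \<in> X r" for k l \<beta>
    by (rule Q.Csr_cong[OF _ Q.Csr_atom_constant[of r "\<lambda>_. \<beta>" "[]" k 0 l]])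
      (use k \<beta> PD_Nil[OF \<beta>] in auto)
  define G where "G = (\<lambda>c (p::unit) x. \<gamma> x $ c + \<eta> (shift \<gamma> x) $ c)"
  have G: "Q.Csr 0 k (G c)" if "enat k \<le> r" for k c
    unfolding G_def by (rule Csr_comp_shift[OF Q.param_calculus_axioms])
      (use A[OF that] Diff_domain_X[OF \<gamma>] Diff_domain_X[OF \<eta>] \<gamma> in auto)
  have out: "\<gamma> x + \<eta> (shift \<gamma> x) = 0" if "x \<notin> interior K" for x
    using X_outside[OF Diff_domain_X[OF \<gamma>] that] X_outside[OF Diff_domain_X[OF \<eta>] that] by (simp add: shift_def)
  have van: "Q.vanishing G"
    using out by (auto simp: Q.vanishing_def G_def simp flip: vector_add_component)
  have "Q.to_map G () = (\<psi> \<circ> \<phi>) - id"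
  proof
    fix x
    have "((\<psi> \<circ> \<phi>) - id) x = \<gamma> x + \<eta> (shift \<gamma> x)" by (simp add: \<gamma>_def \<eta>_def shift_def)
    then show "Q.to_map G () x = ((\<psi> \<circ> \<phi>) - id) x"
      using out by (simp add: Q.to_map_def G_def vec_eq_iff)
  qed
  then have X: "(\<psi> \<circ> \<phi>) - id \<in> X r" using Q.to_map_in_X[where p="()" and r=r, OF G van] by simp
  have s: "shift ((\<psi> \<circ> \<phi>) - id) = \<psi> \<circ> \<phi>" by (simp add: fun_eq_iff shift_def)
  have bij: "bij (\<psi> \<circ> \<phi>)"
    using Diff_domain_bij[OF \<gamma>] Diff_domain_bij[OF \<eta>] \<open>shift \<gamma> = \<phi>\<close> \<open>shift \<eta> = \<psi>\<close> by (simp add: bij_comp)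
  have i\<gamma>: "inv_into UNIV (shift \<gamma>) - id \<in> X r" and i\<eta>: "inv_into UNIV (shift \<eta>) - id \<in> X r"
    using inverse_X[OF _ r] \<gamma> \<eta> by auto
  \<comment> \<open>The reciprocal of the product of Lipschitz constants of the two
    inverses.\<close>
  define c where "c = 1 / ((1 + lip_const (inv_into UNIV \<phi> - id)) * (1 + lip_const (inv_into UNIV \<psi> - id)))"
  have L0: "0 \<le> lip_const \<beta>" if "\<beta> \<in> X r" for \<beta>
    using snorm_nonneg[OF that enat_1_le[OF r]] by (simp add: lip_const_def)
  have low: "norm (a - b) \<le> (1 + lip_const (inv_into UNIV \<theta> - id)) * norm (\<theta> a - \<theta> b)"
    if \<theta>: "bij \<theta>" "inv_into UNIV \<theta> - id \<in> X r" for \<theta> a b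
  proof -
    have "a - b = (\<theta> a - \<theta> b) + ((inv_into UNIV \<theta> - id) (\<theta> a) - (inv_into UNIV \<theta> - id) (\<theta> b))"
      using \<theta>(1) by (simp add: bij_def inv_f_f)
    then have "norm (a - b) \<le> norm (\<theta> a - \<theta> b) + norm ((inv_into UNIV \<theta> - id) (\<theta> a) - (inv_into UNIV \<theta> - id) (\<theta> b))"
      by (metis norm_triangle_ineq)
    also have "\<dots> \<le> (1 + lip_const (inv_into UNIV \<theta> - id)) * norm (\<theta> a - \<theta> b)"
      using X_lipschitz[OF \<theta>(2) r, of "\<theta> a" "\<theta> b"] by (simp add: distrib_right)
    finally show ?thesis .
  qed
  have i\<phi>: "inv_into UNIV \<phi> - id \<in> X r" "bij \<phi>" and i\<psi>: "inv_into UNIV \<psi> - id \<in> X r" "bij \<psi>"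
    using i\<gamma> i\<eta> Diff_domain_bij[OF \<gamma>] Diff_domain_bij[OF \<eta>] \<open>shift \<gamma> = \<phi>\<close> \<open>shift \<eta> = \<psi>\<close> by auto
  have "det (jacobian ((\<psi> \<circ> \<phi>) - id) x) \<noteq> 0" if x: "x \<in> K" for x
  proof (rule det_jacobian_nonzero[OF X r _ _ x])
    show "0 < c" using L0[OF i\<phi>(1)] L0[OF i\<psi>(1)] by (simp add: c_def add_pos_nonneg)
    fix a b
    have "norm (a - b) \<le> (1 + lip_const (inv_into UNIV \<phi> - id)) * norm (\<phi> a - \<phi> b)" by (rule low[OF i\<phi>(2,1)])
    also have "\<dots> \<le> (1 + lip_const (inv_into UNIV \<phi> - id)) * ((1 + lip_const (inv_into UNIV \<psi> - id)) * norm (\<psi> (\<phi> a) - \<psi> (\<phi> b)))"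
      using L0[OF i\<phi>(1)] by (intro mult_left_mono low[OF i\<psi>(2,1)]) auto
    finally show "c * norm (a - b) \<le> norm (shift ((\<psi> \<circ> \<phi>) - id) a - shift ((\<psi> \<circ> \<phi>) - id) b)"
      unfolding s c_def using L0[OF i\<phi>(1)] L0[OF i\<psi>(1)]
      by (simp add: pos_divide_le_eq add_pos_nonneg mult_ac)
  qed
  then show ?thesis using Diff_bdry_iff[OF r] X bij s by (simp add: Diff_domain_def)
qed

text \<open>The lower Lipschitz bound for the inverse is the upper bound
  \<open>1 + lip_const \<gamma>\<close> for \<phi> read backwards.\<close>

lemma Diff_bdry_inv:
  assumes r: "1 \<le> r" and \<phi>: "\<phi> \<in> Diff_bdry r K"
  shows "inv_into UNIV \<phi> \<in> Diff_bdry r K"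
proof -
  define \<gamma> where "\<gamma> = \<phi> - id"
  have \<gamma>: "\<gamma> \<in> Diff_domain r" using \<phi> Diff_bdry_iff[OF r] by (simp add: \<gamma>_def)
  have shift: "shift \<gamma> = \<phi>" by (simp add: fun_eq_iff shift_def \<gamma>_def)
  have X: "inv_into UNIV \<phi> - id \<in> X r" using inverse_X[OF \<gamma> r] shift by simp
  have bij: "bij \<phi>" using Diff_domain_bij[OF \<gamma>] shift by simp
  have s: "shift (inv_into UNIV \<phi> - id) = inv_into UNIV \<phi>" by (simp add: fun_eq_iff shift_def)
  have L0: "0 \<le> lip_const \<gamma>" using snorm_nonneg[OF Diff_domain_X[OF \<gamma>] enat_1_le[OF r]] by (simp add: lip_const_def)
  have "det (jacobian (inv_into UNIV \<phi> - id) x) \<noteq> 0" if x: "x \<in> K" for x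
  proof (rule det_jacobian_nonzero[OF X r _ _ x])
    show "0 < 1 / (1 + lip_const \<gamma>)" using L0 by simp
    fix a b
    have "a - b = (inv_into UNIV \<phi> a - inv_into UNIV \<phi> b) + (\<gamma> (inv_into UNIV \<phi> a) - \<gamma> (inv_into UNIV \<phi> b))"
      using bij by (simp add: \<gamma>_def bij_def surj_f_inv_f)
    then have "norm (a - b) \<le> norm (inv_into UNIV \<phi> a - inv_into UNIV \<phi> b) + norm (\<gamma> (inv_into UNIV \<phi> a) - \<gamma> (inv_into UNIV \<phi> b))"
      by (metis norm_triangle_ineq)
    also have "\<dots> \<le> (1 + lip_const \<gamma>) * norm (inv_into UNIV \<phi> a - inv_into UNIV \<phi> b)"
      using X_lipschitz[OF Diff_domain_X[OF \<gamma>] r, of "inv_into UNIV \<phi> a" "inv_into UNIV \<phi> b"] by (simp add: distrib_right)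
    finally show "1 / (1 + lip_const \<gamma>) * norm (a - b) \<le> norm (shift (inv_into UNIV \<phi> - id) a - shift (inv_into UNIV \<phi> - id) b)"
      unfolding s using L0 by (simp add: pos_divide_le_eq mult.commute)
  qed
  then show ?thesis using Diff_bdry_iff[OF r] X bij s by (simp add: Diff_domain_def bij_imp_bij_inv)
qed

lemma Cr_inversion:
  assumes r: "1 \<le> r"
  shows "Cr_manifold_map s (Diff_manifold (r + s) K) (Diff_manifold r K) (\<lambda>\<phi>. inv_into UNIV \<phi>)"
proof -
  let ?m = "r + s"
  have m: "1 \<le> ?m" using r by (simp add: add_increasing2)
  have rm: "r \<le> ?m" by simp
  interpret Q: open_calculus K "Cr_bdry_topology ?m K" "Diff_domain ?m" by (rule open_calculus_Diff_domain[OF m])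
  have \<pi>: "continuous_map Q.Pt (Cr_bdry_topology ?m K) (\<lambda>p. fst p)"
    by (rule Q.continuous_L_fst[of ?m "\<lambda>u. u"]) simp_all
  have U: "fst p \<in> Diff_domain ?m" if "p \<in> topspace Q.Pt" for p using that by (auto simp: Q.topspace_Pt)
  have C: "Cr_on_open (Cr_bdry_topology ?m K) (Cr_bdry_topology r K) s (Diff_domain ?m)
      (Diff_chart \<circ> inv_into UNIV \<circ> inv_into (Diff_bdry ?m K) Diff_chart)"
  proof (rule Q.Cr_on_open_to_map[where G="\<lambda>c p x. inv_into UNIV (shift (fst p)) x $ c - x $ c"])
    show "Q.Csr s' r' (\<lambda>p x. inv_into UNIV (shift (fst p)) x $ c - x $ c)" if "enat s' \<le> s" "enat r' \<le> r" for c s' r'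
    proof (intro Q.Csr_diff Q.Csr_coord Q.Csr_inverse_shift[OF \<pi> m _ U])
      \<comment> \<open>Each parameter derivative of the inverse consumes a space order of \<gamma>;
        the budget suffices because r' + s' \<le> r + s.\<close>
      show "Q.Csr s' (r' + s') (\<lambda>p x. fst p x $ l)" for l
      proof (rule Q.Csr_eval_linear[of ?m "\<lambda>u. u"])
        show "enat (r' + s') \<le> ?m" using add_mono[OF that(2,1)] by simp
      qed simp_all
    qed
    show "Q.vanishing (\<lambda>c p x. inv_into UNIV (shift (fst p)) x $ c - x $ c)"
      unfolding Q.vanishing_def using inv_shift_outside[OF Diff_domain_X[OF U] Diff_domain_bij[OF U]] by auto
    fix u y assume p: "(u, y) \<in> topspace Q.Pt"
    then have u: "u \<in> Diff_domain ?m" by (simp add: Q.topspace_Pt)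
    show "(Diff_chart \<circ> inv_into UNIV \<circ> inv_into (Diff_bdry ?m K) Diff_chart) u
        = Q.to_map (\<lambda>c p x. inv_into UNIV (shift (fst p)) x $ c - x $ c) (u, y)"
      using inv_shift_outside[OF Diff_domain_X[OF u] Diff_domain_bij[OF u]]
      by (auto simp: inv_Diff_chart[OF m u] Diff_chart_def Q.to_map_def fun_eq_iff vec_eq_iff)
  qed
  show ?thesis
  proof (rule Cr_manifold_map_into_Diff)
    show "atlas (Diff_manifold ?m K) = {(Diff_bdry ?m K, Diff_chart)}" by (simp add: Diff_manifold_def)
    show "topspace (mtop (Diff_manifold ?m K)) = Diff_bdry ?m K" by (rule topspace_Diff_manifold[OF m])
    show "continuous_map (mtop (Diff_manifold ?m K))
       (subtopology (model (Diff_manifold ?m K)) (Diff_chart ` Diff_bdry ?m K)) Diff_chart"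
      using continuous_Diff_chart[OF m] by (simp add: Diff_chart_image[OF m]) (simp add: Diff_manifold_def)
    show "inv_into UNIV \<phi> \<in> Diff_bdry r K" if "\<phi> \<in> Diff_bdry ?m K" for \<phi>
      using Diff_bdry_inv[OF r] Diff_bdry_mono[OF r rm] that by blast
    show "Cr_on_open (model (Diff_manifold ?m K)) (Cr_bdry_topology r K) s (Diff_chart ` Diff_bdry ?m K)
       (Diff_chart \<circ> inv_into UNIV \<circ> inv_into (Diff_bdry ?m K) Diff_chart)"
      using C by (simp add: Diff_chart_image[OF m]) (simp add: Diff_manifold_def)
  qed (rule inj_Diff_chart)
qed

lemma Cr_composition:
  assumes r: "1 \<le> r"
  shows "Cr_manifold_map s (prod_manifold (Diff_manifold (r + s) K) (Diff_manifold r K)) (Diff_manifold r K)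
    (\<lambda>(\<psi>, \<phi>). \<psi> \<circ> \<phi>)"
proof -
  let ?m = "r + s"
  have m: "1 \<le> ?m" using r by (simp add: add_increasing2)
  have rm: "r \<le> ?m" by simp
  let ?T1 = "Cr_bdry_topology ?m K" and ?T2 = "Cr_bdry_topology r K"
  let ?T = "prod_topology ?T1 ?T2" and ?U = "Diff_domain ?m \<times> Diff_domain r"
  have op: "openin ?T ?U" using open_Diff_domain[OF m] open_Diff_domain[OF r] by (simp add: openin_prod_Times_iff)
  \<comment> \<open>Both factors move at once, so the parameters lie in a product of two spaces of
    maps of different order.\<close>
  interpret Q: open_calculus K ?T ?U
  proof
    show "subspace (topspace ?T)"
      using subspace_Times[OF subspace_X subspace_X] by simp
    have a: "continuous_map (prod_topology ?T ?T) (Cr_bdry_topology k K) (\<lambda>p. h (fst p) + h (snd p))"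
      if "continuous_map ?T (Cr_bdry_topology k K) h" for h k
    proof -
      have "continuous_map (prod_topology ?T ?T) (prod_topology (Cr_bdry_topology k K) (Cr_bdry_topology k K))
          (\<lambda>p. (h (fst p), h (snd p)))"
        by (intro continuous_map_pairedI continuous_map_compose[OF continuous_map_fst that, unfolded o_def]
            continuous_map_compose[OF continuous_map_snd that, unfolded o_def])
      from continuous_map_compose[OF this continuous_add_Cr_bdry] show ?thesis by (simp add: o_def)
    qed
    show "continuous_map (prod_topology ?T ?T) ?T (\<lambda>(x, y). x + y)"
      using continuous_map_pairedI[OF a[OF continuous_map_fst] a[OF continuous_map_snd]]
      by (simp add: case_prod_unfold plus_prod_def)
    have b: "continuous_map (prod_topology euclideanreal ?T) (Cr_bdry_topology k K) (\<lambda>p. fst p *\<^sub>R h (snd p))"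
      if "continuous_map ?T (Cr_bdry_topology k K) h" for h k
    proof -
      have "continuous_map (prod_topology euclideanreal ?T) (prod_topology euclideanreal (Cr_bdry_topology k K))
          (\<lambda>p. (fst p, h (snd p)))"
        by (intro continuous_map_pairedI continuous_map_fst
            continuous_map_compose[OF continuous_map_snd that, unfolded o_def])
      from continuous_map_compose[OF this continuous_scaleR_Cr_bdry] show ?thesis by (simp add: o_def)
    qed
    show "continuous_map (prod_topology euclideanreal ?T) ?T (\<lambda>(c, x). c *\<^sub>R x)"
      using continuous_map_pairedI[OF b[OF continuous_map_fst] b[OF continuous_map_snd]]
      by (simp add: case_prod_unfold scaleR_prod_def)
    show "openin ?T ?U" by (rule op)
  qed
  let ?V = "Diff_bdry ?m K \<times> Diff_bdry r K" and ?\<kappa> = "map_prod Diff_chart Diff_chart"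
  have im: "?\<kappa> ` ?V = ?U" using Diff_chart_image[OF m] Diff_chart_image[OF r] by (simp add: map_prod_surj_on[OF refl refl])
  have inj: "inj_on ?\<kappa> ?V" by (intro map_prod_inj_on inj_Diff_chart)
  have inv: "inv_into ?V ?\<kappa> (\<eta>, \<gamma>) = (shift \<eta>, shift \<gamma>)" if "\<eta> \<in> Diff_domain ?m" "\<gamma> \<in> Diff_domain r" for \<eta> \<gamma>
  proof (rule inv_into_f_eq[OF inj])
    have e: "shift \<beta> - id = \<beta>" for \<beta> by (simp add: fun_eq_iff shift_def)
    then show "(shift \<eta>, shift \<gamma>) \<in> ?V" using that Diff_bdry_iff[OF m] Diff_bdry_iff[OF r] by simp
    show "?\<kappa> (shift \<eta>, shift \<gamma>) = (\<eta>, \<gamma>)" using e by (simp add: Diff_chart_def)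
  qed
  have U: "fst (fst p) \<in> Diff_domain ?m" "snd (fst p) \<in> Diff_domain r" if "p \<in> topspace Q.Pt" for p
    using that by (auto simp: Q.topspace_Pt)
  define G where "G = (\<lambda>c (p :: ((real^'n \<Rightarrow> real^'n) \<times> (real^'n \<Rightarrow> real^'n)) \<times> (nat \<Rightarrow> (real^'n \<Rightarrow> real^'n) \<times> (real^'n \<Rightarrow> real^'n))) x.
     snd (fst p) x $ c + fst (fst p) (shift (snd (fst p)) x) $ c)"
  have out: "\<gamma> x + \<eta> (shift \<gamma> x) = 0" if "\<gamma> \<in> Diff_domain r" "\<eta> \<in> Diff_domain ?m" "x \<notin> interior K" for x \<gamma> \<eta>
    using X_outside[OF Diff_domain_X[OF that(1)] that(3)] X_outside[OF Diff_domain_X[OF that(2)] that(3)] by (simp add: shift_def)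
  have C: "Cr_on_open ?T ?T2 s ?U (Diff_chart \<circ> (\<lambda>(\<psi>, \<phi>). \<psi> \<circ> \<phi>) \<circ> inv_into ?V ?\<kappa>)"
  proof (rule Q.Cr_on_open_to_map[where G=G])
    show "Q.Csr s' r' (G c)" if "enat s' \<le> s" "enat r' \<le> r" for c s' r'
      unfolding G_def
    proof (rule Csr_comp_shift[OF Q.param_calculus_axioms])
      \<comment> \<open>Evaluation in a factor is \<open>Csr_eval_linear\<close> for a projection.
        The right factor supplies r' space orders; the left one has order r + s and pays for
        derivatives in the right one.\<close>
      show "Q.Csr s' r' (\<lambda>p x. snd (fst p) x $ c)" for c
        by (rule Q.Csr_eval_linear[of r snd]) (use that in \<open>simp_all add: continuous_map_snd\<close>)
      show "Q.Csr s' (r' + s') (\<lambda>p x. fst (fst p) x $ c)" for c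
      proof (rule Q.Csr_eval_linear[of ?m fst])
        show "enat (r' + s') \<le> ?m" using add_mono[OF that(2,1)] by simp
      qed (simp_all add: continuous_map_fst)
    qed (rule U)
    show "Q.vanishing G"
      using out U by (auto simp: Q.vanishing_def G_def simp flip: vector_add_component)
    fix u y assume p: "(u, y) \<in> topspace Q.Pt"
    obtain \<eta> \<gamma> where u: "u = (\<eta>, \<gamma>)" by fastforce
    have \<eta>: "\<eta> \<in> Diff_domain ?m" and \<gamma>: "\<gamma> \<in> Diff_domain r" using p by (auto simp: Q.topspace_Pt u)
    show "(Diff_chart \<circ> (\<lambda>(\<psi>, \<phi>). \<psi> \<circ> \<phi>) \<circ> inv_into ?V ?\<kappa>) u = Q.to_map G (u, y)"
    proof
      fix x
      have "(Diff_chart \<circ> (\<lambda>(\<psi>, \<phi>). \<psi> \<circ> \<phi>) \<circ> inv_into ?V ?\<kappa>) u x = \<gamma> x + \<eta> (shift \<gamma> x)"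
        by (simp add: u inv[OF \<eta> \<gamma>] Diff_chart_def) (simp add: shift_def)
      then show "(Diff_chart \<circ> (\<lambda>(\<psi>, \<phi>). \<psi> \<circ> \<phi>) \<circ> inv_into ?V ?\<kappa>) u x = Q.to_map G (u, y) x"
        using out[OF \<gamma> \<eta>] by (simp add: Q.to_map_def G_def u vec_eq_iff)
    qed
  qed
  let ?M = "prod_manifold (Diff_manifold ?m K) (Diff_manifold r K)"
  show ?thesis
  proof (rule Cr_manifold_map_into_Diff)
    show "atlas ?M = {(?V, ?\<kappa>)}" by (auto simp: prod_manifold_def Diff_manifold_def)
    show "topspace (mtop ?M) = ?V"
      using topspace_Diff_manifold[OF m] topspace_Diff_manifold[OF r] by (simp add: prod_manifold_def)
    have mod: "model ?M = ?T" by (simp add: prod_manifold_def Diff_manifold_def)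
    have "continuous_map (prod_topology (mtop (Diff_manifold ?m K)) (mtop (Diff_manifold r K)))
        (prod_topology (subtopology ?T1 (Diff_domain ?m)) (subtopology ?T2 (Diff_domain r)))
        (\<lambda>p. (Diff_chart (fst p), Diff_chart (snd p)))"
      by (intro continuous_map_pairedI
          continuous_map_compose[OF continuous_map_fst continuous_Diff_chart[OF m], unfolded o_def]
          continuous_map_compose[OF continuous_map_snd continuous_Diff_chart[OF r], unfolded o_def])
    then show "continuous_map (mtop ?M) (subtopology (model ?M) (?\<kappa> ` ?V)) ?\<kappa>"
      unfolding mod im by (simp add: prod_manifold_def subtopology_Times map_prod_def case_prod_unfold)
    show "inj_on ?\<kappa> ?V" by (rule inj)
    show "(\<lambda>(\<psi>, \<phi>). \<psi> \<circ> \<phi>) v \<in> Diff_bdry r K" if "v \<in> ?V" for v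
      using that Diff_bdry_comp[OF r] Diff_bdry_mono[OF r rm] by auto
    show "Cr_on_open (model ?M) ?T2 s (?\<kappa> ` ?V) (Diff_chart \<circ> (\<lambda>(\<psi>, \<phi>). \<psi> \<circ> \<phi>) \<circ> inv_into ?V ?\<kappa>)"
      unfolding mod im by (rule C)
  qed
qed

text \<open>In the chart the map is \<eta> -> \<gamma> + \<eta> o \<phi>, affine in \<eta>. As
  \<phi> is fixed, \<open>Csr_comp_constant\<close> applies for every parameter order.\<close>

lemma smooth_right_translation:
  assumes r: "1 \<le> r" and \<phi>: "\<phi> \<in> Diff_bdry r K"
  shows "Cr_manifold_map \<infinity> (Diff_manifold r K) (Diff_manifold r K) (\<lambda>\<psi>. \<psi> \<circ> \<phi>)"
proof -
  interpret Q: open_calculus K "Cr_bdry_topology r K" "Diff_domain r" by (rule open_calculus_Diff_domain[OF r])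
  define \<gamma> where "\<gamma> = \<phi> - id"
  have \<gamma>: "\<gamma> \<in> Diff_domain r" using \<phi> Diff_bdry_iff[OF r] by (simp add: \<gamma>_def)
  have shift: "shift \<gamma> = \<phi>" by (simp add: fun_eq_iff shift_def \<gamma>_def)
  note \<phi>int = shift_interior[OF Diff_domain_X[OF \<gamma>] Diff_domain_bij[OF \<gamma>], unfolded shift]
    and \<phi>out = shift_outside[OF Diff_domain_X[OF \<gamma>], unfolded shift]
  have U: "fst p \<in> Diff_domain r" if "p \<in> topspace Q.Pt" for p using that by (auto simp: Q.topspace_Pt)
  define G where "G = (\<lambda>c (p :: (real^'n \<Rightarrow> real^'n) \<times> (nat \<Rightarrow> real^'n \<Rightarrow> real^'n)) x.
      \<gamma> x $ c + fst p (\<phi> x) $ c)"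
  have Csr\<gamma>: "Q.Csr s' r' (\<lambda>p x. \<gamma> x $ c)" if "enat r' \<le> r" for s' r' c
    by (rule Q.Csr_cong[OF _ Q.Csr_atom_constant[of r "\<lambda>_. \<gamma>" "[]" r' s' c]])
      (use that Diff_domain_X[OF \<gamma>] PD_Nil[OF Diff_domain_X[OF \<gamma>]] in auto)
  have out: "\<gamma> x + \<eta> (\<phi> x) = 0" if "\<eta> \<in> Diff_domain r" "x \<notin> interior K" for x \<eta>
    using X_outside[OF Diff_domain_X[OF \<gamma>] that(2)] X_outside[OF Diff_domain_X[OF that(1)] that(2)] \<phi>out[OF that(2)] by simp
  have C: "Cr_on_open (Cr_bdry_topology r K) (Cr_bdry_topology r K) \<infinity> (Diff_domain r)
      (Diff_chart \<circ> (\<lambda>\<psi>. \<psi> \<circ> \<phi>) \<circ> inv_into (Diff_bdry r K) Diff_chart)"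
  proof (rule Q.Cr_on_open_to_map[where G=G])
    show "Q.Csr s' r' (G c)" if "enat r' \<le> r" for c s' r'
    proof -
      have v: "(\<chi> l. x $ l + \<gamma> x $ l) = \<phi> x" for x by (simp add: vec_eq_iff \<gamma>_def)
      have "Q.Csr s' r' (\<lambda>p x. (\<lambda>p x. fst p x $ c) p (\<chi> l. x $ l + \<gamma> x $ l))"
      proof (rule Q.Csr_comp_constant)
        show "Q.Csr s' r' (\<lambda>p x. fst p x $ c)"
          by (rule Q.Csr_eval_linear[of r "\<lambda>u. u"]) (use that in simp_all)
        show "Q.Csr s' r' (\<lambda>p x. x $ l + \<gamma> x $ l)" for l
          by (intro Q.Csr_add Q.Csr_coord Csr\<gamma> that)
      qed (use \<phi>int \<phi>out in \<open>auto simp: v\<close>)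
      then show ?thesis unfolding G_def by (intro Q.Csr_add Csr\<gamma> that) (simp add: v)
    qed
    show "Q.vanishing G"
      using out U by (auto simp: Q.vanishing_def G_def simp flip: vector_add_component)
    fix u y assume p: "(u, y) \<in> topspace Q.Pt"
    then have u: "u \<in> Diff_domain r" by (simp add: Q.topspace_Pt)
    show "(Diff_chart \<circ> (\<lambda>\<psi>. \<psi> \<circ> \<phi>) \<circ> inv_into (Diff_bdry r K) Diff_chart) u = Q.to_map G (u, y)"
    proof
      fix x
      have "(Diff_chart \<circ> (\<lambda>\<psi>. \<psi> \<circ> \<phi>) \<circ> inv_into (Diff_bdry r K) Diff_chart) u x = \<gamma> x + u (\<phi> x)"
        by (simp add: inv_Diff_chart[OF r u] Diff_chart_def shift_def \<gamma>_def)
      then show "(Diff_chart \<circ> (\<lambda>\<psi>. \<psi> \<circ> \<phi>) \<circ> inv_into (Diff_bdry r K) Diff_chart) u x = Q.to_map G (u, y) x"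
        using out[OF u] by (simp add: Q.to_map_def G_def vec_eq_iff)
    qed
  qed
  show ?thesis
  proof (rule Cr_manifold_map_into_Diff)
    show "atlas (Diff_manifold r K) = {(Diff_bdry r K, Diff_chart)}" by (simp add: Diff_manifold_def)
    show "topspace (mtop (Diff_manifold r K)) = Diff_bdry r K" by (rule topspace_Diff_manifold[OF r])
    show "continuous_map (mtop (Diff_manifold r K))
       (subtopology (model (Diff_manifold r K)) (Diff_chart ` Diff_bdry r K)) Diff_chart"
      using continuous_Diff_chart[OF r] by (simp add: Diff_chart_image[OF r]) (simp add: Diff_manifold_def)
    show "\<psi> \<circ> \<phi> \<in> Diff_bdry r K" if "\<psi> \<in> Diff_bdry r K" for \<psi>
      by (rule Diff_bdry_comp[OF r that \<phi>])
    show "Cr_on_open (model (Diff_manifold r K)) (Cr_bdry_topology r K) \<infinity> (Diff_chart ` Diff_bdry r K)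
       (Diff_chart \<circ> (\<lambda>\<psi>. \<psi> \<circ> \<phi>) \<circ> inv_into (Diff_bdry r K) Diff_chart)"
      using C by (simp add: Diff_chart_image[OF r]) (simp add: Diff_manifold_def)
  qed (rule inj_Diff_chart)
qed

section \<open>The group structure\<close>

lemma Diff_bdry_bij:
  assumes "\<phi> \<in> Diff_bdry r K"
  shows "bij \<phi>"
  using assms by (intro bij_if_bij_betw_K) (auto simp: Diff_bdry_def)

lemma group_Diff:
  assumes r: "1 \<le> r"
  shows "group (Diff_group r K)"
proof (rule groupI)
  \<comment> \<open>The chart sends the identity to 0, where the Jacobian is the unit
    matrix.\<close>
  have "id - id = (0 :: real^'n \<Rightarrow> real^'n)" by simp
  moreover have "0 \<in> Diff_domain r"
  proof -
    have "shift 0 = id" by (simp add: fun_eq_iff shift_def)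
    moreover have "det (jacobian 0 x) \<noteq> 0" if "x \<in> K" for x
    proof -
      have "jacobian 0 x = mat 1" using that by (simp add: jacobian_def PD_zero mat_def)
      then show ?thesis by simp
    qed
    ultimately show ?thesis using X_zero by (simp add: Diff_domain_def)
  qed
  ultimately show "\<one>\<^bsub>Diff_group r K\<^esub> \<in> carrier (Diff_group r K)"
    using Diff_bdry_iff[OF r, of id] by (simp add: Diff_group_def)
  fix \<phi> assume \<phi>: "\<phi> \<in> carrier (Diff_group r K)"
  then have "inv_into UNIV \<phi> \<circ> \<phi> = id" using Diff_bdry_bij[of \<phi> r] by (simp add: Diff_group_def bij_def)
  then show "\<exists>\<psi>\<in>carrier (Diff_group r K). \<psi> \<otimes>\<^bsub>Diff_group r K\<^esub> \<phi> = \<one>\<^bsub>Diff_group r K\<^esub>"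
    using Diff_bdry_inv[OF r] \<phi> by (intro bexI[of _ "inv_into UNIV \<phi>"]) (auto simp: Diff_group_def)
qed (auto simp: Diff_group_def Diff_bdry_comp[OF r] comp_assoc)

text \<open>Continuity of both operations is the case s = 0 of the C^s statements, where the two
  orders coincide.\<close>

lemma topological_group_Diff:
  assumes r: "1 \<le> r"
  shows "topological_group (Diff_group r K) (mtop (Diff_manifold r K))"
  unfolding topological_group_def
proof (intro conjI)
  interpret G: group "Diff_group r K" by (rule group_Diff[OF r])
  show "group (Diff_group r K)" by (rule group_Diff[OF r])
  show "topspace (mtop (Diff_manifold r K)) = carrier (Diff_group r K)"
    by (simp add: topspace_Diff_manifold[OF r] Diff_group_def)
  show "continuous_map (prod_topology (mtop (Diff_manifold r K)) (mtop (Diff_manifold r K)))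
     (mtop (Diff_manifold r K)) (\<lambda>(x, y). x \<otimes>\<^bsub>Diff_group r K\<^esub> y)"
    using Cr_composition[OF r, of 0] by (simp add: Cr_manifold_map_def prod_manifold_def Diff_group_def)
  have "continuous_map (mtop (Diff_manifold r K)) (mtop (Diff_manifold r K)) (\<lambda>\<phi>. inv_into UNIV \<phi>)"
    using Cr_inversion[OF r, of 0] by (simp add: Cr_manifold_map_def)
  then show "continuous_map (mtop (Diff_manifold r K)) (mtop (Diff_manifold r K)) (m_inv (Diff_group r K))"
  proof (rule continuous_map_eq)
    fix \<phi> assume "\<phi> \<in> topspace (mtop (Diff_manifold r K))"
    then have \<phi>: "\<phi> \<in> Diff_bdry r K" by (simp add: topspace_Diff_manifold[OF r])
    then have "inv_into UNIV \<phi> \<circ> \<phi> = id" using Diff_bdry_bij[of \<phi> r] by (simp add: bij_def)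
    then show "inv_into UNIV \<phi> = m_inv (Diff_group r K) \<phi>"
      using G.inv_equality[of "inv_into UNIV \<phi>" \<phi>] \<phi> Diff_bdry_inv[OF r \<phi>] by (simp add: Diff_group_def)
  qed
qed

end

theorem mainTheorem6:
  fixes K :: "(real^'n) set"
  assumes "compact K" and "convex K" and "interior K \<noteq> {}"
  shows
    "(\<forall>r::enat. 1 \<le> r \<longrightarrow> smooth_manifold (Diff_manifold r K)) \<and>
     (\<forall>r::nat. 1 \<le> r \<longrightarrow>
        smooth_Banach_manifold (Diff_manifold (enat r) K) \<and>
        global_chart (Diff_manifold (enat r) K) Diff_chart \<and>
        topological_group (Diff_group (enat r) K) (mtop (Diff_manifold (enat r) K)) \<and>
        (\<forall>\<phi>\<in>Diff_bdry (enat r) K.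
           Cr_manifold_map \<infinity> (Diff_manifold (enat r) K) (Diff_manifold (enat r) K)
             (\<lambda>\<psi>. \<psi> \<circ> \<phi>))) \<and>
     (\<forall>(r::enat) (s::enat). 1 \<le> r \<longrightarrow>
        Cr_manifold_map s
          (prod_manifold (Diff_manifold (r + s) K) (Diff_manifold r K)) (Diff_manifold r K)
          (\<lambda>(\<psi>, \<phi>). \<psi> \<circ> \<phi>) \<and>
        Cr_manifold_map s (Diff_manifold (r + s) K) (Diff_manifold r K)
          (\<lambda>\<phi>. inv_into UNIV \<phi>))"
proof -
  interpret convex_body K using assms by unfold_locales
  have "1 \<le> enat r" if "1 \<le> r" for r using that by (simp add: one_enat_def)
  moreover have "global_chart (Diff_manifold r K) Diff_chart" if "1 \<le> r" for r
    using topspace_Diff_manifold[OF that] by (simp add: global_chart_def) (simp add: Diff_manifold_def)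
  moreover have "Banach_space (model (Diff_manifold (enat r) K))" for r
    using Banach_Cr_bdry by (simp add: Diff_manifold_def)
  ultimately show ?thesis
    unfolding smooth_Banach_manifold_def
    using smooth_manifold_Diff topological_group_Diff smooth_right_translation Cr_composition Cr_inversion
    by blast
qed

end
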